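(* For integers $m\ge 1$ and $n\ge 0$, the quasisymmetric function $\mathscr{LMF}(L_{m,n})$ is a positive sum of Young quasisymmetric Schur functions. In particular, $$\mathscr{LMF}(L_{m,n})=\sum_{\alpha\in\mathrm{comp}(m,n)}\hat{\mathscr{S}}_{\alpha},$$ where $\mathrm{comp}(m,n)$ is the set of compositions $(\alpha_1,\alpha_2,\ldots,\alpha_{m-1},n,n-1,\ldots,2,1)$ such that $[\alpha_1,\ldots,\alpha_{m-1}]$ is a permutation of the integers in the interval $[n+1,n+m-1]$.
   Context: **Maximum length chains.** $\mathfrak{S}_N$ is the set of permutations of $[N]$; $s_i$ is the adjacent transposition, $w\circ s_i$ swaps the entries of $w$ in positions $i,i+1$. The (right) weak order has covers $u\lessdot u\circ s_i$ when $u(i)<u(i+1)$. $\omega_0^{(N)}=[N,\ldots,1]$; a reduced word of $w$ is a minimal-length sequence $i_1\cdots i_\ell$ with $w=s_{i_1}\circ\cdots\circ s_{i_\ell}$. A reduced word $\sigma=\sigma_1\cdots\sigma_M$ of $\omega_0^{(N)}$, $M=\binom N2$, corresponds to the maximal chain $w^{(k)}=s_{\sigma_1}\circ\cdots\circ s_{\sigma_k}$, $0\le k\le M$. $L_{m,n}$ is the graph on $[m+n]$ which is the complete graph on $\{1,\ldots,m\}$ together with the path $m,m+1,\ldots,m+n$. For a graph $G$ on $[N]$, $w$ is a $G$-permutation if for every $i$, $w(i)$ lies in the same component as $\max\{w(1),\ldots,w(i)\}$ of the induced subgraph $G|_{\{w(1),\ldots,w(i)\}}$. The tubing lattice $\mathfrak{L}(L_{m,n})$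 is the subposet of the weak order on $\mathfrak{S}_{m+n}$ induced by the $L_{m,n}$-permutations. $\mathcal{LMR}(L_{m,n})$ is the set of reduced words of $\omega_0^{(m+n)}$ whose chain of permutations is a chain of maximum length in $\mathfrak{L}(L_{m,n})$. **Quasisymmetric functions.** For a composition $\alpha=(\alpha_1,\ldots,\alpha_l)$ of $d$, $\mathrm{set}(\alpha)=\{\alpha_1,\alpha_1+\alpha_2,\ldots,\alpha_1+\cdots+\alpha_{l-1}\}$. The fundamental quasisymmetric function is $Q_{S,d}=Q_\alpha=\sum x_{i_1}x_{i_2}\cdots x_{i_d}$ with $S=\mathrm{set}(\alpha)$, over sequences of positive integers $i_1\le i_2\le\cdots\le i_d$ with $i_s\ne i_{s+1}$ for all $s\in S$. For a word $\sigma$ of length $|\sigma|$, $\mathrm{Des}(\sigma)=\{i:\sigma_i>\sigma_{i+1}\}$. Define $$\mathscr{LMF}(L_{m,n})=\sum_{\sigma\in\mathcal{LMR}(L_{m,n})}Q_{\mathrm{Des}(\sigma),|\sigma|}.$$ **Young quasisymmetric Schur functions.** The diagram of a composition $\alpha$ has left-justified rows, row $i$ from the top having $\alpha_i$ cells. A standard Young column tableau (SYCT) $\tau$ of shape $\alpha$ is a filling of the diagram with $1,\ldots,|\alpha|$, each used once, such that: rows increase left to right; the first column increases from top to bottom; and whenever $i>j$, $(j,k+1)$ is a cell of $\alpha$ and $\tau(i,k)\le\tau(j,k+1)$, then $\tau(i,k+1)<\tau(j,k+1)$ (with $\tau=\infty$ at positions outside the diagram). Its descent set is $\mathrm{Des}(\tau)=\{i: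 i+1\text{ lies in a column weakly to the left of the column of }i\}$. Then $\hat{\mathscr{S}}_\alpha=\sum_\beta\hat d_{\alpha,\beta}Q_\beta$, where $\beta$ ranges over compositions of $|\alpha|$ and $\hat d_{\alpha,\beta}$ is the number of SYCT $\tau$ of shape $\alpha$ with $\mathrm{Des}(\tau)=\mathrm{set}(\beta)$. *)

theory Defs
  imports
    "HOL-Library.Extended_Nat"
    "HOL-Library.Function_Algebras"
    "HOL-Library.Multiset"
    "HOL-Combinatorics.Permutations"
    "HOL-Combinatorics.Multiset_Permutations"
begin

section \<open>Permutations, reduced words and the weak order\<close>

text \<open>
  Elements of the symmetric group on \<open>[N]\<close> are functions \<open>w :: nat \<Rightarrow> nat\<close> with
  \<open>w permutes {1..N}\<close>, so they are the identity outside \<open>{1..N}\<close>.  The word notation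
  is \<open>[w 1, \<dots>, w N]\<close>, and \<open>w \<circ> adj i\<close> swaps its entries in positions \<open>i\<close> and \<open>i + 1\<close>.
\<close>

definition adj :: "nat \<Rightarrow> nat \<Rightarrow> nat" where
  "adj i = transpose i (i + 1)"

definition word_perm :: "nat list \<Rightarrow> nat \<Rightarrow> nat" where
  "word_perm \<sigma> = foldr (\<lambda>i w. adj i \<circ> w) \<sigma> id"

definition long_perm :: "nat \<Rightarrow> nat \<Rightarrow> nat" where
  "long_perm N i = (if i \<in> {1..N} then N + 1 - i else i)"

definition reduced_word :: "nat \<Rightarrow> (nat \<Rightarrow> nat) \<Rightarrow> nat list \<Rightarrow> bool" where
  "reduced_word N w \<sigma> \<longleftrightarrow>
     \<sigma> \<in> lists {1..<N} \<and> word_perm \<sigma> = w \<and>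
     (\<forall>\<sigma>' \<in> lists {1..<N}. word_perm \<sigma>' = w \<longrightarrow> length \<sigma> \<le> length \<sigma>')"

definition weak_covers :: "nat \<Rightarrow> (nat \<Rightarrow> nat) \<Rightarrow> (nat \<Rightarrow> nat) \<Rightarrow> bool" where
  "weak_covers N u v \<longleftrightarrow>
     u permutes {1..N} \<and> (\<exists>i \<in> {1..<N}. u i < u (i + 1) \<and> v = u \<circ> adj i)"

definition weak_le :: "nat \<Rightarrow> (nat \<Rightarrow> nat) \<Rightarrow> (nat \<Rightarrow> nat) \<Rightarrow> bool" where
  "weak_le N = (weak_covers N)\<^sup>*\<^sup>*"

definition word_chain :: "nat list \<Rightarrow> (nat \<Rightarrow> nat) set" where
  "word_chain \<sigma> = {word_perm (take k \<sigma>) | k. k \<le> length \<sigma>}"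

section \<open>Graph permutations and chains of maximum length\<close>

text \<open>A graph on \<open>[N]\<close> is given by its (symmetric, irreflexive) adjacency relation.\<close>

definition same_component :: "('a \<Rightarrow> 'a \<Rightarrow> bool) \<Rightarrow> 'a set \<Rightarrow> 'a \<Rightarrow> 'a \<Rightarrow> bool" where
  "same_component E U x y \<longleftrightarrow>
     x \<in> U \<and> y \<in> U \<and> (\<lambda>a b. a \<in> U \<and> b \<in> U \<and> E a b)\<^sup>*\<^sup>* x y"

definition graph_perm :: "nat \<Rightarrow> (nat \<Rightarrow> nat \<Rightarrow> bool) \<Rightarrow> (nat \<Rightarrow> nat) \<Rightarrow> bool" where
  "graph_perm N E w \<longleftrightarrow>
     w permutes {1..N} \<and>
     (\<forall>i \<in> {1..N}. same_component E (w ` {1..i}) (w i) (Max (w ` {1..i})))"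

definition lollipop :: "nat \<Rightarrow> nat \<Rightarrow> nat \<Rightarrow> nat \<Rightarrow> bool" where
  "lollipop m n u v \<longleftrightarrow>
     u \<in> {1..m + n} \<and> v \<in> {1..m + n} \<and> u \<noteq> v \<and>
     (u \<le> m \<and> v \<le> m \<or> m \<le> u \<and> m \<le> v \<and> (v = u + 1 \<or> u = v + 1))"

definition chain_in :: "('a \<Rightarrow> 'a \<Rightarrow> bool) \<Rightarrow> 'a set \<Rightarrow> 'a set \<Rightarrow> bool" where
  "chain_in le P C \<longleftrightarrow> C \<subseteq> P \<and> (\<forall>x \<in> C. \<forall>y \<in> C. le x y \<or> le y x)"

definition max_length_chain :: "('a \<Rightarrow> 'a \<Rightarrow> bool) \<Rightarrow> 'a set \<Rightarrow> 'a set \<Rightarrow> bool" where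
  "max_length_chain le P C \<longleftrightarrow>
     finite C \<and> chain_in le P C \<and>
     (\<forall>D. finite D \<and> chain_in le P D \<longrightarrow> card D \<le> card C)"

definition LMR :: "nat \<Rightarrow> nat \<Rightarrow> nat list set" where
  "LMR m n = {\<sigma>. reduced_word (m + n) (long_perm (m + n)) \<sigma> \<and>
     max_length_chain (weak_le (m + n)) {w. graph_perm (m + n) (lollipop m n) w}
       (word_chain \<sigma>)}"

section \<open>Quasisymmetric functions\<close>

text \<open>
  A formal power series in \<open>x\<^sub>1, x\<^sub>2, \<dots>\<close> is given by its coefficients; the monomial
  \<open>x\<^bsub>i\<^sub>1\<^esub> \<cdots> x\<^bsub>i\<^sub>d\<^esub>\<close> is encoded by the multiset of its indices.  Sums are the
  pointwise ones of Function-Algebras; the pointwise product there is not the product of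
  power series and is not used.
\<close>

type_synonym power_series = "nat multiset \<Rightarrow> int"

definition scale :: "nat \<Rightarrow> power_series \<Rightarrow> power_series" where
  "scale c f = (\<lambda>\<mu>. int c * f \<mu>)"

text \<open>
  Meant for \<open>S \<subseteq> {1..<d}\<close>.  The sequence \<open>i\<^sub>1, \<dots>, i\<^sub>d\<close> is the list \<open>xs\<close>, whose indexing
  starts at 0, so \<open>i\<^sub>s\<close> is \<open>xs ! (s - 1)\<close>.
\<close>

definition fundamental_qsym :: "nat set \<Rightarrow> nat \<Rightarrow> power_series" where
  "fundamental_qsym S d = (\<lambda>\<mu>. int (card {xs :: nat list.
     length xs = d \<and> (\<forall>x \<in> set xs. 1 \<le> x) \<and> sorted xs \<and>
     (\<forall>s \<in> S. xs ! (s - 1) \<noteq> xs ! s) \<and> mset xs = \<mu>}))"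

definition word_descents :: "nat list \<Rightarrow> nat set" where
  "word_descents \<sigma> = {i. 1 \<le> i \<and> i < length \<sigma> \<and> \<sigma> ! (i - 1) > \<sigma> ! i}"

definition LMF :: "nat \<Rightarrow> nat \<Rightarrow> power_series" where
  "LMF m n = (\<Sum>\<sigma> \<in> LMR m n. fundamental_qsym (word_descents \<sigma>) (length \<sigma>))"

definition compositions :: "nat \<Rightarrow> nat list set" where
  "compositions d = {\<alpha>. (\<forall>a \<in> set \<alpha>. 1 \<le> a) \<and> sum_list \<alpha> = d}"

definition comp_set :: "nat list \<Rightarrow> nat set" where
  "comp_set \<alpha> = {sum_list (take j \<alpha>) | j. 1 \<le> j \<and> j < length \<alpha>}"

section \<open>Young quasisymmetric Schur functions\<close>

definition diagram :: "nat list \<Rightarrow> (nat \<times> nat) set" where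
  "diagram \<alpha> = {(i, k). 1 \<le> i \<and> i \<le> length \<alpha> \<and> 1 \<le> k \<and> k \<le> \<alpha> ! (i - 1)}"

text \<open>Fillings take the value \<open>\<infinity>\<close> outside the diagram.\<close>

definition SYCT :: "nat list \<Rightarrow> (nat \<times> nat \<Rightarrow> enat) set" where
  "SYCT \<alpha> = {\<tau>.
     bij_betw \<tau> (diagram \<alpha>) (enat ` {1..sum_list \<alpha>}) \<and>
     (\<forall>p. p \<notin> diagram \<alpha> \<longrightarrow> \<tau> p = \<infinity>) \<and>
     (\<forall>i k. (i, k) \<in> diagram \<alpha> \<and> (i, k + 1) \<in> diagram \<alpha> \<longrightarrow> \<tau> (i, k) < \<tau> (i, k + 1)) \<and>
     (\<forall>i. (i, 1) \<in> diagram \<alpha> \<and> (i + 1, 1) \<in> diagram \<alpha> \<longrightarrow> \<tau> (i, 1) < \<tau> (i + 1, 1)) \<and>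
     (\<forall>i j k. 1 \<le> j \<and> j < i \<and> 1 \<le> k \<and> (j, k + 1) \<in> diagram \<alpha> \<and> \<tau> (i, k) \<le> \<tau> (j, k + 1)
        \<longrightarrow> \<tau> (i, k + 1) < \<tau> (j, k + 1))}"

definition tableau_descents :: "nat list \<Rightarrow> (nat \<times> nat \<Rightarrow> enat) \<Rightarrow> nat set" where
  "tableau_descents \<alpha> \<tau> = {i. \<exists>r c r' c'. (r, c) \<in> diagram \<alpha> \<and> (r', c') \<in> diagram \<alpha> \<and>
     \<tau> (r, c) = enat i \<and> \<tau> (r', c') = enat (i + 1) \<and> c' \<le> c}"

definition YQS :: "nat list \<Rightarrow> power_series" where
  "YQS \<alpha> = (\<Sum>\<beta> \<in> compositions (sum_list \<alpha>).
     scale (card {\<tau> \<in> SYCT \<alpha>. tableau_descents \<alpha> \<tau> = comp_set \<beta>})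
       (fundamental_qsym (comp_set \<beta>) (sum_list \<beta>)))"

definition YQS_positive :: "power_series \<Rightarrow> bool" where
  "YQS_positive f \<longleftrightarrow> (\<exists>A c. finite A \<and> A \<subseteq> (\<Union>d. compositions d) \<and>
     (\<forall>\<alpha> \<in> A. 0 < c \<alpha>) \<and> f = (\<Sum>\<alpha> \<in> A. scale (c \<alpha>) (YQS \<alpha>)))"

definition comp_mn :: "nat \<Rightarrow> nat \<Rightarrow> nat list set" where
  "comp_mn m n = {as @ rev [1..<n + 1] | as. as \<in> permutations_of_set {n + 1..n + m - 1}}"

end

theory Submission
  imports Defs
begin

text \<open>
  Both sides are matched with words \<open>c\<close> of column indices.  Edelman--Greene insertion sends a
  reduced word of the longest permutation to the word of columns in which its recording tableau
  grows; this is a bijection onto the lattice words with \<open>N - k\<close> letters \<open>k\<close> and it preserves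
  descents.  A standard Young column tableau is also determined by the columns of \<open>1, 2, \<dots>\<close>:
  letter \<open>1\<close> appends a row of length 1 at the bottom, and letter \<open>k + 1\<close> extends the lowest row of
  length \<open>k\<close>.

  Chains of maximum length in the tubing lattice are the reduced words all of whose prefixes are
  graph permutations \<open>w\<close>.  For such \<open>w\<close> the rows \<open>m, m + 1, \<dots>\<close> of the insertion tableau have the
  lengths \<open>|{y. x < y, y before x in w}|\<close>, \<open>x = m, m + 1, \<dots>\<close>, and each of these rows, if nonempty,
  is shorter than all rows above it.  Going backwards from the longest permutation, the first prefix
  that is not a graph permutation violates this strictness.  On the tableau side the same condition
  on all column heights says that the final composition ends in \<open>n, \<dots>, 2, 1\<close>.
\<close>

section \<open>Inversions and reduced words\<close>

text \<open>Row lengths of an insertion tableau are hard to compute directly, so they are trapped by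
  counting. An increasing word moves any value to the left at most once; therefore the rows of index
  \<open>i\<close> and more (from 0) have at least the sum over \<open>y\<close> of
  \<open>lcode w y - i\<close> cells, in truncated subtraction. The invariant \<open>full\<close>,
  which a graph permutation hands down to the prefix one letter shorter, bounds this sum from below
  by the sum of \<open>rcode w x\<close> over \<open>x > i\<close>. These are only inequalities: the
  exact lengths are known at the staircase and carried back one letter at a time. Each step removes
  one cell and one inversion, and a cell taken from a wrong row would violate this bound or the fact
  that a letter \<open>k\<close> creates no cell beyond column \<open>k\<close>. Insertion succeeds
  only under a reducedness condition, so insertion and growth are relations, and the bijections come
  from totality, functionality and injectivity on the relevant sets. The list of rows has fixed
  length \<open>N\<close> with empty rows at the end; opening a row is then appending to an empty
  one.\<close>

lemma word_perm_Nil [simp]: "word_perm [] = id"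
  by (simp add: word_perm_def)

lemma word_perm_Cons: "word_perm (i # \<sigma>) = adj i \<circ> word_perm \<sigma>"
  by (simp add: word_perm_def)

lemma word_perm_append: "word_perm (\<sigma> @ \<tau>) = word_perm \<sigma> \<circ> word_perm \<tau>"
  by (induction \<sigma>) (simp_all add: word_perm_Cons comp_assoc)

lemma word_perm_snoc: "word_perm (\<sigma> @ [i]) = word_perm \<sigma> \<circ> adj i"
  by (simp add: word_perm_append word_perm_Cons)

lemma adj_adj [simp]: "adj i \<circ> adj i = id"
  by (simp add: adj_def)

lemma adj_apply [simp]: "adj i i = Suc i" "adj i (Suc i) = i"
  by (simp_all add: adj_def)

lemma adj_other: "p \<noteq> i \<Longrightarrow> p \<noteq> Suc i \<Longrightarrow> adj i p = p"
  by (simp add: adj_def transpose_def)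

lemma bij_adj [simp]: "bij (adj i)"
  by (simp add: adj_def)

lemma inv_adj [simp]: "inv (adj i) = adj i"
  by (simp add: adj_def)

lemma adj_commute:
  assumes "Suc i < j \<or> Suc j < i"
  shows "adj i \<circ> adj j = adj j \<circ> adj i"
  using assms by (auto simp: fun_eq_iff adj_def transpose_def)

lemma adj_permutes: "i \<in> {1..<N} \<Longrightarrow> adj i permutes {1..N}"
  unfolding adj_def by (rule permutes_swap_id) auto

lemma word_perm_permutes: "\<sigma> \<in> lists {1..<N} \<Longrightarrow> word_perm \<sigma> permutes {1..N}"
proof (induction \<sigma>)
  case (Cons i \<sigma>)
  then have "i \<in> {1..<N}" "word_perm \<sigma> permutes {1..N}"
    by auto
  then show ?case
    unfolding word_perm_Cons by (intro permutes_compose adj_permutes)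
qed (simp add: permutes_id)

lemma word_perm_commute:
  assumes "\<And>a. a \<in> set \<sigma> \<Longrightarrow> Suc a < i \<or> Suc i < a"
  shows "word_perm \<sigma> \<circ> adj i = adj i \<circ> word_perm \<sigma>"
  using assms
proof (induction \<sigma>)
  case (Cons a \<sigma>)
  then have IH: "word_perm \<sigma> \<circ> adj i = adj i \<circ> word_perm \<sigma>"
    by (meson list.set_intros(2))
  have "word_perm (a # \<sigma>) \<circ> adj i = adj a \<circ> (adj i \<circ> word_perm \<sigma>)"
    by (simp only: word_perm_Cons comp_assoc IH)
  also have "\<dots> = (adj a \<circ> adj i) \<circ> word_perm \<sigma>"
    by (simp add: comp_assoc)
  also have "adj a \<circ> adj i = adj i \<circ> adj a"
    using Cons.prems by (intro adj_commute) auto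
  finally show ?case
    by (simp add: word_perm_Cons comp_assoc)
qed simp

text \<open>Pairs of values, smaller one first, rather than pairs of positions: multiplication by
  \<open>adj i\<close> on the right then adds or removes a single pair.\<close>

definition inversions :: "(nat \<Rightarrow> nat) \<Rightarrow> (nat \<times> nat) set" where
  "inversions w = {(x, y). x < y \<and> inv w y < inv w x}"

lemma inversions_id [simp]: "inversions id = {}"
  by (auto simp: inversions_def)

lemma inversions_subset:
  assumes "w permutes {1..N}"
  shows "inversions w \<subseteq> {(x, y). 1 \<le> x \<and> x < y \<and> y \<le> N}"
proof -
  have "inv w permutes {1..N}"
    using assms by (rule permutes_inv)
  then have in_iff: "inv w z \<in> {1..N} \<longleftrightarrow> z \<in> {1..N}" and out: "z \<notin> {1..N} \<Longrightarrow> inv w z = z" for z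
    by (rule permutes_in_image, rule permutes_not_in)
  show ?thesis
  proof (clarsimp simp: inversions_def)
    fix x y assume xy: "x < y" "inv w y < inv w x"
    have "x \<in> {1..N}"
    proof (rule ccontr)
      assume "x \<notin> {1..N}"
      with xy out[of x] out[of y] show False by (cases "y \<in> {1..N}") auto
    qed
    moreover have "y \<in> {1..N}"
      using xy out[of y] in_iff[of x] \<open>x \<in> {1..N}\<close> by (cases "y \<in> {1..N}") auto
    ultimately show "Suc 0 \<le> x \<and> y \<le> N" by auto
  qed
qed

lemma finite_inversions:
  assumes "w permutes {1..N}"
  shows "finite (inversions w)"
  by (rule finite_subset[OF inversions_subset[OF assms]],
      rule finite_subset[of _ "{1..N} \<times> {1..N}"]) auto

lemma inversions_ascent:
  assumes "bij w" "w i < w (Suc i)"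
  shows "inversions (w \<circ> adj i) = insert (w i, w (Suc i)) (inversions w)"
    and "(w i, w (Suc i)) \<notin> inversions w"
proof -
  have inv_eq: "inv (w \<circ> adj i) = adj i \<circ> inv w"
    using assms(1) by (simp add: o_inv_distrib)
  have w_inv: "w (inv w x) = x" for x
    using assms(1) by (simp add: bij_is_surj surj_f_inv_f)
  have inv_w: "inv w (w p) = p" for p
    using assms(1) by (simp add: bij_is_inj)
  have "x < y \<and> adj i (inv w y) < adj i (inv w x) \<longleftrightarrow>
      x = w i \<and> y = w (Suc i) \<or> x < y \<and> inv w y < inv w x" (is "?l = ?r") for x y
  proof -
    define p q where "p = inv w x" and "q = inv w y"
    then have xy: "x = w p" "y = w q"
      by (simp_all add: w_inv)
    have w_inj: "w a = w b \<longleftrightarrow> a = b" for a b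
      using assms(1) by (metis inv_w)
    show ?thesis
      unfolding xy w_inj inv_w
      using assms(2) unfolding adj_def transpose_def by (auto split: if_splits)
  qed
  then show "inversions (w \<circ> adj i) = insert (w i, w (Suc i)) (inversions w)"
    by (auto simp: inversions_def inv_eq)
  show "(w i, w (Suc i)) \<notin> inversions w"
    by (simp add: inversions_def inv_w)
qed

lemma inversions_descent:
  assumes "bij w" "w (Suc i) < w i"
  shows "inversions (w \<circ> adj i) = inversions w - {(w (Suc i), w i)}"
    and "(w (Suc i), w i) \<in> inversions w"
proof -
  have "bij (w \<circ> adj i)" "(w \<circ> adj i) i < (w \<circ> adj i) (Suc i)"
    using assms by (auto intro: bij_comp)
  from inversions_ascent[OF this]
  have "inversions w = insert (w (Suc i), w i) (inversions (w \<circ> adj i))"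
    and "(w (Suc i), w i) \<notin> inversions (w \<circ> adj i)"
    by (simp_all only: comp_assoc adj_adj comp_id) (simp_all add: comp_def)
  then show "inversions (w \<circ> adj i) = inversions w - {(w (Suc i), w i)}"
    and "(w (Suc i), w i) \<in> inversions w"
    by auto
qed

lemma adj_cases:
  fixes w :: "nat \<Rightarrow> nat"
  assumes "bij w"
  obtains "w i < w (Suc i)" | "w (Suc i) < w i"
proof -
  have "w i \<noteq> w (Suc i)"
    using inj_eq[OF bij_is_inj[OF assms], of i "Suc i"] by simp
  then show thesis
    using that by (meson linorder_neqE_nat)
qed

lemma card_inversions_step:
  assumes "w permutes {1..N}"
  shows "w i < w (Suc i) \<Longrightarrow> card (inversions (w \<circ> adj i)) = Suc (card (inversions w))"
    and "card (inversions (w \<circ> adj i)) \<le> Suc (card (inversions w))"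
proof -
  have bij: "bij w" using assms by (rule permutes_bij)
  have fin: "finite (inversions w)" using assms by (rule finite_inversions)
  show up: "w i < w (Suc i) \<Longrightarrow> card (inversions (w \<circ> adj i)) = Suc (card (inversions w))"
    using inversions_ascent[OF bij, of i] fin by simp
  show "card (inversions (w \<circ> adj i)) \<le> Suc (card (inversions w))"
  proof (cases rule: adj_cases[OF bij, of i])
    case 1
    then show ?thesis using up by simp
  next
    case 2
    have "card (inversions (w \<circ> adj i)) \<le> card (inversions w)"
      unfolding inversions_descent(1)[OF bij 2] using fin by (intro card_mono) auto
    then show ?thesis by simp
  qed
qed

lemma card_inversions_word_append_le:
  assumes "\<sigma> \<in> lists {1..<N}" "\<tau> \<in> lists {1..<N}"
  shows "card (inversions (word_perm (\<sigma> @ \<tau>))) \<le> card (inversions (word_perm \<sigma>)) + length \<tau>"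
  using assms(2)
proof (induction \<tau> rule: rev_induct)
  case (snoc i \<tau>)
  have "word_perm (\<sigma> @ \<tau>) permutes {1..N}"
    using assms(1) snoc.prems by (intro word_perm_permutes) auto
  moreover have "word_perm (\<sigma> @ \<tau> @ [i]) = word_perm (\<sigma> @ \<tau>) \<circ> adj i"
    by (simp add: word_perm_append word_perm_Cons comp_assoc)
  ultimately have "card (inversions (word_perm (\<sigma> @ \<tau> @ [i]))) \<le>
      Suc (card (inversions (word_perm (\<sigma> @ \<tau>))))"
    using card_inversions_step(2) by simp
  moreover have "card (inversions (word_perm (\<sigma> @ \<tau>))) \<le> card (inversions (word_perm \<sigma>)) + length \<tau>"
    using snoc by (metis append_in_lists_conv)
  ultimately show ?case
    unfolding length_append by simp
qed simp

lemma card_inversions_word_le: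
  "\<sigma> \<in> lists {1..<N} \<Longrightarrow> card (inversions (word_perm \<sigma>)) \<le> length \<sigma>"
  using card_inversions_word_append_le[of "[]" N \<sigma>] by simp

section \<open>The longest permutation and its reduced words\<close>

lemma long_perm_bij: "long_perm N permutes {1..N}"
proof (rule bij_imp_permutes)
  show "bij_betw (long_perm N) {1..N} {1..N}"
    by (rule bij_betw_byWitness[where f' = "long_perm N"]) (auto simp: long_perm_def)
qed (auto simp: long_perm_def)

lemma inversions_long_perm:
  "inversions (long_perm N) = {(x, y). 1 \<le> x \<and> x < y \<and> y \<le> N}"
proof -
  have "inv (long_perm N) = long_perm N"
    by (rule inv_unique_comp) (auto simp: fun_eq_iff long_perm_def)
  moreover have "inversions (long_perm N) \<subseteq> {(x, y). 1 \<le> x \<and> x < y \<and> y \<le> N}"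
    by (rule inversions_subset[OF long_perm_bij])
  ultimately show ?thesis
    by (auto simp: inversions_def long_perm_def)
qed

lemma card_inversions_long_perm: "card (inversions (long_perm N)) = (\<Sum>j<N. j)"
proof -
  have "inversions (long_perm N) = (SIGMA x:{1..N}. {x<..N})"
    by (auto simp: inversions_long_perm)
  then have "card (inversions (long_perm N)) = (\<Sum>x=1..N. N - x)"
    by simp
  also have "\<dots> = (\<Sum>j<N. j)"
    by (rule sum.reindex_bij_witness[where i = "\<lambda>j. N - j" and j = "\<lambda>x. N - x"]) auto
  finally show ?thesis .
qed

lemma card_inversions_le:
  assumes "w permutes {1..N}"
  shows "card (inversions w) \<le> card (inversions (long_perm N))"
  using inversions_subset[OF assms] finite_inversions[OF long_perm_bij[of N]]
  by (simp add: card_mono inversions_long_perm)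

lemma no_ascent_eq_long_perm:
  assumes "w permutes {1..N}" "\<And>i. i \<in> {1..<N} \<Longrightarrow> w (Suc i) < w i"
  shows "w = long_perm N"
proof
  fix p
  \<comment> \<open>A word that descends everywhere satisfies \<open>w p \<le> N + 1 - p\<close> by
    counting from the left end and the opposite inequality by counting from the right end.\<close>
  have upper: "p \<le> N \<Longrightarrow> 1 \<le> p \<Longrightarrow> w p + p \<le> N + 1" for p
  proof (induction p)
    case (Suc p)
    then show ?case
      using assms(2)[of p] permutes_in_image[OF assms(1), of "Suc p"] by (cases "p = 0") auto
  qed simp
  have lower: "k < N \<Longrightarrow> Suc k \<le> w (N - k)" for k
  proof (induction k)
    case 0
    then show ?case using permutes_in_image[OF assms(1), of N] by auto
  next
    case (Suc k)
    then have "N - Suc k \<in> {1..<N}" "Suc (N - Suc k) = N - k"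
      by auto
    with Suc assms(2)[of "N - Suc k"] show ?case by simp
  qed
  show "w p = long_perm N p"
  proof (cases "p \<in> {1..N}")
    case True
    then show ?thesis
      using upper[of p] lower[of "N - p"] by (auto simp: long_perm_def)
  next
    case False
    then show ?thesis
      using assms(1) by (auto simp: long_perm_def permutes_not_in)
  qed
qed

text \<open>A longest word with as many inversions as letters cannot be extended by an ascent, so
  its permutation has none.\<close>

lemma ex_word_of_long_perm:
  "\<exists>\<sigma>\<in>lists {1..<N}. word_perm \<sigma> = long_perm N \<and> length \<sigma> = (\<Sum>j<N. j)"
proof -
  define A where "A = {\<sigma> \<in> lists {1..<N}. card (inversions (word_perm \<sigma>)) = length \<sigma>}"
  have bound: "length \<sigma> \<le> (\<Sum>j<N. j)" if "\<sigma> \<in> A" for \<sigma>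
    using that card_inversions_le[OF word_perm_permutes, of \<sigma> N]
    by (simp add: A_def card_inversions_long_perm)
  have "[] \<in> A" by (simp add: A_def)
  then obtain \<sigma> where \<sigma>: "\<sigma> \<in> A" and max: "\<And>\<tau>. \<tau> \<in> A \<Longrightarrow> length \<tau> \<le> length \<sigma>"
    using ex_has_greatest_nat[of "\<lambda>s. s \<in> A" "[]" length "Suc (\<Sum>j<N. j)"] bound
    by (auto simp: less_Suc_eq_le)
  have perm: "word_perm \<sigma> permutes {1..N}"
    using \<sigma> by (intro word_perm_permutes) (simp add: A_def)
  have "word_perm \<sigma> (Suc i) < word_perm \<sigma> i" if "i \<in> {1..<N}" for i
  proof (rule ccontr)
    assume "\<not> ?thesis"
    then have "word_perm \<sigma> i < word_perm \<sigma> (Suc i)"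
      using adj_cases[OF permutes_bij[OF perm], of i] by blast
    then have "\<sigma> @ [i] \<in> A"
      using \<sigma> that card_inversions_step(1)[OF perm] by (auto simp: A_def word_perm_snoc)
    from max[OF this] show False by simp
  qed
  then have "word_perm \<sigma> = long_perm N"
    using perm by (rule no_ascent_eq_long_perm[rotated])
  with \<sigma> show ?thesis
    by (auto simp: A_def card_inversions_long_perm[symmetric])
qed

lemma reduced_word_long_perm_iff:
  "reduced_word N (long_perm N) \<sigma> \<longleftrightarrow>
     \<sigma> \<in> lists {1..<N} \<and> word_perm \<sigma> = long_perm N \<and> length \<sigma> = (\<Sum>j<N. j)"
proof -
  have "(\<Sum>j<N. j) \<le> length \<sigma>'" if "\<sigma>' \<in> lists {1..<N}" "word_perm \<sigma>' = long_perm N" for \<sigma>'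
    using card_inversions_word_le[OF that(1)] that(2) by (simp add: card_inversions_long_perm)
  then show ?thesis
    using ex_word_of_long_perm[of N] unfolding reduced_word_def by (metis le_antisym)
qed

text \<open>Each letter adds at most one inversion, so a word with as many inversions as letters
  gains exactly one at every letter.\<close>

lemma card_inversions_take:
  assumes "\<sigma> \<in> lists {1..<N}" "card (inversions (word_perm \<sigma>)) = length \<sigma>" "t \<le> length \<sigma>"
  shows "card (inversions (word_perm (take t \<sigma>))) = t"
proof -
  have "take t \<sigma> \<in> lists {1..<N}" "drop t \<sigma> \<in> lists {1..<N}"
    using assms(1) by (auto dest: in_set_takeD in_set_dropD)
  from card_inversions_word_append_le[OF this] card_inversions_word_le[OF this(1)]
  show ?thesis
    using assms(2,3) by auto
qed

lemma take_word_ascent: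
  assumes "\<sigma> \<in> lists {1..<N}" "card (inversions (word_perm \<sigma>)) = length \<sigma>" "t < length \<sigma>"
  shows "word_perm (take t \<sigma>) (\<sigma> ! t) < word_perm (take t \<sigma>) (Suc (\<sigma> ! t))"
proof (rule ccontr)
  assume nless: "\<not> ?thesis"
  have "take t \<sigma> \<in> lists {1..<N}"
    using assms(1) by (auto dest: in_set_takeD)
  then have perm: "word_perm (take t \<sigma>) permutes {1..N}"
    by (rule word_perm_permutes)
  from nless have desc: "word_perm (take t \<sigma>) (Suc (\<sigma> ! t)) < word_perm (take t \<sigma>) (\<sigma> ! t)"
    using adj_cases[OF permutes_bij[OF perm], of "\<sigma> ! t"] by blast
  have "word_perm (take (Suc t) \<sigma>) = word_perm (take t \<sigma>) \<circ> adj (\<sigma> ! t)"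
    using assms(3) by (simp add: take_Suc_conv_app_nth word_perm_snoc)
  then have "card (inversions (word_perm (take (Suc t) \<sigma>))) \<le> card (inversions (word_perm (take t \<sigma>)))"
    using inversions_descent[OF permutes_bij[OF perm] desc] finite_inversions[OF perm]
    by (auto intro: card_mono)
  then show False
    using card_inversions_take[OF assms(1,2)] assms(3) by simp
qed

section \<open>Edelman-Greene insertion\<close>

definition reduced :: "nat \<Rightarrow> nat list \<Rightarrow> bool" where
  "reduced N \<sigma> \<longleftrightarrow> reduced_word N (word_perm \<sigma>) \<sigma>"

lemma reduced_cong:
  assumes "reduced N \<sigma>" "word_perm \<tau> = word_perm \<sigma>" "length \<tau> = length \<sigma>" "\<tau> \<in> lists {1..<N}"
  shows "reduced N \<tau>"
  using assms by (simp add: reduced_def reduced_word_def)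

lemma reduced_minimal:
  "reduced N \<sigma> \<Longrightarrow> \<tau> \<in> lists {1..<N} \<Longrightarrow> word_perm \<tau> = word_perm \<sigma> \<Longrightarrow> length \<sigma> \<le> length \<tau>"
  by (simp add: reduced_def reduced_word_def)

lemma reduced_factor:
  assumes "reduced N (\<sigma> @ \<tau> @ \<rho>)"
  shows "reduced N \<tau>"
proof -
  have lists: "\<sigma> \<in> lists {1..<N}" "\<tau> \<in> lists {1..<N}" "\<rho> \<in> lists {1..<N}"
    using assms by (auto simp: reduced_def reduced_word_def)
  have "length \<tau> \<le> length \<tau>'" if "\<tau>' \<in> lists {1..<N}" "word_perm \<tau>' = word_perm \<tau>" for \<tau>'
  proof -
    have "word_perm (\<sigma> @ \<tau>' @ \<rho>) = word_perm (\<sigma> @ \<tau> @ \<rho>)"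
      by (simp add: word_perm_append that(2))
    moreover have "\<sigma> @ \<tau>' @ \<rho> \<in> lists {1..<N}"
      using lists that(1) by simp
    ultimately show ?thesis
      using reduced_minimal[OF assms] by fastforce
  qed
  with lists show ?thesis
    by (simp add: reduced_def reduced_word_def)
qed

section \<open>Rows as sets and the bumping relation\<close>

lemma sorted_list_of_set_Un:
  fixes A B :: "nat set"
  assumes "finite A" "finite B" "\<And>a b. a \<in> A \<Longrightarrow> b \<in> B \<Longrightarrow> a < b"
  shows "sorted_list_of_set (A \<union> B) = sorted_list_of_set A @ sorted_list_of_set B"
proof -
  have "A \<inter> B = {}" using assms(3) by fastforce
  then show ?thesis
    using assms by (subst sorted_list_of_set_unique[symmetric]) (auto simp: sorted_wrt_append card_Un_disjoint)
qed

lemma sorted_list_of_set_insert_top: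
  fixes R :: "nat set"
  assumes "finite R" "\<forall>z\<in>R. z < x"
  shows "sorted_list_of_set (insert x R) = sorted_list_of_set R @ [x]"
  using sorted_list_of_set_Un[of R "{x}"] assms by simp

lemma sorted_list_of_set_split:
  fixes R :: "nat set"
  assumes "finite R" "y \<in> R"
  shows "sorted_list_of_set R = sorted_list_of_set (R \<inter> {..<y}) @ y # sorted_list_of_set (R \<inter> {y<..})"
proof -
  have "R = (R \<inter> {..<y}) \<union> ({y} \<union> (R \<inter> {y<..}))"
    using assms(2) by auto
  then have "sorted_list_of_set R = sorted_list_of_set ((R \<inter> {..<y}) \<union> ({y} \<union> (R \<inter> {y<..})))"
    by simp
  also have "\<dots> = sorted_list_of_set (R \<inter> {..<y}) @ sorted_list_of_set ({y} \<union> (R \<inter> {y<..}))"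
    using assms(1) by (intro sorted_list_of_set_Un) auto
  also have "sorted_list_of_set ({y} \<union> (R \<inter> {y<..})) = [y] @ sorted_list_of_set (R \<inter> {y<..})"
    using assms(1) by (subst sorted_list_of_set_Un) auto
  finally show ?thesis by simp
qed

text \<open>One row step of Edelman-Greene insertion: \<open>x\<close> enters \<open>R\<close> and
  pushes out \<open>y\<close>, the least entry above \<open>x\<close>. The special rule is the case
  \<open>x \<in> R\<close>, where \<open>x + 1\<close> must be present and is passed on while the
  row stays as it is. A row is a set, so no positions have to be tracked.\<close>

definition bump :: "nat set \<Rightarrow> nat \<Rightarrow> nat \<Rightarrow> nat set \<Rightarrow> bool" where
  "bump R x y R' \<longleftrightarrow> x < y \<and> y \<in> R \<and> R \<inter> {x<..<y} = {} \<and>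
     (if x \<in> R then y = Suc x \<and> R' = R else R' = insert x (R - {y}))"

text \<open>The definition is symmetric under exchanging \<open>x\<close> with \<open>y\<close> and
  \<open>R\<close> with \<open>R'\<close> and reversing the order of the letters; in this form it
  describes reverse bumping.\<close>

lemma bump_iff_reverse:
  "bump R x y R' \<longleftrightarrow> x < y \<and> x \<in> R' \<and> R' \<inter> {x<..<y} = {} \<and>
     (if y \<in> R' then y = Suc x \<and> R = R' else R = insert y (R' - {x}))"
proof (cases "x \<in> R")
  case True
  then show ?thesis unfolding bump_def by (auto split: if_splits)
next
  case False
  show ?thesis
  proof
    assume "bump R x y R'"
    with False have *: "x < y" "y \<in> R" "R \<inter> {x<..<y} = {}" "R' = insert x (R - {y})"
      by (auto simp: bump_def)
    then have n: "y \<notin> R'" "x \<in> R'" "R' \<inter> {x<..<y} = {}" "R = insert y (R' - {x})"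
      using False by auto
    show "x < y \<and> x \<in> R' \<and> R' \<inter> {x<..<y} = {} \<and>
        (if y \<in> R' then y = Suc x \<and> R = R' else R = insert y (R' - {x}))"
      unfolding if_not_P[OF n(1)] using *(1) n by blast
  next
    assume *: "x < y \<and> x \<in> R' \<and> R' \<inter> {x<..<y} = {} \<and>
        (if y \<in> R' then y = Suc x \<and> R = R' else R = insert y (R' - {x}))"
    then have y: "y \<notin> R'" "R = insert y (R' - {x})"
      using False by (auto split: if_splits)
    with * have n: "R \<inter> {x<..<y} = {}" "R' = insert x (R - {y})"
      by auto
    have "x < y" "y \<in> R"
      using * y by auto
    with n show "bump R x y R'"
      unfolding bump_def if_not_P[OF False] by blast
  qed
qed

lemma bump_subset: "bump R x y R' \<Longrightarrow> R' \<subseteq> insert x R"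
  by (auto simp: bump_def split: if_splits)

lemma bump_subset_reverse: "bump R x y R' \<Longrightarrow> R \<subseteq> insert y R'"
  by (auto simp: bump_def split: if_splits)

lemma bump_finite: "bump R x y R' \<Longrightarrow> finite R' \<longleftrightarrow> finite R"
  by (auto simp: bump_def split: if_splits)

lemma bump_card: "bump R x y R' \<Longrightarrow> finite R \<Longrightarrow> card R' = card R"
  using card_Suc_Diff1[of R y] by (auto simp: bump_def split: if_splits)

lemma bump_functional:
  assumes "bump R x y R'" "bump R x z R''"
  shows "y = z \<and> R' = R''"
proof -
  have "\<not> b < c" if "bump R x b S" "bump R x c T" for b c S T
    using that by (auto simp: bump_def disjoint_iff)
  then have "y = z"
    using assms by (metis linorder_neqE_nat)
  then show ?thesis
    using assms unfolding bump_def by (cases "x \<in> R") (simp_all only: if_True if_False)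
qed

lemma bump_injective:
  assumes "bump R x z R'" "bump S y z R'"
  shows "x = y \<and> R = S"
proof -
  have "\<not> b < c" if "bump T b z R'" "bump U c z R'" for b c T U
    using that by (auto simp: bump_iff_reverse disjoint_iff)
  then have "x = y"
    using assms by (metis linorder_neqE_nat)
  then show ?thesis
    using assms unfolding bump_iff_reverse by (cases "z \<in> R'") (simp_all only: if_True if_False)
qed

lemma adj_braid: "adj x \<circ> adj (Suc x) \<circ> adj x = adj (Suc x) \<circ> adj x \<circ> adj (Suc x)"
  by (auto simp: fun_eq_iff adj_def transpose_def)

text \<open>Entries below \<open>x\<close> commute with \<open>adj y\<close> and entries above
  \<open>y\<close> commute with \<open>adj x\<close>. What remains is a braid relation if
  \<open>x\<close> is in the row, and nothing otherwise.\<close>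

lemma word_perm_bump:
  assumes "finite R" "bump R x y R'"
  shows "word_perm (sorted_list_of_set R @ [x]) = word_perm (y # sorted_list_of_set R')"
proof -
  define A B where "A = R \<inter> {..<x}" and "B = R \<inter> {y<..}"
  have fin: "finite A" "finite B"
    using assms(1) by (auto simp: A_def B_def)
  define p q where "p = word_perm (sorted_list_of_set A)" and "q = word_perm (sorted_list_of_set B)"
  have xy: "x < y"
    using assms(2) by (simp add: bump_def)
  have qx: "q \<circ> adj x = adj x \<circ> q"
    unfolding q_def using fin xy by (intro word_perm_commute) (auto simp: B_def)
  have py: "p \<circ> adj y = adj y \<circ> p"
    unfolding p_def using fin xy by (intro word_perm_commute) (auto simp: A_def)
  show ?thesis
  proof (cases "x \<in> R")
    case True
    with assms(2) have y: "y = Suc x" "Suc x \<in> R" "R' = R"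
      by (auto simp: bump_def)
    have "R \<inter> {x<..} \<inter> {..<y} = {}" "R \<inter> {x<..} \<inter> {y<..} = B"
      using y(1) by (auto simp: B_def)
    then have "sorted_list_of_set (R \<inter> {x<..}) = y # sorted_list_of_set B"
      using sorted_list_of_set_split[of "R \<inter> {x<..}" y] assms(1) y by simp
    then have R: "sorted_list_of_set R = sorted_list_of_set A @ x # y # sorted_list_of_set B"
      using sorted_list_of_set_split[OF assms(1) True] by (simp add: A_def)
    have "word_perm (sorted_list_of_set R @ [x]) = p \<circ> (adj x \<circ> adj y) \<circ> (q \<circ> adj x)"
      by (simp only: R word_perm_append word_perm_Cons word_perm_Nil p_def q_def comp_assoc
          append_assoc append_Cons append_Nil comp_id)
    also have "\<dots> = p \<circ> (adj x \<circ> adj y \<circ> adj x) \<circ> q"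
      by (simp only: qx comp_assoc)
    also have "\<dots> = p \<circ> (adj y \<circ> adj x \<circ> adj y) \<circ> q"
      by (simp only: y(1) adj_braid)
    also have "\<dots> = (p \<circ> adj y) \<circ> adj x \<circ> adj y \<circ> q"
      by (simp only: comp_assoc)
    also have "\<dots> = adj y \<circ> (p \<circ> adj x \<circ> adj y \<circ> q)"
      by (simp only: py comp_assoc)
    also have "p \<circ> adj x \<circ> adj y \<circ> q = word_perm (sorted_list_of_set R')"
      by (simp only: R y(3) word_perm_append word_perm_Cons word_perm_Nil p_def q_def comp_assoc)
    finally show ?thesis
      by (simp only: word_perm_Cons)
  next
    case False
    with assms(2) have R': "R' = insert x (R - {y})" and y: "y \<in> R" "R \<inter> {x<..<y} = {}"
      by (auto simp: bump_def)
    have "R \<inter> {..<y} = A"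
    proof
      show "R \<inter> {..<y} \<subseteq> A"
      proof
        fix z assume "z \<in> R \<inter> {..<y}"
        moreover from this have "z \<noteq> x" "\<not> x < z"
          using y(2) False by (auto simp: disjoint_iff)
        ultimately show "z \<in> A"
          by (simp add: A_def)
      qed
      show "A \<subseteq> R \<inter> {..<y}" using xy by (auto simp: A_def)
    qed
    then have sR: "sorted_list_of_set R = sorted_list_of_set A @ y # sorted_list_of_set B"
      using sorted_list_of_set_split[OF assms(1) y(1)] by (simp add: B_def)
    have "R' \<inter> {x<..} = B"
    proof
      show "R' \<inter> {x<..} \<subseteq> B"
      proof
        fix z assume "z \<in> R' \<inter> {x<..}"
        then have "z \<in> R" "x < z" "z \<noteq> y" by (auto simp: R')
        moreover from this have "\<not> z < y"
          using y(2) by (auto simp: disjoint_iff)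
        ultimately show "z \<in> B"
          by (simp add: B_def)
      qed
      show "B \<subseteq> R' \<inter> {x<..}" using xy by (auto simp: B_def R')
    qed
    moreover have "R' \<inter> {..<x} = A"
      using xy by (auto simp: A_def R')
    ultimately have sR': "sorted_list_of_set R' = sorted_list_of_set A @ x # sorted_list_of_set B"
      using sorted_list_of_set_split[of R' x] assms(1) by (simp add: R')
    have "word_perm (sorted_list_of_set R @ [x]) = (p \<circ> adj y) \<circ> (q \<circ> adj x)"
      by (simp only: sR word_perm_append word_perm_Cons word_perm_Nil p_def q_def comp_assoc
          append_assoc append_Cons append_Nil comp_id)
    also have "\<dots> = adj y \<circ> (p \<circ> adj x \<circ> q)"
      by (simp only: py qx comp_assoc)
    also have "p \<circ> adj x \<circ> q = word_perm (sorted_list_of_set R')"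
      by (simp only: sR' word_perm_append word_perm_Cons p_def q_def comp_assoc)
    finally show ?thesis
      by (simp only: word_perm_Cons)
  qed
qed

text \<open>
  If a row contains \<open>x\<close> but not \<open>x + 1\<close>, the letters above \<open>x\<close> commute with a new letter \<open>x\<close>, which
  then cancels the old one.
\<close>

lemma reduced_row_snoc:
  assumes "reduced N (sorted_list_of_set R @ [x])" "finite R" "x \<in> R"
  shows "Suc x \<in> R"
proof (rule ccontr)
  assume nin: "Suc x \<notin> R"
  define A B where "A = sorted_list_of_set (R \<inter> {..<x})" and "B = sorted_list_of_set (R \<inter> {x<..})"
  have R: "sorted_list_of_set R = A @ x # B"
    unfolding A_def B_def by (rule sorted_list_of_set_split[OF assms(2,3)])
  have "Suc x < b" if "b \<in> set B" for b
    using that nin assms(2) by (auto simp: B_def) (metis Suc_lessI)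
  then have B: "word_perm B \<circ> adj x = adj x \<circ> word_perm B"
    by (intro word_perm_commute) auto
  have "word_perm (sorted_list_of_set R @ [x]) = word_perm A \<circ> adj x \<circ> (word_perm B \<circ> adj x)"
    by (simp only: R word_perm_append word_perm_Cons word_perm_Nil comp_assoc
        append_assoc append_Cons append_Nil comp_id)
  also have "\<dots> = word_perm A \<circ> (adj x \<circ> adj x) \<circ> word_perm B"
    by (simp only: B comp_assoc)
  also have "\<dots> = word_perm (A @ B)"
    by (simp add: word_perm_append)
  finally have "word_perm (A @ B) = word_perm (sorted_list_of_set R @ [x])" ..
  moreover have "A @ B \<in> lists {1..<N}"
    using assms(1) R by (auto simp: reduced_def reduced_word_def)
  ultimately show False
    using reduced_minimal[OF assms(1)] R by fastforce
qed

text \<open>Mirror image of \<open>reduced_row_snoc\<close> for reverse insertion: without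
  \<open>x\<close> in the row, a leading \<open>Suc x\<close> commutes past all smaller entries and
  cancels the one in the row.\<close>

lemma reduced_row_Cons:
  assumes "reduced N (Suc x # sorted_list_of_set R)" "finite R" "Suc x \<in> R"
  shows "x \<in> R"
proof (rule ccontr)
  assume nin: "x \<notin> R"
  define A B where "A = sorted_list_of_set (R \<inter> {..<Suc x})" and "B = sorted_list_of_set (R \<inter> {Suc x<..})"
  have R: "sorted_list_of_set R = A @ Suc x # B"
    unfolding A_def B_def by (rule sorted_list_of_set_split[OF assms(2,3)])
  have "a < x" if "a \<in> set A" for a
    using that nin assms(2) by (auto simp: A_def) (metis less_Suc_eq)
  then have A: "word_perm A \<circ> adj (Suc x) = adj (Suc x) \<circ> word_perm A"
    by (intro word_perm_commute) fastforce
  have "word_perm (Suc x # sorted_list_of_set R) = adj (Suc x) \<circ> (word_perm A \<circ> adj (Suc x)) \<circ> word_perm B"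
    by (simp only: R word_perm_append word_perm_Cons comp_assoc)
  also have "\<dots> = (adj (Suc x) \<circ> adj (Suc x)) \<circ> word_perm A \<circ> word_perm B"
    by (simp only: A comp_assoc)
  also have "\<dots> = word_perm (A @ B)"
    by (simp add: word_perm_append)
  finally have "word_perm (A @ B) = word_perm (Suc x # sorted_list_of_set R)" ..
  moreover have "A @ B \<in> lists {1..<N}"
    using assms(1) R by (auto simp: reduced_def reduced_word_def)
  ultimately show False
    using reduced_minimal[OF assms(1)] R by fastforce
qed

section \<open>Column strictness through counting functions\<close>

definition cnt :: "nat set \<Rightarrow> nat \<Rightarrow> nat" where
  "cnt R a = card (R \<inter> {..a})"

lemma cnt_Suc: "cnt R (Suc a) = cnt R a + (if Suc a \<in> R then 1 else 0)"
proof -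
  have "R \<inter> {..Suc a} = (if Suc a \<in> R then insert (Suc a) (R \<inter> {..a}) else R \<inter> {..a})"
    by (auto simp: le_Suc_eq)
  then show ?thesis by (simp add: cnt_def)
qed

lemma cnt_mono: "a \<le> b \<Longrightarrow> cnt R a \<le> cnt R b"
  unfolding cnt_def by (intro card_mono) auto

lemma cnt_gap:
  assumes "R \<inter> {a<..<b} = {}" "a \<le> c" "c < b"
  shows "cnt R c = cnt R a"
proof -
  have "R \<inter> {..c} = R \<inter> {..a}"
    using assms by (fastforce simp: disjoint_iff not_less)
  then show ?thesis by (simp add: cnt_def)
qed

lemma cnt_le_card: "finite R \<Longrightarrow> cnt R a \<le> card R"
  unfolding cnt_def by (intro card_mono) auto

lemma cnt_eq_card: "R \<subseteq> {..a} \<Longrightarrow> cnt R a = card R"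
  unfolding cnt_def by (simp add: Int_absorb2)

lemma cnt_insert: "x \<notin> R \<Longrightarrow> cnt (insert x R) a = cnt R a + (if x \<le> a then 1 else 0)"
  unfolding cnt_def by (auto simp: Int_insert_left)

lemma cnt_remove: "y \<in> R \<Longrightarrow> cnt R a = cnt (R - {y}) a + (if y \<le> a then 1 else 0)"
  using cnt_insert[of y "R - {y}" a] by (simp add: insert_absorb)

lemma cnt_bump:
  assumes "bump R x y R'"
  shows "cnt R' a = cnt R a + (if x \<notin> R \<and> x \<le> a \<and> a < y then 1 else 0)"
proof (cases "x \<in> R")
  case True
  with assms show ?thesis by (simp add: bump_def)
next
  case False
  then have "R' = insert x (R - {y})" "y \<in> R" "x < y" "x \<notin> R - {y}"
    using assms by (auto simp: bump_def)
  then show ?thesis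
    using cnt_insert[of x "R - {y}" a] cnt_remove[of y R a] False by auto
qed

text \<open>
  For rows of equal or decreasing length, given as sets, this says that columns increase
  strictly: the \<open>k\<close>-th smallest element of \<open>S\<close> exceeds that of \<open>R\<close>.
\<close>

definition row_above :: "nat set \<Rightarrow> nat set \<Rightarrow> bool" where
  "row_above R S \<longleftrightarrow> (\<forall>a. cnt S (Suc a) \<le> cnt R a)"

text \<open>What a row undergoes when a letter enters it, leaving open whether the letter is
  appended or bumps another one.\<close>

definition row_ins :: "nat set \<Rightarrow> nat \<Rightarrow> nat set \<Rightarrow> bool" where
  "row_ins S x S' \<longleftrightarrow> (\<forall>z\<in>S. z < x) \<and> S' = insert x S \<or> (\<exists>y. bump S x y S')"

lemma row_ins_mem: "row_ins S x S' \<Longrightarrow> x \<in> S'"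
  by (auto simp: row_ins_def bump_iff_reverse)

text \<open>From the bumped entry on, gain and loss cancel. Between \<open>y\<close> and that entry
  the old row has no elements, so its count there is still the one at \<open>y\<close>.\<close>

lemma row_ins_cnt:
  assumes "row_ins S y S'"
  shows "cnt S' b = cnt S b \<or> y \<notin> S \<and> y \<le> b \<and> cnt S b = cnt S y \<and> cnt S' b = Suc (cnt S b)"
  using assms unfolding row_ins_def
proof (elim disjE conjE exE)
  assume *: "\<forall>z\<in>S. z < y" "S' = insert y S"
  then have nin: "y \<notin> S" by auto
  have "cnt S b = cnt S y" if "y \<le> b"
    using cnt_gap[of S y "Suc b" b] * that by fastforce
  then show ?thesis
    using cnt_insert[OF nin, of b] * nin by auto
next
  fix z assume bz: "bump S y z S'"
  have "cnt S b = cnt S y" if "y \<le> b" "b < z"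
    using cnt_gap[of S y z b] bz that by (simp add: bump_def)
  then show ?thesis
    using cnt_bump[OF bz, of b] by auto
qed

lemma row_ins_cnt_Suc:
  assumes "row_ins S y S'"
  shows "Suc (cnt S y) \<le> cnt S' (Suc y)"
  using assms unfolding row_ins_def
proof (elim disjE conjE exE)
  assume *: "\<forall>z\<in>S. z < y" "S' = insert y S"
  then have nin: "y \<notin> S" by auto
  then show ?thesis
    using cnt_insert[OF nin, of "Suc y"] * cnt_mono[of y "Suc y" S] by simp
next
  fix z assume bz: "bump S y z S'"
  show ?thesis
  proof (cases "y \<in> S")
    case True
    with bz show ?thesis by (auto simp: bump_def cnt_Suc)
  next
    case False
    with bz have "cnt S' y = Suc (cnt S y)"
      using cnt_bump[OF bz, of y] by (simp add: bump_def)
    then show ?thesis using cnt_mono[of y "Suc y" S'] by simp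
  qed
qed

text \<open>Work is needed only where the lower row gains an entry, and there its old count is that
  at \<open>y\<close>. If \<open>R\<close> stays unchanged, its entry \<open>x = y - 1\<close>
  supplies the missing unit; otherwise the new \<open>x\<close> does so at \<open>y - 1\<close>, and
  the old \<open>y\<close> from \<open>y\<close> on.\<close>

lemma above_row_ins:
  assumes "row_above R S" "0 \<notin> R" "bump R x y R'" "row_ins S y S'"
  shows "row_above R' S'"
  unfolding row_above_def
proof
  fix a
  have RR': "cnt R b \<le> cnt R' b" for b
    using cnt_bump[OF assms(3), of b] by simp
  have RS: "cnt S (Suc b) \<le> cnt R b" for b
    using assms(1) by (simp add: row_above_def)
  obtain y' where y': "y = Suc y'" "x \<le> y'"
    using assms(3) by (cases y) (auto simp: bump_def)
  from row_ins_cnt[OF assms(4), of "Suc a"] show "cnt S' (Suc a) \<le> cnt R' a"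
  proof (elim disjE conjE)
    assume "cnt S' (Suc a) = cnt S (Suc a)"
    then show ?thesis using RS[of a] RR'[of a] by simp
  next
    assume *: "y \<notin> S" "y \<le> Suc a" "cnt S (Suc a) = cnt S y" "cnt S' (Suc a) = Suc (cnt S (Suc a))"
    have S: "cnt S y = cnt S y'"
      using * y' by (simp add: cnt_Suc)
    show ?thesis
    proof (cases "x \<in> R")
      case True
      then have "y' = x"
        using assms(3) y' by (auto simp: bump_def)
      \<comment> \<open>Entries of \<open>R\<close> are positive, so \<open>x\<close> has a
        predecessor at which the old column condition can be read off.\<close>
      moreover obtain x' where x': "x = Suc x'"
        using True assms(2) by (cases x) auto
      ultimately have "cnt S y \<le> cnt R x'"
        using RS[of x'] S by simp
      moreover have "cnt R x = Suc (cnt R x')"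
        using True x' by (simp add: cnt_Suc)
      moreover have "cnt R x \<le> cnt R a"
        using * y' \<open>y' = x\<close> by (intro cnt_mono) simp
      ultimately show ?thesis
        using * RR'[of a] by simp
    next
      case False
      have ge: "cnt S y \<le> cnt R y'"
        using RS[of y'] y' by simp
      show ?thesis
      proof (cases "a = y'")
        case True
        then show ?thesis
          using cnt_bump[OF assms(3), of a] False y' * ge by simp
      next
        case a: False
        have "cnt R y = Suc (cnt R y')"
          using assms(3) y' by (simp add: cnt_Suc bump_def)
        moreover have "cnt R y \<le> cnt R a"
          using a * y' by (intro cnt_mono) simp
        ultimately show ?thesis
          using * ge RR'[of a] by simp
      qed
    qed
  qed
qed

text \<open>The count of \<open>R\<close> is smaller than that of \<open>R'\<close> only from
  \<open>x\<close> up to \<open>y - 1\<close>, where the count of \<open>R'\<close> already has its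
  value at \<open>y\<close>. The new lower row has by \<open>Suc y\<close> at least one entry more
  than the old one by \<open>y\<close>, which makes up for the loss.\<close>

lemma above_row_ins_reverse:
  assumes "row_above R' S'" "bump R x y R'" "row_ins S y S'"
  shows "row_above R S"
  unfolding row_above_def
proof
  fix a
  have SS': "cnt S b \<le> cnt S' b" for b
    using row_ins_cnt[OF assms(3), of b] by auto
  have RS: "cnt S' (Suc b) \<le> cnt R' b" for b
    using assms(1) by (simp add: row_above_def)
  show "cnt S (Suc a) \<le> cnt R a"
  proof (cases "x \<notin> R \<and> x \<le> a \<and> a < y")
    case False
    then have "cnt R' a = cnt R a"
      using cnt_bump[OF assms(2), of a] by simp
    then show ?thesis using RS[of a] SS'[of "Suc a"] by simp
  next
    case True
    then have R': "R' \<inter> {x<..<Suc y} = {}"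
      using assms(2) by (auto simp: bump_def disjoint_iff less_Suc_eq)
    then have "cnt R' a = cnt R' x" "cnt R' y = cnt R' x"
      using cnt_gap[OF R', of a] cnt_gap[OF R', of y] True by auto
    moreover have "cnt R' a = Suc (cnt R a)"
      using cnt_bump[OF assms(2), of a] True by simp
    moreover have "cnt S (Suc a) \<le> cnt S y"
      using True by (intro cnt_mono) simp
    ultimately show ?thesis
      using row_ins_cnt_Suc[OF assms(3)] RS[of y] by simp
  qed
qed

lemma row_above_transp: "transp row_above"
proof (rule transpI)
  fix R S T assume "row_above R S" "row_above S T"
  then show "row_above R T"
    unfolding row_above_def by (meson cnt_mono le_SucI le_refl le_trans)
qed

section \<open>Tableaux, reading words and insertion\<close>

definition tab :: "nat \<Rightarrow> nat set list \<Rightarrow> bool" where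
  "tab N Rs \<longleftrightarrow> successively row_above Rs \<and> (\<forall>R\<in>set Rs. R \<subseteq> {1..<N})"

lemma tab_Cons:
  "tab N (R # Rs) \<longleftrightarrow> R \<subseteq> {1..<N} \<and> (Rs = [] \<or> row_above R (hd Rs)) \<and> tab N Rs"
  by (auto simp: tab_def successively_Cons)

text \<open>Rows are read from bottom to top, so a letter inserted into the top row is a letter
  appended to the word.\<close>

primrec reading :: "nat set list \<Rightarrow> nat list" where
  "reading [] = []"
| "reading (R # Rs) = reading Rs @ sorted_list_of_set R"

lemma length_reading: "length (reading Rs) = sum_list (map card Rs)"
  by (induction Rs) auto

lemma set_sorted_list_of_set_subset: "set (sorted_list_of_set R) \<subseteq> R"
  by (cases "finite R") auto

lemma set_reading: "\<forall>R\<in>set Rs. R \<subseteq> {1..<N} \<Longrightarrow> reading Rs \<in> lists {1..<N}"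
proof (induction Rs)
  case (Cons R Rs)
  then show ?case
    using set_sorted_list_of_set_subset[of R] by auto
qed simp

lemma tab_reading: "tab N Rs \<Longrightarrow> reading Rs \<in> lists {1..<N}"
  unfolding tab_def by (rule set_reading) (rule conjunct2)

text \<open>The third argument is the row, counted from 0, where the path ends. The empty list
  admits no insertion: opening a new row means using \<open>here\<close> on an empty set.\<close>

inductive ins :: "nat \<Rightarrow> nat set list \<Rightarrow> nat \<Rightarrow> nat set list \<Rightarrow> bool" where
  here: "\<forall>z\<in>R. z < x \<Longrightarrow> ins x (R # Rs) 0 (insert x R # Rs)"
| down: "bump R x y R' \<Longrightarrow> ins y Rs i Rs' \<Longrightarrow> ins x (R # Rs) (Suc i) (R' # Rs')"

lemma ins_row_ins: "ins x Rs i Rs' \<Longrightarrow> row_ins (hd Rs) x (hd Rs')"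
  by (cases rule: ins.cases) (auto simp: row_ins_def)

lemma ins_length: "ins x Rs i Rs' \<Longrightarrow> length Rs' = length Rs \<and> i < length Rs"
  by (induction rule: ins.induct) auto

lemma ins_shape:
  assumes "ins x Rs i Rs'" "\<forall>R\<in>set Rs. finite R"
  shows "map card Rs' = (map card Rs)[i := Suc (map card Rs ! i)]"
  using assms
proof (induction rule: ins.induct)
  case (here R x Rs)
  then have "x \<notin> R" by auto
  with here show ?case by simp
qed (simp add: bump_card)

lemma ins_tab:
  assumes "ins x Rs i Rs'" "tab N Rs" "x \<in> {1..<N}"
  shows "tab N Rs'"
  using assms
proof (induction rule: ins.induct)
  case (here R x Rs)
  then have nin: "x \<notin> R" by auto
  have "row_above (insert x R) T" if "row_above R T" for T
    using that cnt_insert[OF nin] unfolding row_above_def by (metis le_trans le_add1)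
  with here show ?case by (auto simp: tab_Cons)
next
  case (down R x y R' Rs i Rs')
  have "y \<in> R" using down.hyps(1) by (simp add: bump_def)
  with down.prems down.IH have tab': "tab N Rs'"
    by (auto simp: tab_Cons)
  have "Rs \<noteq> []" using ins_length[OF down.hyps(2)] by auto
  with down.prems have "row_above R (hd Rs)" "0 \<notin> R"
    by (auto simp: tab_Cons)
  then have "row_above R' (hd Rs')"
    using down.hyps(1) ins_row_ins[OF down.hyps(2)] by (rule above_row_ins)
  moreover have "R' \<subseteq> {1..<N}"
    using bump_subset[OF down.hyps(1)] down.prems by (auto simp: tab_Cons)
  ultimately show ?case
    using tab' by (simp add: tab_Cons)
qed

lemma ins_reading:
  assumes "ins x Rs i Rs'" "\<forall>R\<in>set Rs. finite R"
  shows "word_perm (reading Rs') = word_perm (reading Rs @ [x])"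
  using assms
proof (induction rule: ins.induct)
  case (here R x Rs)
  then have "sorted_list_of_set (insert x R) = sorted_list_of_set R @ [x]"
    by (intro sorted_list_of_set_insert_top) auto
  then show ?case
    by (simp only: reading.simps append_assoc)
next
  case (down R x y R' Rs i Rs')
  have IH: "word_perm (reading Rs') = word_perm (reading Rs @ [y])"
    by (rule down.IH) (use down.prems in simp)
  have "word_perm (reading (R' # Rs')) = word_perm (reading Rs @ [y]) \<circ> word_perm (sorted_list_of_set R')"
    by (simp only: word_perm_append reading.simps IH)
  also have "\<dots> = word_perm (reading Rs) \<circ> word_perm (y # sorted_list_of_set R')"
    by (simp only: word_perm_append word_perm_Cons word_perm_Nil comp_assoc comp_id)
  also have "\<dots> = word_perm (reading Rs) \<circ> word_perm (sorted_list_of_set R @ [x])"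
    using word_perm_bump[OF _ down.hyps(1)] down.prems by simp
  finally show ?case
    by (simp add: word_perm_append comp_assoc)
qed

lemma ins_reading_length:
  assumes "ins x Rs i Rs'" "\<forall>R\<in>set Rs. finite R"
  shows "length (reading Rs') = Suc (length (reading Rs))"
proof -
  have "i < length (map card Rs)"
    using ins_length[OF assms(1)] by simp
  then show ?thesis
    unfolding length_reading ins_shape[OF assms] by (simp add: sum_list_update)
qed

lemma ins_functional:
  "ins x Rs i Rs' \<Longrightarrow> ins x Rs j Rs'' \<Longrightarrow> i = j \<and> Rs' = Rs''"
proof (induction arbitrary: j Rs'' rule: ins.induct)
  case (here R x Rs)
  from here(2,1) show ?case
    by cases (auto simp: bump_def)
next
  case (down R x y R' Rs i Rs')
  from down.prems show ?case
  proof cases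
    case here
    then show ?thesis using down.hyps(1) by (auto simp: bump_def)
  next
    case (down z S' k Ss')
    then have "z = y" "S' = R'"
      using bump_functional down.hyps(1) by blast+
    with down down.IH show ?thesis by auto
  qed
qed

text \<open>Knowing the final row, the path is retraced: the letter that arrived there is the
  maximum of the row, and \<open>bump_injective\<close> recovers the letters above.\<close>

lemma ins_injective:
  "ins x Rs i Rs' \<Longrightarrow> ins y Ss i Rs' \<Longrightarrow> x = y \<and> Rs = Ss"
proof (induction arbitrary: y Ss rule: ins.induct)
  case (here R x Rs)
  from here(2) show ?case
  proof cases
    case (here S)
    have "x = y"
      using here(2,3) \<open>\<forall>z\<in>R. z < x\<close> by (metis insert_iff not_less_iff_gr_or_eq)
    moreover have "R = insert x R - {x}" "S = insert y S - {y}"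
      using here(3) \<open>\<forall>z\<in>R. z < x\<close> by auto
    ultimately show ?thesis
      using here by auto
  qed
next
  case (down R x z R' Rs i Rs')
  from down.prems show ?case
  proof cases
    case (down S z' Ss')
    then have "z = z'" "Rs = Ss'"
      using down.IH by blast+
    with down have "bump S y z R'"
      by simp
    from bump_injective[OF down.hyps(1) this] down \<open>Rs = Ss'\<close> show ?thesis
      by simp
  qed
qed

lemma tab_finite: "tab N Rs \<Longrightarrow> R \<in> set Rs \<Longrightarrow> finite R"
  unfolding tab_def by (meson finite_atLeastLessThan finite_subset)

lemma ex_bump:
  assumes "finite R" "z \<in> R" "x < z" "x \<in> R \<longrightarrow> Suc x \<in> R"
  shows "\<exists>y R'. bump R x y R'"
proof -
  define y where "y = Min (R \<inter> {x<..})"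
  have fin: "finite (R \<inter> {x<..})" and ne: "R \<inter> {x<..} \<noteq> {}"
    using assms by auto
  have y: "y \<in> R" "x < y"
    using Min_in[OF fin ne] by (auto simp: y_def)
  have least: "y \<le> u" if "u \<in> R" "x < u" for u
    using Min_le[OF fin] that by (simp add: y_def)
  have "R \<inter> {x<..<y} = {}"
    using least by (force simp: disjoint_iff)
  moreover have "y = Suc x" if "x \<in> R"
    using least[of "Suc x"] y that assms(4) by auto
  ultimately have "bump R x y (if x \<in> R then R else insert x (R - {y}))"
    using y by (simp add: bump_def)
  then show ?thesis by blast
qed

lemma ex_bump_reverse:
  assumes "z \<in> R'" "z < y" "y \<in> R' \<longrightarrow> y - 1 \<in> R'"
  shows "\<exists>x R. bump R x y R'"
proof -
  define x where "x = Max (R' \<inter> {..<y})"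
  have fin: "finite (R' \<inter> {..<y})" and ne: "R' \<inter> {..<y} \<noteq> {}"
    using assms by auto
  have x: "x \<in> R'" "x < y"
    using Max_in[OF fin ne] by (auto simp: x_def)
  have greatest: "u \<le> x" if "u \<in> R'" "u < y" for u
    using Max_ge[OF fin] that by (simp add: x_def)
  have "R' \<inter> {x<..<y} = {}"
    using greatest by (force simp: disjoint_iff)
  moreover have "y = Suc x" if "y \<in> R'"
    using greatest[of "y - 1"] x that assms(3) by auto
  ultimately have "bump (if y \<in> R' then R' else insert y (R' - {x})) x y R'"
    using x by (simp add: bump_iff_reverse)
  then show ?thesis by blast
qed

text \<open>Reducedness excludes a letter that is present without its successor. After a bump, the
  word in which \<open>y\<close> stands before the changed row has the same length and permutation,
  so it is again reduced and the hypothesis passes to the lower rows.\<close>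

lemma ex_ins:
  assumes "tab N Rs" "{} \<in> set Rs" "reduced N (reading Rs @ [x])"
  shows "\<exists>i Rs'. ins x Rs i Rs'"
  using assms
proof (induction Rs arbitrary: x)
  case (Cons R Rs)
  have fin: "finite R"
    using Cons.prems(1) by (rule tab_finite) simp
  have red: "reduced N (sorted_list_of_set R @ [x])"
    using reduced_factor[of N "reading Rs" "sorted_list_of_set R @ [x]" "[]"] Cons.prems(3) by simp
  show ?case
  proof (cases "\<forall>z\<in>R. z < x")
    case True
    then show ?thesis by (blast intro: ins.here)
  next
    case False
    then obtain z where z: "z \<in> R" "x \<le> z"
      using linorder_not_le by blast
    have *: "x \<in> R \<longrightarrow> Suc x \<in> R"
      using reduced_row_snoc[OF red fin] by blast
    have "\<exists>z'\<in>R. x < z'"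
      using * z by (cases "x = z") (auto intro: bexI[of _ z])
    then obtain y R' where b: "bump R x y R'"
      using ex_bump[OF fin _ _ *] by blast
    have fin': "finite R'"
      using b fin by (simp add: bump_finite)
    have "R' \<subseteq> {1..<N}"
      using bump_subset[OF b] Cons.prems(1,3) by (auto simp: tab_Cons reduced_def reduced_word_def)
    then have "reading Rs @ y # sorted_list_of_set R' \<in> lists {1..<N}"
      using b Cons.prems(1,3) fin' by (auto simp: tab_Cons reduced_def reduced_word_def bump_def)
    moreover have "word_perm (reading Rs @ y # sorted_list_of_set R') = word_perm (reading (R # Rs) @ [x])"
      unfolding reading.simps append_assoc word_perm_append[of "reading Rs"] word_perm_bump[OF fin b] ..
    moreover have "length (reading Rs @ y # sorted_list_of_set R') = length (reading (R # Rs) @ [x])"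
      using bump_card[OF b fin] by simp
    ultimately have "reduced N (reading Rs @ y # sorted_list_of_set R')"
      using Cons.prems(3) by (metis reduced_cong)
    then have "reduced N (reading Rs @ [y])"
      using reduced_factor[of N "[]" "reading Rs @ [y]" "sorted_list_of_set R'"] by simp
    \<comment> \<open>The current row is not empty, so the empty row that stops the recursion lies
      further down.\<close>
    moreover have "{} \<in> set Rs" "tab N Rs"
      using Cons.prems z by (auto simp: tab_Cons)
    ultimately obtain i Rs' where "ins y Rs i Rs'"
      using Cons.IH by blast
    then show ?thesis
      using b by (blast intro: ins.down)
  qed
qed simp

text \<open>The cell to remove is a corner, the last cell of row \<open>i\<close>. Its entry leaves,
  and each row above trades the incoming letter for its largest smaller entry. Column strictness
  provides such an entry and reducedness excludes a present letter whose predecessor is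
  missing.\<close>

lemma ex_ins_reverse:
  assumes "tab N Rs'" "i < length Rs'" "Rs' ! i \<noteq> {}"
    and "Suc i < length Rs' \<Longrightarrow> card (Rs' ! Suc i) < card (Rs' ! i)"
    and "reduced N (reading Rs')"
  shows "\<exists>x Rs. ins x Rs i Rs' \<and> tab N Rs \<and> x \<in> {1..<N}"
  using assms
proof (induction Rs' arbitrary: i)
  case (Cons R' Rs')
  have fin': "finite R'"
    using Cons.prems(1) by (rule tab_finite) simp
  show ?case
  proof (cases i)
    case 0
    define x where "x = Max R'"
    define R where "R = R' - {x}"
    have ne: "R' \<noteq> {}" using Cons.prems(3) 0 by simp
    have x: "x \<in> R'" using Max_in[OF fin' ne] by (simp add: x_def)
    have less: "\<forall>z\<in>R. z < x"
      using Max_ge[OF fin'] by (auto simp: R_def x_def order_le_less)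
    have R': "R' = insert x R" and xR: "x \<notin> R"
      using x by (auto simp: R_def)
    have "ins x (R # Rs') 0 (R' # Rs')"
      unfolding R' by (rule ins.here[OF less])
    \<comment> \<open>Below the removed maximum nothing changes; from it on the count of
      \<open>R\<close> is its full size, and the strict drop in length bounds the lower row.\<close>
    moreover have "row_above R T" if T: "row_above R' T" "card T < card R'" "finite T" for T
      unfolding row_above_def
    proof
      fix a
      have a: "cnt T (Suc a) \<le> cnt R' a" using T(1) by (simp add: row_above_def)
      show "cnt T (Suc a) \<le> cnt R a"
      proof (cases "a < x")
        case True
        with a show ?thesis using cnt_insert[OF xR, of a] by (simp add: R')
      next
        case False
        with less have "cnt R a = card R" by (intro cnt_eq_card) auto
        moreover have "card R' = Suc (card R)" using xR fin' by (simp add: R')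
        ultimately show ?thesis using cnt_le_card[OF T(3), of "Suc a"] T(2) by simp
      qed
    qed
    then have "Rs' = [] \<or> row_above R (hd Rs')"
      using Cons.prems(1,4) 0 tab_finite[OF Cons.prems(1)] by (cases Rs') (auto simp: tab_Cons)
    then have "tab N (R # Rs')"
      using Cons.prems(1) R' by (auto simp: tab_Cons)
    moreover have "x \<in> {1..<N}"
      using x Cons.prems(1) by (auto simp: tab_Cons)
    ultimately show ?thesis
      using 0 by blast
  next
    case (Suc k)
    have tab': "tab N Rs'" using Cons.prems(1) by (simp add: tab_Cons)
    have "reduced N (reading Rs')"
      using reduced_factor[of N "[]" "reading Rs'" "sorted_list_of_set R'"] Cons.prems(5) by simp
    then obtain y Ss where y: "ins y Ss k Rs'" "tab N Ss" "y \<in> {1..<N}"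
      using Cons.IH[OF tab', of k] Cons.prems Suc by auto
    have ne: "Rs' \<noteq> []" "Ss \<noteq> []" using ins_length[OF y(1)] by auto
    have abv: "row_above R' (hd Rs')" and sub: "R' \<subseteq> {1..<N}"
      using Cons.prems(1) ne by (auto simp: tab_Cons)
    have ri: "row_ins (hd Ss) y (hd Rs')" by (rule ins_row_ins[OF y(1)])
    obtain y' where y': "y = Suc y'" using y(3) by (cases y) auto
    \<comment> \<open>The letter \<open>y\<close> lies in the row below, so strictness yields an
      entry of \<open>R'\<close> smaller than \<open>y\<close>, as required by
      \<open>ex_bump_reverse\<close>.\<close>
    have "0 < cnt (hd Rs') y"
      using row_ins_mem[OF ri] unfolding cnt_def by (simp add: card_gt_0_iff) blast
    then have "0 < cnt R' y'"
      using abv y' unfolding row_above_def by (metis not_gr_zero le_zero_eq)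
    then obtain z where "z \<in> R'" "z \<le> y'"
      unfolding cnt_def by (auto simp: card_gt_0_iff)
    then have "z < y" by (simp add: y')
    have finS: "\<forall>S\<in>set Ss. finite S" using tab_finite[OF y(2)] by blast
    have w: "word_perm (reading Ss @ y # sorted_list_of_set R') = word_perm (reading (R' # Rs'))"
      using ins_reading[OF y(1) finS]
      unfolding reading.simps word_perm_append word_perm_Cons word_perm_Nil comp_id
      by (simp only: comp_assoc)
    have "reduced N (reading Ss @ y # sorted_list_of_set R')"
    proof (rule reduced_cong[OF Cons.prems(5) w])
      show "length (reading Ss @ y # sorted_list_of_set R') = length (reading (R' # Rs'))"
        using ins_reading_length[OF y(1) finS] by simp
      show "reading Ss @ y # sorted_list_of_set R' \<in> lists {1..<N}"
        using tab_reading[OF y(2)] y(3) sub set_sorted_list_of_set_subset[of R'] by auto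
    qed
    then have "reduced N (y # sorted_list_of_set R')"
      using reduced_factor[of N "reading Ss" "y # sorted_list_of_set R'" "[]"] by simp
    then have "y \<in> R' \<longrightarrow> y - 1 \<in> R'"
      using reduced_row_Cons[OF _ fin'] y' by auto
    then obtain x R where b: "bump R x y R'"
      using ex_bump_reverse \<open>z \<in> R'\<close> \<open>z < y\<close> by blast
    have "ins x (R # Ss) i (R' # Rs')"
      unfolding Suc using b y(1) by (rule ins.down)
    moreover have "tab N (R # Ss)"
      using above_row_ins_reverse[OF abv b ri] bump_subset_reverse[OF b] sub y(2,3)
      by (auto simp: tab_Cons)
    moreover have "x \<in> {1..<N}"
      using b sub by (auto simp: bump_iff_reverse)
    ultimately show ?thesis by blast
  qed
qed simp

text \<open>In each row the second path bumps a larger letter than the first did, so it cannot go on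
  below the row where the first one stopped.\<close>

lemma ins_less_imp_row_le:
  "ins x Rs i Rs' \<Longrightarrow> ins x' Rs' i' Rs'' \<Longrightarrow> x < x' \<Longrightarrow> i' \<le> i"
proof (induction arbitrary: x' i' Rs'' rule: ins.induct)
  case (here R x Rs)
  from here(2) show ?case
  proof cases
    case (down y R' k Rs')
    then show ?thesis using here(1,3) by (auto simp: bump_def)
  qed simp
next
  case (down R x y R' Rs i Rs')
  from down.prems(1) show ?case
  proof cases
    case (down y' S k Ss)
    then have y': "y' \<in> R'" "x' < y'" by (auto simp: bump_def)
    have "y < y'"
    proof (cases "x \<in> R")
      case True
      then show ?thesis using \<open>bump R x y R'\<close> \<open>x < x'\<close> y' by (simp add: bump_def)
    next
      case False
      then have "y' \<in> R - {y}" "\<not> (x < y' \<and> y' < y)"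
        using \<open>bump R x y R'\<close> \<open>x < x'\<close> y' by (auto simp: bump_def disjoint_iff)
      then show ?thesis using \<open>x < x'\<close> y' by auto
    qed
    with down show ?thesis using down.IH by auto
  qed simp
qed

text \<open>The first path leaves its incoming letter in every row it visits. A smaller second
  letter therefore always has something to bump, and what it bumps is at most that letter, so it
  goes on past the end of the first path.\<close>

lemma ins_greater_imp_row_less:
  "ins x Rs i Rs' \<Longrightarrow> ins x' Rs' i' Rs'' \<Longrightarrow> x' < x \<Longrightarrow> i < i'"
proof (induction arbitrary: x' i' Rs'' rule: ins.induct)
  case (here R x Rs)
  from here(2) show ?case
  proof cases
    case here
    then show ?thesis using \<open>x' < x\<close> by auto
  qed simp
next
  case (down R x y R' Rs i Rs')
  have x: "x \<in> R'" "x < y" using \<open>bump R x y R'\<close> by (auto simp: bump_iff_reverse)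
  from down.prems(1) show ?case
  proof cases
    case here
    then show ?thesis using x \<open>x' < x\<close> by auto
  next
    case (down y' S k Ss)
    then have "y' \<le> x"
      using x(1) \<open>x' < x\<close> by (auto simp: bump_def disjoint_iff not_less)
    with down x show ?thesis using down.IH by auto
  qed
qed

text \<open>The path drifts weakly to the left, so the final column is bounded by the place that
  \<open>x\<close> takes in the first row.\<close>

lemma ins_col_le_cnt:
  assumes "ins x Rs i Rs'" "tab N Rs" "x \<in> {1..<N}"
  shows "card (Rs' ! i) \<le> Suc (cnt (hd Rs) (x - 1))"
  using assms
proof (induction rule: ins.induct)
  case (here R x Rs)
  then have "finite R" "x \<notin> R" by (auto dest: tab_finite)
  moreover have "R \<subseteq> {..x - 1}" using here by fastforce
  ultimately show ?case by (simp add: cnt_eq_card)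
next
  case (down R x y R' Rs i Rs')
  have ne: "Rs \<noteq> []" using ins_length[OF down.hyps(2)] by auto
  have t: "row_above R (hd Rs)" "tab N Rs" "R \<subseteq> {1..<N}"
    using down.prems(1) ne by (auto simp: tab_Cons)
  have y: "y \<in> R" "x < y" using down.hyps(1) by (auto simp: bump_def)
  obtain x' where x': "x = Suc x'" using down.prems by (cases x) auto
  \<comment> \<open>Since \<open>1 \<le> x < y\<close>, two units can be taken off \<open>y\<close>:
    one for the \<open>y - 1\<close> of the induction hypothesis, one for the shift in
    \<open>row_above\<close>.\<close>
  obtain y' where y': "y = Suc (Suc y')" by (rule that[of "y - 2"]) (use y x' in simp)
  have "card (Rs' ! i) \<le> Suc (cnt (hd Rs) (Suc y'))"
    using down.IH[OF t(2)] y t(3) y' by auto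
  also have "cnt (hd Rs) (Suc y') \<le> cnt R y'"
    using t(1) by (simp add: row_above_def)
  also have "cnt R y' \<le> cnt R x'"
  proof (cases "x \<in> R")
    case True
    then show ?thesis using down.hyps(1) x' y' by (simp add: bump_def)
  next
    case False
    have "cnt R y' \<le> cnt R (Suc y')" by (rule cnt_mono) simp
    also have "cnt R (Suc y') = cnt R x"
      using down.hyps(1) y' by (intro cnt_gap[of R x y]) (auto simp: bump_def)
    finally show ?thesis using False x' by (simp add: cnt_Suc)
  qed
  finally show ?case using x' by simp
qed

lemma ins_col_le:
  assumes "ins x Rs i Rs'" "tab N Rs" "x \<in> {1..<N}"
  shows "card (Rs' ! i) \<le> x"
proof -
  have "Rs \<noteq> []" using ins_length[OF assms(1)] by auto
  then have "hd Rs \<subseteq> {1..<N}" using assms(2) by (auto simp: tab_def)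
  then have "hd Rs \<inter> {..x - 1} \<subseteq> {1..x - 1}" by auto
  then have "cnt (hd Rs) (x - 1) \<le> card {1..x - 1}"
    unfolding cnt_def by (intro card_mono) auto
  then have "cnt (hd Rs) (x - 1) \<le> x - 1" by simp
  then show ?thesis using ins_col_le_cnt[OF assms] assms(3) by auto
qed

section \<open>Size bounds and the staircase tableau\<close>

lemma tab_nth_above: "tab N Rs \<Longrightarrow> j < k \<Longrightarrow> k < length Rs \<Longrightarrow> row_above (Rs ! j) (Rs ! k)"
  unfolding tab_def successively_conv_sorted_wrt[OF row_above_transp] sorted_wrt_iff_nth_less by blast

lemma row_above_card_le:
  assumes "row_above R S" "finite R" "finite S"
  shows "card S \<le> card R"
proof (cases "S = {}")
  case False
  have "card S = cnt S (Suc (Max S))"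
    using assms(3) by (intro cnt_eq_card[symmetric]) (auto intro: le_SucI)
  also have "\<dots> \<le> card R"
    using assms(1) cnt_le_card[OF assms(2)] unfolding row_above_def by (meson le_trans)
  finally show ?thesis .
qed simp

lemma tab_card_antimono:
  assumes "tab N Rs" "j \<le> k" "k < length Rs"
  shows "card (Rs ! k) \<le> card (Rs ! j)"
proof (cases "j = k")
  case False
  with assms show ?thesis
    by (intro row_above_card_le tab_nth_above[OF assms(1)] tab_finite[OF assms(1)]) auto
qed simp

text \<open>Columns increase strictly from entries at least 1, so the entries of row
  \<open>j\<close> (from 0) are distinct numbers above \<open>j\<close>.\<close>

lemma tab_cnt_le:
  assumes "tab N Rs" "j < length Rs"
  shows "cnt (Rs ! j) a \<le> a - j"
  using assms(2)
proof (induction j arbitrary: a)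
  case 0
  then have "Rs ! 0 \<subseteq> {1..<N}" using assms(1) by (auto simp: tab_def)
  then have "Rs ! 0 \<inter> {..a} \<subseteq> {1..a}" by auto
  then have "cnt (Rs ! 0) a \<le> card {1..a}"
    unfolding cnt_def by (intro card_mono) auto
  then show ?case by simp
next
  case (Suc j)
  have abv: "row_above (Rs ! j) (Rs ! Suc j)"
    using Suc.prems by (intro tab_nth_above[OF assms(1)]) auto
  show ?case
  proof (cases a)
    case 0
    have "cnt (Rs ! Suc j) 0 \<le> cnt (Rs ! Suc j) (Suc 0)" by (rule cnt_mono) simp
    also have "\<dots> \<le> cnt (Rs ! j) 0" using abv by (simp add: row_above_def)
    also have "\<dots> \<le> 0" using Suc.IH[of 0] Suc.prems by simp
    finally show ?thesis using 0 by simp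
  next
    case (Suc b)
    have "cnt (Rs ! Suc j) (Suc b) \<le> cnt (Rs ! j) b"
      using abv by (simp add: row_above_def)
    also have "\<dots> \<le> b - j"
      using Suc.IH[of b] Suc.prems by simp
    finally show ?thesis
      using Suc by simp
  qed
qed

lemma tab_card_le:
  assumes "tab N Rs" "j < length Rs"
  shows "card (Rs ! j) \<le> N - 1 - j"
proof -
  have "Rs ! j \<subseteq> {1..<N}" using assms by (auto simp: tab_def)
  then have "cnt (Rs ! j) (N - 1) = card (Rs ! j)" by (intro cnt_eq_card) fastforce
  then show ?thesis using tab_cnt_le[OF assms, of "N - 1"] by simp
qed

definition stair :: "nat \<Rightarrow> nat set list" where
  "stair N = map (\<lambda>j. {Suc j..<N}) [0..<N]"

lemma tab_row_eq:
  assumes "tab N Rs" "j < length Rs" "card (Rs ! j) = N - 1 - j"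
  shows "Rs ! j = {Suc j..<N}"
proof (rule card_subset_eq)
  have "cnt (Rs ! j) j = 0" using tab_cnt_le[OF assms(1,2), of j] by simp
  then have "Rs ! j \<inter> {..j} = {}" by (simp add: cnt_def)
  moreover have "Rs ! j \<subseteq> {1..<N}" using assms by (auto simp: tab_def)
  ultimately show "Rs ! j \<subseteq> {Suc j..<N}" by (auto simp: disjoint_iff not_le Suc_le_eq)
qed (use assms in auto)

text \<open>The upper bounds for the rows add up to the given number of cells. Hence all of them are
  attained, and a row of maximal length is forced.\<close>

lemma tab_eq_stair:
  assumes "tab N Rs" "length Rs = N" "sum_list (map card Rs) = (\<Sum>j<N. j)"
  shows "Rs = stair N"
proof -
  have "(\<Sum>j<N. card (Rs ! j)) = sum_list (map card Rs)"
    using assms(2) by (simp add: sum_list_sum_nth atLeast0LessThan)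
  also have "\<dots> = (\<Sum>j<N. j)"
    by (fact assms(3))
  also have "\<dots> = (\<Sum>j<N. N - 1 - j)"
    by (rule sum.reindex_bij_witness[of _ "\<lambda>j. N - 1 - j" "\<lambda>j. N - 1 - j"]) auto
  finally have sum_eq: "(\<Sum>j<N. card (Rs ! j)) = (\<Sum>j<N. N - 1 - j)" .
  have "card (Rs ! j) = N - 1 - j" if "j < N" for j
    using sum_eq
  proof (rule sum_mono_inv)
    show "card (Rs ! i) \<le> N - 1 - i" if "i \<in> {..<N}" for i
      using tab_card_le[OF assms(1)] assms(2) that by simp
  qed (use that in auto)
  then have "Rs ! j = {Suc j..<N}" if "j < N" for j
    using tab_row_eq[OF assms(1), of j] that assms(2) by simp
  then show ?thesis
    using assms(2) by (intro nth_equalityI) (simp_all add: stair_def)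
qed

section \<open>Column words of reduced words\<close>

text \<open>The height of column \<open>k\<close> when the rows have lengths \<open>\<rho>\<close>.
  It ignores the order of the rows and so serves partitions and compositions alike.\<close>

definition hts :: "nat list \<Rightarrow> nat \<Rightarrow> nat" where
  "hts \<rho> k = length (filter (\<lambda>r. k \<le> r) \<rho>)"

lemma hts_eq_card: "hts \<rho> k = card {j. j < length \<rho> \<and> k \<le> \<rho> ! j}"
  by (simp add: hts_def length_filter_conv_card)

lemma hts_update:
  "i < length \<rho> \<Longrightarrow> hts (\<rho>[i := Suc (\<rho> ! i)]) k = hts \<rho> k + (if k = Suc (\<rho> ! i) then 1 else 0)"
  by (induction \<rho> arbitrary: i) (auto simp: hts_def nth_Cons' split: nat.split)

lemma hts_antimono: "k \<le> l \<Longrightarrow> hts \<rho> l \<le> hts \<rho> k"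
  unfolding hts_eq_card by (intro card_mono) auto

lemma hts_le_length: "hts \<rho> k \<le> length \<rho>"
  by (simp add: hts_def)

lemma less_hts_iff:
  assumes "\<And>i j. i \<le> j \<Longrightarrow> j < length \<rho> \<Longrightarrow> \<rho> ! j \<le> \<rho> ! i" "j < length \<rho>"
  shows "j < hts \<rho> k \<longleftrightarrow> k \<le> \<rho> ! j"
proof
  assume less: "j < hts \<rho> k"
  show "k \<le> \<rho> ! j"
  proof (rule ccontr)
    assume nle: "\<not> k \<le> \<rho> ! j"
    have "i < j" if "i < length \<rho>" "k \<le> \<rho> ! i" for i
      using assms(1)[of j i] that nle by (cases "j \<le> i") auto
    then have "{i. i < length \<rho> \<and> k \<le> \<rho> ! i} \<subseteq> {..<j}"
      by auto
    then have "hts \<rho> k \<le> card {..<j}"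
      unfolding hts_eq_card by (intro card_mono) auto
    with less show False by simp
  qed
next
  assume le: "k \<le> \<rho> ! j"
  have "k \<le> \<rho> ! i" if "i \<le> j" for i
    using assms(1)[OF that assms(2)] le by simp
  then have "{..j} \<subseteq> {i. i < length \<rho> \<and> k \<le> \<rho> ! i}"
    using assms(2) by auto
  then have "card {..j} \<le> hts \<rho> k"
    unfolding hts_eq_card by (intro card_mono) auto
  then show "j < hts \<rho> k" by simp
qed

text \<open>Yamanouchi words: the letter counts of each prefix are the column heights of a
  partition.\<close>

definition lattice_word :: "nat list \<Rightarrow> bool" where
  "lattice_word c \<longleftrightarrow> 0 \<notin> set c \<and>
     (\<forall>t k. 1 \<le> k \<longrightarrow> count_list (take t c) (Suc k) \<le> count_list (take t c) k)"

text \<open>Column heights of every prefix drop by at most 1 as long as they are at least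
  \<open>m\<close>. For a shape with sorted rows this says that each nonempty row from the
  \<open>m\<close>-th on is shorter than all rows above it, as in \<open>steep\<close>.\<close>

definition thin :: "nat \<Rightarrow> nat list \<Rightarrow> bool" where
  "thin m c \<longleftrightarrow> (\<forall>t k. 1 \<le> k \<and> m \<le> count_list (take t c) k \<longrightarrow>
     count_list (take t c) k \<le> Suc (count_list (take t c) (Suc k)))"

text \<open>Equal neighbours count as a descent, matching the weakly-left condition in
  \<open>tableau_descents\<close>; for reduced words equal neighbours do not occur.\<close>

definition col_descents :: "nat list \<Rightarrow> nat set" where
  "col_descents c = {i. 1 \<le> i \<and> i < length c \<and> c ! i \<le> c ! (i - 1)}"

lemma all_take_snoc: "(\<forall>t. P (take t (xs @ [x]))) \<longleftrightarrow> (\<forall>t. P (take t xs)) \<and> P (xs @ [x])"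
proof
  assume *: "\<forall>t. P (take t (xs @ [x]))"
  have "P (take t xs)" for t
    using *[rule_format, of "min t (length xs)"] by (simp add: min_def split: if_splits)
  moreover have "P (xs @ [x])"
    using *[rule_format, of "Suc (length xs)"] by simp
  ultimately show "(\<forall>t. P (take t xs)) \<and> P (xs @ [x])" by blast
next
  assume *: "(\<forall>t. P (take t xs)) \<and> P (xs @ [x])"
  show "\<forall>t. P (take t (xs @ [x]))"
  proof
    fix t show "P (take t (xs @ [x]))"
      using * by (cases "t \<le> length xs") auto
  qed
qed

lemma lattice_word_snoc:
  "lattice_word (c @ [k]) \<longleftrightarrow> lattice_word c \<and> 1 \<le> k \<and>
     (\<forall>l\<ge>1. count_list (c @ [k]) (Suc l) \<le> count_list (c @ [k]) l)"
  unfolding lattice_word_def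
  using all_take_snoc[of "\<lambda>c. \<forall>l. 1 \<le> l \<longrightarrow> count_list c (Suc l) \<le> count_list c l" c k] by auto

lemma thin_snoc:
  "thin m (c @ [k]) \<longleftrightarrow> thin m c \<and>
     (\<forall>l\<ge>1. m \<le> count_list (c @ [k]) l \<longrightarrow> count_list (c @ [k]) l \<le> Suc (count_list (c @ [k]) (Suc l)))"
  unfolding thin_def
  using all_take_snoc[of "\<lambda>c. \<forall>l. 1 \<le> l \<and> m \<le> count_list c l \<longrightarrow>
      count_list c l \<le> Suc (count_list c (Suc l))" c k] by auto

lemma word_descents_snoc:
  "word_descents (\<sigma> @ [x, y]) =
     word_descents (\<sigma> @ [x]) \<union> (if y < x then {Suc (length \<sigma>)} else {})"
  by (auto simp: word_descents_def nth_append nth_Cons' less_Suc_eq split: if_splits)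

lemma col_descents_snoc:
  "col_descents (c @ [x, y]) = col_descents (c @ [x]) \<union> (if y \<le> x then {Suc (length c)} else {})"
  by (auto simp: col_descents_def nth_append nth_Cons' less_Suc_eq split: if_splits)

text \<open>The recording tableau is kept as the word of columns of its cells: the new cell of row
  \<open>i\<close> lies in the column given by the new length of that row.\<close>

inductive EG :: "nat \<Rightarrow> nat list \<Rightarrow> nat list \<Rightarrow> nat set list \<Rightarrow> bool" for N where
  EG_Nil: "EG N [] [] (replicate N {})"
| EG_snoc: "EG N \<sigma> c Rs \<Longrightarrow> x \<in> {1..<N} \<Longrightarrow> ins x Rs i Rs' \<Longrightarrow>
    EG N (\<sigma> @ [x]) (c @ [card (Rs' ! i)]) Rs'"

lemma tab_replicate: "tab N (replicate n {})"
proof (induction n)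
  case (Suc n)
  have "row_above {} {}" by (simp add: row_above_def cnt_def)
  with Suc show ?case by (cases n) (auto simp: tab_Cons)
qed (simp add: tab_def)

lemma reading_replicate: "reading (replicate n {}) = []"
  by (induction n) auto

lemma EG_tab: "EG N \<sigma> c Rs \<Longrightarrow> tab N Rs"
  by (induction rule: EG.induct) (auto intro: tab_replicate ins_tab)

lemma EG_length: "EG N \<sigma> c Rs \<Longrightarrow> length Rs = N \<and> length c = length \<sigma>"
  by (induction rule: EG.induct) (auto dest: ins_length)

lemma EG_lists: "EG N \<sigma> c Rs \<Longrightarrow> \<sigma> \<in> lists {1..<N}"
  by (induction rule: EG.induct) auto

lemma EG_finite: "EG N \<sigma> c Rs \<Longrightarrow> \<forall>R\<in>set Rs. finite R"
  using EG_tab tab_finite by blast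

lemma EG_reading:
  "EG N \<sigma> c Rs \<Longrightarrow> word_perm (reading Rs) = word_perm \<sigma> \<and> length (reading Rs) = length \<sigma>"
proof (induction rule: EG.induct)
  case (EG_snoc \<sigma> c Rs x i Rs')
  then show ?case
    using ins_reading[OF EG_snoc.hyps(3) EG_finite[OF EG_snoc.hyps(1)]]
      ins_reading_length[OF EG_snoc.hyps(3) EG_finite[OF EG_snoc.hyps(1)]]
    by (simp only: word_perm_snoc) simp
qed (simp add: reading_replicate)

lemma ins_nth_card:
  assumes "ins x Rs i Rs'" "\<forall>R\<in>set Rs. finite R" "j < length Rs"
  shows "card (Rs' ! j) = card (Rs ! j) + (if j = i then 1 else 0)"
proof -
  have "map card Rs' ! j = (map card Rs)[i := Suc (map card Rs ! i)] ! j"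
    by (simp only: ins_shape[OF assms(1,2)])
  then show ?thesis
    using ins_length[OF assms(1)] assms(3) by (cases "j = i") auto
qed

lemma ins_hts:
  assumes "ins x Rs i Rs'" "\<forall>R\<in>set Rs. finite R"
  shows "hts (map card Rs') k = hts (map card Rs) k + (if k = card (Rs' ! i) then 1 else 0)"
proof -
  have i: "i < length Rs" using ins_length[OF assms(1)] by simp
  show ?thesis
    unfolding ins_shape[OF assms] using i ins_nth_card[OF assms i] by (subst hts_update) auto
qed

lemma EG_hts: "EG N \<sigma> c Rs \<Longrightarrow> 1 \<le> k \<Longrightarrow> hts (map card Rs) k = count_list c k"
proof (induction rule: EG.induct)
  case (EG_snoc \<sigma> c Rs x i Rs')
  then show ?case
    by (simp add: ins_hts[OF EG_snoc.hyps(3) EG_finite[OF EG_snoc.hyps(1)]])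
qed (simp add: hts_def)

lemma EG_lattice_word: "EG N \<sigma> c Rs \<Longrightarrow> lattice_word c"
proof (induction rule: EG.induct)
  case (EG_snoc \<sigma> c Rs x i Rs')
  have EG': "EG N (\<sigma> @ [x]) (c @ [card (Rs' ! i)]) Rs'"
    using EG_snoc.hyps by (rule EG.EG_snoc)
  have "1 \<le> card (Rs' ! i)"
    using ins_nth_card[OF EG_snoc.hyps(3) EG_finite[OF EG_snoc.hyps(1)], of i]
      ins_length[OF EG_snoc.hyps(3)] by simp
  then show ?case
    unfolding lattice_word_snoc
    using EG_snoc.IH EG_hts[OF EG'] hts_antimono[of _ "Suc _" "map card Rs'"] by (metis le_SucI le_refl)
qed (simp add: lattice_word_def)

lemma EG_ex: "reduced N \<sigma> \<Longrightarrow> \<exists>c Rs. EG N \<sigma> c Rs"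
proof (induction \<sigma> rule: rev_induct)
  case Nil
  show ?case using EG.EG_Nil by blast
next
  case (snoc x \<sigma>)
  have "reduced N \<sigma>"
    using reduced_factor[of N "[]" \<sigma> "[x]"] snoc.prems by simp
  then obtain c Rs where EG: "EG N \<sigma> c Rs"
    using snoc.IH by blast
  have x: "x \<in> {1..<N}"
    using snoc.prems by (simp add: reduced_def reduced_word_def)
  have "reduced N (reading Rs @ [x])"
    using EG_reading[OF EG] tab_reading[OF EG_tab[OF EG]] x
    by (intro reduced_cong[OF snoc.prems]) (simp_all only: word_perm_snoc length_append, auto)
  \<comment> \<open>By \<open>tab_card_le\<close> the row of index \<open>N - 1\<close> has length
    0, so a list of \<open>N\<close> rows always has room.\<close>
  moreover have "{} \<in> set Rs"
  proof -
    have "N - 1 < length Rs"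
      using x EG_length[OF EG] by simp
    moreover from this have "card (Rs ! (N - 1)) = 0"
      using tab_card_le[OF EG_tab[OF EG], of "N - 1"] by simp
    ultimately show ?thesis
      using EG_finite[OF EG] by (metis card_0_eq nth_mem)
  qed
  ultimately obtain i Rs' where "ins x Rs i Rs'"
    using ex_ins[OF EG_tab[OF EG]] by blast
  then show ?case
    using EG.EG_snoc[OF EG x] by blast
qed

lemma EG_functional: "EG N \<sigma> c Rs \<Longrightarrow> EG N \<sigma> c' Rs' \<Longrightarrow> c = c' \<and> Rs = Rs'"
proof (induction arbitrary: c' Rs' rule: EG.induct)
  case EG_Nil
  then show ?case by (cases rule: EG.cases) auto
next
  case (EG_snoc \<sigma> c Rs x i Rs')
  note IH = EG_snoc.IH and step = EG_snoc.hyps(3)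
  from EG_snoc.prems show ?case
  proof (cases rule: EG.cases)
    case (EG_snoc \<sigma>0 c0 Rs0 x0 i0)
    then have "c = c0" "Rs = Rs0"
      using IH[of c0 Rs0] by auto
    then show ?thesis
      using EG_snoc ins_functional[OF step] by auto
  qed simp
qed

section \<open>Recovering a reduced word from its column word\<close>

lemma tab_less_hts_iff:
  "tab N Rs \<Longrightarrow> j < length Rs \<Longrightarrow> j < hts (map card Rs) k \<longleftrightarrow> k \<le> card (Rs ! j)"
  using less_hts_iff[of "map card Rs" j k] tab_card_antimono[of N Rs] by simp

text \<open>The new cell is a corner, hence the bottom of its column, so its row can be read off
  from the column. \<open>ins_injective\<close> needs the row, whereas the column word stores only
  columns.\<close>

lemma ins_row_hts:
  assumes "ins x Rs i Rs'" "tab N Rs" "tab N Rs'"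
  shows "hts (map card Rs') (card (Rs' ! i)) = Suc i"
proof (rule antisym)
  have fin: "\<forall>R\<in>set Rs. finite R" using tab_finite[OF assms(2)] by blast
  have i: "i < length Rs" "length Rs' = length Rs" using ins_length[OF assms(1)] by auto
  then show "Suc i \<le> hts (map card Rs') (card (Rs' ! i))"
    using tab_less_hts_iff[OF assms(3), of i "card (Rs' ! i)"] by simp
  show "hts (map card Rs') (card (Rs' ! i)) \<le> Suc i"
  proof (cases "Suc i < length Rs")
    case True
    then have "card (Rs' ! Suc i) = card (Rs ! Suc i)" "card (Rs ! Suc i) \<le> card (Rs ! i)"
        "card (Rs' ! i) = Suc (card (Rs ! i))"
      using ins_nth_card[OF assms(1) fin] i tab_card_antimono[OF assms(2)] by auto
    then show ?thesis
      using tab_less_hts_iff[OF assms(3), of "Suc i" "card (Rs' ! i)"] True i by simp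
  next
    case False
    then show ?thesis
      using hts_le_length[of "map card Rs'" "card (Rs' ! i)"] i by simp
  qed
qed

lemma EG_injective: "EG N \<sigma> c Rs \<Longrightarrow> EG N \<sigma>' c Rs \<Longrightarrow> \<sigma> = \<sigma>'"
proof (induction arbitrary: \<sigma>' rule: EG.induct)
  case EG_Nil
  then show ?case by (cases rule: EG.cases) auto
next
  case (EG_snoc \<sigma> c Rs x i Rs')
  note tabs = EG_tab[OF EG_snoc.hyps(1)] EG_tab[OF EG_snoc.prems]
  note IH = EG_snoc.IH and step = EG_snoc.hyps(3)
  have i: "Suc i = hts (map card Rs') (card (Rs' ! i))"
    using ins_row_hts[OF EG_snoc.hyps(3) tabs] by simp
  from EG_snoc.prems show ?case
  proof (cases rule: EG.cases)
    case (EG_snoc \<sigma>0 c0 Rs0 x0 i0)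
    have "Suc i0 = hts (map card Rs') (card (Rs' ! i0))"
      using ins_row_hts[OF EG_snoc(5) EG_tab[OF EG_snoc(3)] tabs(2)] by simp
    then have "i0 = i"
      using i EG_snoc by simp
    then have "x0 = x \<and> Rs0 = Rs"
      using ins_injective[OF EG_snoc(5), of x Rs] step by simp
    then show ?thesis
      using EG_snoc IH[of \<sigma>0] by simp
  qed simp
qed

text \<open>The last letter of \<open>c\<close> names the column whose bottom cell is removed. The
  lattice condition on the shorter word makes this cell a corner, so \<open>ex_ins_reverse\<close>
  applies, and the smaller tableau again has a reduced reading word.\<close>

lemma EG_ex_reverse:
  assumes "lattice_word c" "tab N Rs" "length Rs = N" "reduced N (reading Rs)"
    and "\<And>k. 1 \<le> k \<Longrightarrow> hts (map card Rs) k = count_list c k"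
  shows "\<exists>\<sigma>. EG N \<sigma> c Rs"
  using assms
proof (induction c arbitrary: Rs rule: rev_induct)
  case Nil
  have "R = {}" if "R \<in> set Rs" for R
  proof -
    have "card R = 0"
      using Nil.prems(5)[of 1] that by (auto simp: hts_def filter_empty_conv not_less_eq_eq)
    then show ?thesis using tab_finite[OF Nil.prems(2) that] by simp
  qed
  then have "Rs = replicate N {}"
    using Nil.prems(3) by (simp add: replicate_eqI)
  then show ?case using EG.EG_Nil by blast
next
  case (snoc k c)
  have k: "1 \<le> k" "lattice_word c"
    and lat: "\<And>l. 1 \<le> l \<Longrightarrow> count_list (c @ [k]) (Suc l) \<le> count_list (c @ [k]) l"
    using snoc.prems(1) unfolding lattice_word_snoc by auto
  define i where "i = count_list c k"
  have hk: "hts (map card Rs) k = Suc i"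
    using snoc.prems(5)[OF k(1)] by (simp add: i_def)
  then have iN: "i < length Rs"
    using hts_le_length[of "map card Rs" k] by simp
  have "hts (map card Rs) (Suc k) = count_list c (Suc k)"
    using snoc.prems(5)[of "Suc k"] by simp
  also have "\<dots> \<le> i"
    using k unfolding i_def lattice_word_def by (metis order.refl take_all)
  finally have "\<not> Suc k \<le> card (Rs ! i)"
    using tab_less_hts_iff[OF snoc.prems(2) iN, of "Suc k"] by simp
  moreover have "k \<le> card (Rs ! i)"
    using tab_less_hts_iff[OF snoc.prems(2) iN, of k] hk by simp
  ultimately have ci: "card (Rs ! i) = k" by simp
  have "card (Rs ! Suc i) < card (Rs ! i)" if "Suc i < length Rs"
    using tab_less_hts_iff[OF snoc.prems(2) that, of k] hk ci by simp
  moreover have "Rs ! i \<noteq> {}" using ci k by auto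
  ultimately obtain x Ss where x: "ins x Ss i Rs" "tab N Ss" "x \<in> {1..<N}"
    using ex_ins_reverse[OF snoc.prems(2) iN] snoc.prems(4) by blast
  have fin: "\<forall>S\<in>set Ss. finite S" using tab_finite[OF x(2)] by blast
  have "reduced N (reading Ss @ [x])"
    using ins_reading[OF x(1) fin] ins_reading_length[OF x(1) fin] tab_reading[OF x(2)] x(3)
    by (intro reduced_cong[OF snoc.prems(4)]) auto
  then have "reduced N (reading Ss)"
    using reduced_factor[of N "[]" "reading Ss" "[x]"] by simp
  moreover have "hts (map card Ss) l = count_list c l" if "1 \<le> l" for l
    using ins_hts[OF x(1) fin, of l] snoc.prems(5)[OF that] ci by (auto split: if_splits)
  moreover have "length Ss = N" using ins_length[OF x(1)] snoc.prems(3) by simp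
  ultimately obtain \<sigma> where "EG N \<sigma> c Ss"
    using snoc.IH[OF k(2) x(2)] by blast
  then have "EG N (\<sigma> @ [x]) (c @ [k]) Rs"
    using EG.EG_snoc x ci by metis
  then show ?case by blast
qed

lemma stair_shape: "map card (stair N) = map (\<lambda>j. N - Suc j) [0..<N]"
  by (simp add: stair_def)

lemma hts_stair: "1 \<le> k \<Longrightarrow> hts (map card (stair N)) k = N - k"
proof -
  assume "1 \<le> k"
  then have "{j. j < N \<and> k \<le> N - Suc j} = {..<N - k}" by auto
  then show ?thesis
    unfolding stair_shape hts_eq_card by (simp cong: conj_cong)
qed

text \<open>Every reduced word of the longest permutation has the same insertion tableau, as no
  other tableau has that many cells. With the tableau fixed, the column word alone determines the
  reduced word.\<close>

lemma EG_long_perm: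
  assumes "reduced_word N (long_perm N) \<sigma>"
  shows "\<exists>c. EG N \<sigma> c (stair N)"
proof -
  have "reduced N \<sigma>"
    using assms by (simp add: reduced_def reduced_word_def)
  then obtain c Rs where EG: "EG N \<sigma> c Rs"
    using EG_ex by blast
  have "sum_list (map card Rs) = (\<Sum>j<N. j)"
    using EG_reading[OF EG] assms by (simp add: reduced_word_long_perm_iff length_reading)
  then have "Rs = stair N"
    using EG_tab[OF EG] EG_length[OF EG] by (intro tab_eq_stair) auto
  with EG show ?thesis by blast
qed

lemma EG_stair_count: "EG N \<sigma> c (stair N) \<Longrightarrow> 1 \<le> k \<Longrightarrow> count_list c k = N - k"
  using EG_hts hts_stair by metis

lemma EG_stair_long_perm:
  assumes "lattice_word c" "\<And>k. 1 \<le> k \<Longrightarrow> count_list c k = N - k"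
  shows "\<exists>\<sigma>. EG N \<sigma> c (stair N) \<and> reduced_word N (long_perm N) \<sigma>"
proof -
  obtain \<tau> where \<tau>: "reduced_word N (long_perm N) \<tau>"
    using ex_word_of_long_perm[of N] by (auto simp: reduced_word_long_perm_iff)
  then obtain d where EG: "EG N \<tau> d (stair N)"
    using EG_long_perm by blast
  have "reduced N \<tau>"
    using \<tau> by (simp add: reduced_def reduced_word_def)
  \<comment> \<open>Reducedness is transferred from an arbitrary reduced word of the longest
    permutation, whose insertion tableau is the staircase.\<close>
  then have red: "reduced N (reading (stair N))"
    by (rule reduced_cong) (use EG_reading[OF EG] tab_reading[OF EG_tab[OF EG]] in blast)+
  obtain \<sigma> where \<sigma>: "EG N \<sigma> c (stair N)"
    using EG_ex_reverse[OF assms(1) EG_tab[OF EG] _ red] EG_length[OF EG] assms(2) hts_stair by metis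
  then have "reduced_word N (long_perm N) \<sigma>"
    using EG_reading[OF \<sigma>] EG_reading[OF EG] EG_lists[OF \<sigma>] \<tau>
    unfolding reduced_word_long_perm_iff by metis
  with \<sigma> show ?thesis by blast
qed

section \<open>Descents under insertion\<close>

lemma reduced_neq:
  assumes "reduced N (\<sigma> @ [x, y])"
  shows "x \<noteq> y"
proof
  assume "x = y"
  have "reduced N [x, y]"
    using reduced_factor[of N \<sigma> "[x, y]" "[]"] assms by simp
  from reduced_minimal[OF this, of "[]"] \<open>x = y\<close> show False
    by (simp add: word_perm_Cons)
qed

text \<open>The two comparisons of paths give the relative position of the end rows; weakly
  decreasing row lengths turn it into a comparison of columns.\<close>

lemma ins_descent_iff:
  assumes "ins x Rs i Rs'" "ins x' Rs' i' Rs''" "tab N Rs" "tab N Rs'" "tab N Rs''" "x \<noteq> x'"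
  shows "x' < x \<longleftrightarrow> card (Rs'' ! i') \<le> card (Rs' ! i)"
proof -
  have fin: "\<forall>R\<in>set Rs'. finite R" using tab_finite[OF assms(4)] by blast
  have len: "i < length Rs'" "i' < length Rs'" "length Rs'' = length Rs'"
    using ins_length[OF assms(1)] ins_length[OF assms(2)] by auto
  have c: "card (Rs'' ! i') = Suc (card (Rs' ! i'))"
    using ins_nth_card[OF assms(2) fin len(2)] by simp
  show ?thesis
  proof (cases "x' < x")
    case True
    then have ii: "i < i'" by (rule ins_greater_imp_row_less[OF assms(1,2)])
    then have "card (Rs'' ! i') \<le> card (Rs'' ! i)"
      using tab_card_antimono[OF assms(5), of i i'] len by simp
    also have "\<dots> = card (Rs' ! i)"
      using ins_nth_card[OF assms(2) fin len(1)] ii by simp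
    finally show ?thesis using True by simp
  next
    case False
    then have "i' \<le> i" using assms(6) by (intro ins_less_imp_row_le[OF assms(1,2)]) simp
    then have "card (Rs' ! i) \<le> card (Rs' ! i')"
      using tab_card_antimono[OF assms(4), of i' i] len by simp
    then show ?thesis using False c by simp
  qed
qed

lemma EG_descents:
  "EG N \<sigma> c Rs \<Longrightarrow> reduced N \<sigma> \<Longrightarrow> word_descents \<sigma> = col_descents c"
proof (induction rule: EG.induct)
  case EG_Nil
  show ?case by (simp add: word_descents_def col_descents_def)
next
  case (EG_snoc \<sigma> c Rs x i Rs')
  have red: "reduced N \<sigma>"
    using reduced_factor[of N "[]" \<sigma> "[x]"] EG_snoc.prems by simp
  note EG = EG_snoc.hyps(1) and x = EG_snoc.hyps(2) and step = EG_snoc.hyps(3)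
    and IH = EG_snoc.IH and prems = EG_snoc.prems
  from EG show ?case
  proof (cases rule: EG.cases)
    case EG_Nil
    then show ?thesis by (auto simp: word_descents_def col_descents_def)
  next
    case (EG_snoc \<sigma>0 c0 Rs0 x0 i0)
    have tabs: "tab N Rs0" "tab N Rs" "tab N Rs'"
      using EG_tab[OF EG_snoc(3)] EG_tab[OF EG] ins_tab[OF step _ x] by auto
    have "x0 \<noteq> x"
      using reduced_neq[of N \<sigma>0 x0 x] prems EG_snoc by simp
    from ins_descent_iff[OF EG_snoc(5) step tabs this]
    have "x < x0 \<longleftrightarrow> card (Rs' ! i) \<le> card (Rs ! i0)" .
    moreover have "word_descents \<sigma> = col_descents c"
      using IH red by blast
    moreover have "length \<sigma>0 = length c0"
      using EG_length[OF EG_snoc(3)] by simp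
    ultimately show ?thesis
      using EG_snoc by (simp add: word_descents_snoc col_descents_snoc)
  qed
qed

section \<open>Graph permutations and row lengths of the insertion tableau\<close>

lemma weak_covers_card:
  assumes "weak_covers N u v"
  shows "v permutes {1..N} \<and> card (inversions v) = Suc (card (inversions u))"
proof -
  obtain i where u: "u permutes {1..N}" and i: "i \<in> {1..<N}" "u i < u (Suc i)" "v = u \<circ> adj i"
    using assms by (auto simp: weak_covers_def)
  then show ?thesis
    using card_inversions_step(1)[OF u i(2)] permutes_compose[OF adj_permutes[OF i(1)] u] by simp
qed

lemma weak_le_card: "weak_le N u v \<Longrightarrow> u = v \<or> card (inversions u) < card (inversions v)"
  unfolding weak_le_def
proof (induction rule: rtranclp_induct)
  case (step v w)
  then show ?case using weak_covers_card[of N v w] by auto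
qed simp

lemma weak_le_take:
  assumes "\<sigma> \<in> lists {1..<N}" "card (inversions (word_perm \<sigma>)) = length \<sigma>"
    and "k \<le> l" "l \<le> length \<sigma>"
  shows "weak_le N (word_perm (take k \<sigma>)) (word_perm (take l \<sigma>))"
  using assms(3,4)
proof (induction l rule: dec_induct)
  case base
  show ?case by (simp add: weak_le_def)
next
  case (step l)
  have "take l \<sigma> \<in> lists {1..<N}"
    using assms(1) by (auto dest: in_set_takeD)
  then have "word_perm (take l \<sigma>) permutes {1..N}"
    by (rule word_perm_permutes)
  moreover have "\<sigma> ! l \<in> {1..<N}"
    using assms(1) step.prems nth_mem[of l \<sigma>] by auto
  moreover have "word_perm (take (Suc l) \<sigma>) = word_perm (take l \<sigma>) \<circ> adj (\<sigma> ! l)"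
    using step.prems by (simp add: take_Suc_conv_app_nth word_perm_snoc)
  ultimately have "weak_covers N (word_perm (take l \<sigma>)) (word_perm (take (Suc l) \<sigma>))"
    using take_word_ascent[OF assms(1,2), of l] step.prems unfolding weak_covers_def by auto
  then show ?case
    using step by (simp add: weak_le_def rtranclp.rtrancl_into_rtrancl)
qed

text \<open>The number of inversions is injective on a chain of the weak order, so no chain has more
  elements than that of a reduced word of the longest permutation. Such a chain is of maximum length
  as soon as it lies in the tubing lattice.\<close>

lemma LMR_iff:
  "\<sigma> \<in> LMR m n \<longleftrightarrow> reduced_word (m + n) (long_perm (m + n)) \<sigma> \<and>
     (\<forall>t. graph_perm (m + n) (lollipop m n) (word_perm (take t \<sigma>)))"
proof -
  let ?N = "m + n" and ?G = "{w. graph_perm (m + n) (lollipop m n) w}"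
  have "max_length_chain (weak_le ?N) ?G (word_chain \<sigma>) \<longleftrightarrow>
      (\<forall>t. graph_perm ?N (lollipop m n) (word_perm (take t \<sigma>)))"
    if red: "reduced_word ?N (long_perm ?N) \<sigma>"
  proof -
    have \<sigma>: "\<sigma> \<in> lists {1..<?N}" "card (inversions (word_perm \<sigma>)) = length \<sigma>"
      using red by (simp_all add: reduced_word_long_perm_iff card_inversions_long_perm)
    have chain: "word_chain \<sigma> = (\<lambda>k. word_perm (take k \<sigma>)) ` {..length \<sigma>}"
      by (auto simp: word_chain_def)
    have "inj_on (\<lambda>k. word_perm (take k \<sigma>)) {..length \<sigma>}"
      by (rule inj_onI) (metis atMost_iff card_inversions_take[OF \<sigma>])
    then have card: "card (word_chain \<sigma>) = Suc (length \<sigma>)"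
      unfolding chain by (simp add: card_image)
    have le: "weak_le ?N x y \<or> weak_le ?N y x" if xy: "x \<in> word_chain \<sigma>" "y \<in> word_chain \<sigma>" for x y
    proof -
      obtain k l where "x = word_perm (take k \<sigma>)" "y = word_perm (take l \<sigma>)" "k \<le> length \<sigma>" "l \<le> length \<sigma>"
        using xy by (auto simp: word_chain_def)
      then show ?thesis
        using weak_le_take[OF \<sigma>, of k l] weak_le_take[OF \<sigma>, of l k] by (cases "k \<le> l") auto
    qed
    have bound: "card D \<le> Suc (length \<sigma>)" if D: "chain_in (weak_le ?N) ?G D" for D
    proof -
      have perm: "w permutes {1..?N}" if "w \<in> D" for w
        using D that by (auto simp: chain_in_def graph_perm_def)
      have "inj_on (\<lambda>w. card (inversions w)) D"
      proof (rule inj_onI)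
        fix u v assume uv: "u \<in> D" "v \<in> D" "card (inversions u) = card (inversions v)"
        then have "weak_le ?N u v \<or> weak_le ?N v u"
          using D by (simp add: chain_in_def)
        then show "u = v"
          using weak_le_card[of ?N u v] weak_le_card[of ?N v u] uv(3) by auto
      qed
      moreover have "(\<lambda>w. card (inversions w)) ` D \<subseteq> {..length \<sigma>}"
      proof
        fix c assume "c \<in> (\<lambda>w. card (inversions w)) ` D"
        then obtain w where w: "w \<in> D" "c = card (inversions w)" by blast
        have "word_perm \<sigma> = long_perm ?N"
          using red by (simp add: reduced_word_def)
        then show "c \<in> {..length \<sigma>}"
          using card_inversions_le[OF perm[OF w(1)]] \<sigma>(2) w(2) by simp
      qed
      ultimately show ?thesis
        using card_inj_on_le[of "\<lambda>w. card (inversions w)" D "{..length \<sigma>}"] by simp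
    qed
    have "max_length_chain (weak_le ?N) ?G (word_chain \<sigma>) \<longleftrightarrow> word_chain \<sigma> \<subseteq> ?G"
    proof
      assume "word_chain \<sigma> \<subseteq> ?G"
      moreover have "finite (word_chain \<sigma>)" by (simp add: chain)
      ultimately show "max_length_chain (weak_le ?N) ?G (word_chain \<sigma>)"
        using le bound unfolding max_length_chain_def chain_in_def card by blast
    qed (simp add: max_length_chain_def chain_in_def)
    also have "\<dots> \<longleftrightarrow> (\<forall>t. graph_perm ?N (lollipop m n) (word_perm (take t \<sigma>)))"
    proof
      assume *: "word_chain \<sigma> \<subseteq> ?G"
      show "\<forall>t. graph_perm ?N (lollipop m n) (word_perm (take t \<sigma>))"
      proof
        fix t
        have "take t \<sigma> = take (min t (length \<sigma>)) \<sigma>" by (simp add: min_def)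
        moreover have "word_perm (take (min t (length \<sigma>)) \<sigma>) \<in> word_chain \<sigma>"
          unfolding chain by (rule imageI) simp
        ultimately show "graph_perm ?N (lollipop m n) (word_perm (take t \<sigma>))"
          using * by auto
      qed
    qed (auto simp: chain)
    finally show ?thesis .
  qed
  then show ?thesis
    by (auto simp: LMR_def)
qed

text \<open>Pattern form of the graph condition. A vertex \<open>z \<ge> m\<close> separates the
  smaller from the larger vertices of the lollipop graph, so \<open>x\<close> is cut off from the
  current maximum if a larger \<open>y\<close> has appeared by then but \<open>z\<close> has
  not.\<close>

definition avoids :: "nat \<Rightarrow> (nat \<Rightarrow> nat) \<Rightarrow> bool" where
  "avoids m w \<longleftrightarrow> (\<forall>x z y. x < z \<and> z < y \<and> m \<le> z \<and> (x, y) \<in> inversions w \<longrightarrow> (x, z) \<in> inversions w)"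

lemma graph_perm_imp_avoids:
  assumes "graph_perm (m + n) (lollipop m n) w"
  shows "avoids m w"
  unfolding avoids_def
proof (intro allI impI, elim conjE)
  fix x z y assume xzy: "x < z" "z < y" "m \<le> z" "(x, y) \<in> inversions w"
  have w: "w permutes {1..m + n}" using assms by (simp add: graph_perm_def)
  have w_inv: "w (inv w a) = a" for a by (rule permutes_inverses(1)[OF w])
  have xN: "x \<in> {1..m + n}" "y \<in> {1..m + n}"
    using inversions_subset[OF w] xzy(4) by auto
  have yx: "inv w y < inv w x" using xzy(4) by (simp add: inversions_def)
  define i U where "i = inv w x" and "U = w ` {1..i}"
  have pos: "inv w a \<in> {1..m + n}" if "a \<in> {1..m + n}" for a
    using that permutes_in_image[OF permutes_inv[OF w]] by simp
  have i: "i \<in> {1..m + n}" "w i = x"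
    using pos[OF xN(1)] by (simp_all add: i_def w_inv)
  have "y \<in> U"
    using pos[OF xN(2)] yx w_inv[of y] unfolding U_def i_def by (intro image_eqI[of _ _ "inv w y"]) auto
  then have yM: "y \<le> Max U" by (simp add: U_def)
  have "same_component (lollipop m n) U x (Max U)"
    using assms i unfolding graph_perm_def U_def by blast
  then have path: "(\<lambda>a b. a \<in> U \<and> b \<in> U \<and> lollipop m n a b)\<^sup>*\<^sup>* x (Max U)"
    by (simp add: same_component_def)
  show "(x, z) \<in> inversions w"
  proof (rule ccontr)
    assume "(x, z) \<notin> inversions w"
    then have "i \<le> inv w z" using xzy(1) by (simp add: inversions_def i_def)
    moreover have "i \<noteq> inv w z" using w_inv[of z] i(2) xzy(1) by (metis less_irrefl)
    ultimately have "i < inv w z" by simp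
    have "z \<notin> U"
    proof
      assume "z \<in> U"
      then obtain p where p: "p \<le> i" "z = w p" by (auto simp: U_def)
      then have "inv w z = p" using permutes_inverses(2)[OF w, of p] by simp
      with \<open>i < inv w z\<close> p show False by simp
    qed
    \<comment> \<open>No edge jumps over a vertex \<open>z \<ge> m\<close>, and \<open>z\<close>
      itself is missing, so the path from \<open>x\<close> stays below \<open>z\<close>.\<close>
    from path have "Max U < z"
    proof (induction rule: rtranclp_induct)
      case base
      show ?case by (fact xzy(1))
    next
      case (step a b)
      have "b \<noteq> z" using step.hyps(2) \<open>z \<notin> U\<close> by blast
      then show ?case using step.hyps(2) step.IH xzy(3) by (auto simp: lollipop_def)
    qed
    with yM xzy(2) show False by simp
  qed
qed

lemma avoids_imp_graph_perm:
  assumes "1 \<le> m" "w permutes {1..m + n}" "avoids m w"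
  shows "graph_perm (m + n) (lollipop m n) w"
  unfolding graph_perm_def
proof (intro conjI ballI)
  fix i assume i: "i \<in> {1..m + n}"
  note w = assms(2)
  define x U Y where "x = w i" and "U = w ` {1..i}" and "Y = Max U"
  have UN: "U \<subseteq> {1..m + n}"
  proof -
    have "w ` {1..i} \<subseteq> w ` {1..m + n}" using i by (intro image_mono) auto
    then show ?thesis by (simp only: U_def permutes_image[OF w])
  qed
  have xU: "x \<in> U" using i by (simp add: x_def U_def)
  have YU: "Y \<in> U" using i unfolding Y_def by (intro Max_in) (auto simp: U_def)
  have xY: "x \<le> Y" using xU unfolding Y_def by (intro Max_ge) (auto simp: U_def)
  have inv_w: "inv w (w a) = a" for a by (rule permutes_inverses(2)[OF w])
  have before: "a \<in> U" if "(x, a) \<in> inversions w" for a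
  proof -
    have "inv w a < i" using that by (simp add: inversions_def x_def inv_w)
    moreover have "a \<in> {1..m + n}" using inversions_subset[OF w] that by auto
    then have "inv w a \<in> {1..m + n}" using permutes_in_image[OF permutes_inv[OF w]] by simp
    ultimately have "inv w a \<in> {1..i}" by simp
    then have "w (inv w a) \<in> U" unfolding U_def by (rule imageI)
    then show ?thesis by (simp only: permutes_inverses(1)[OF w])
  qed
  let ?E = "\<lambda>a b. a \<in> U \<and> b \<in> U \<and> lollipop m n a b"
  have "?E\<^sup>*\<^sup>* x Y"
  proof (cases "x = Y")
    case False
    obtain p where p: "p \<in> {1..i}" "Y = w p" using YU by (auto simp: U_def)
    then have "p \<noteq> i" using False by (auto simp: x_def)
    then have xYI: "(x, Y) \<in> inversions w"
      using p xY False by (auto simp: inversions_def x_def inv_w)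
    show ?thesis
    proof (cases "Y \<le> m")
      case True
      then have "?E x Y" using xU YU UN xY False by (auto simp: lollipop_def)
      then show ?thesis by blast
    next
      case Ym: False
      \<comment> \<open>The path enters the tail at \<open>b\<close>, by at most one edge of the
        complete part, and then climbs to \<open>Y\<close>; avoidance ensures that all tail vertices
        on the way have already appeared.\<close>
      define b where "b = max x m"
      have inU: "z \<in> U" if "b \<le> z" "z \<le> Y" for z
      proof (cases "z = x \<or> z = Y")
        case False
        with that have "x < z" "z < Y" "m \<le> z" by (auto simp: b_def)
        then have "(x, z) \<in> inversions w"
          using assms(3) xYI unfolding avoids_def by blast
        then show ?thesis by (rule before)
      qed (use xU YU in auto)
      have up: "?E\<^sup>*\<^sup>* b z" if "b \<le> z" "z \<le> Y" for z
        using that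
      proof (induction z rule: dec_induct)
        case (step z)
        then have "?E z (Suc z)"
          using inU[of z] inU[of "Suc z"] UN by (auto simp: lollipop_def b_def)
        with step show ?case by (simp add: rtranclp.rtrancl_into_rtrancl)
      qed simp
      have bY: "b \<le> Y" using xY Ym by (simp add: b_def)
      have "?E\<^sup>*\<^sup>* x b"
      proof (cases "m \<le> x")
        case True
        then show ?thesis by (simp add: b_def)
      next
        case False
        then have "?E x b"
          using xU inU[of b] bY UN by (auto simp: lollipop_def b_def)
        then show ?thesis by blast
      qed
      also have "?E\<^sup>*\<^sup>* b Y" using up[of Y] bY by simp
      finally show ?thesis .
    qed
  qed simp
  then show "same_component (lollipop m n) (w ` {1..i}) (w i) (Max (w ` {1..i}))"
    using xU YU by (simp add: same_component_def x_def U_def Y_def)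
qed (fact assms(2))

text \<open>The second invariant of the backward induction. It holds for the longest permutation,
  bounds \<open>lcode\<close> from below, and together with \<open>avoids\<close> fixes the
  positions of certain values, see \<open>position_eq_rcode\<close>.\<close>

definition full :: "nat \<Rightarrow> (nat \<Rightarrow> nat) \<Rightarrow> bool" where
  "full m w \<longleftrightarrow> (\<forall>x z y. 1 \<le> x \<and> x < z \<and> m \<le> z \<and> (z, y) \<in> inversions w \<longrightarrow> (x, y) \<in> inversions w)"

text \<open>Two Lehmer codes indexed by values: here the smaller values standing after
  \<open>y\<close>, and in \<open>rcode\<close> the larger values standing before \<open>x\<close>.
  The second gives the row lengths, the first gives the bound that pins them down.\<close>

definition lcode :: "(nat \<Rightarrow> nat) \<Rightarrow> nat \<Rightarrow> nat" where
  "lcode w y = card {x. (x, y) \<in> inversions w}"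

definition rcode :: "(nat \<Rightarrow> nat) \<Rightarrow> nat \<Rightarrow> nat" where
  "rcode w x = card {y. (x, y) \<in> inversions w}"

lemma finite_code:
  assumes "w permutes {1..N}"
  shows "finite {x. (x, y) \<in> inversions w \<and> P x}" "finite {y. (x, y) \<in> inversions w}"
proof -
  have "{x. (x, y) \<in> inversions w \<and> P x} \<subseteq> {1..N}" "{y. (x, y) \<in> inversions w} \<subseteq> {1..N}"
    using inversions_subset[OF assms] by auto
  then show "finite {x. (x, y) \<in> inversions w \<and> P x}" "finite {y. (x, y) \<in> inversions w}"
    using finite_subset by blast+
qed

lemma lcode_adj_le:
  assumes "w permutes {1..N}"
  shows "lcode (w \<circ> adj i) y \<le> lcode w y + (if w (Suc i) = y then 1 else 0)"
proof (cases rule: adj_cases[OF permutes_bij[OF assms], of i])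
  case 1
  have "{x. (x, y) \<in> inversions (w \<circ> adj i)} =
      (if w (Suc i) = y then insert (w i) {x. (x, y) \<in> inversions w} else {x. (x, y) \<in> inversions w})"
    unfolding inversions_ascent(1)[OF permutes_bij[OF assms] 1] by auto
  then show ?thesis
    using card_insert_le_m1 finite_code(1)[OF assms, of y "\<lambda>_. True"]
    by (simp add: lcode_def card_insert_if)
next
  case 2
  have "{x. (x, y) \<in> inversions (w \<circ> adj i)} \<subseteq> {x. (x, y) \<in> inversions w}"
    unfolding inversions_descent(1)[OF permutes_bij[OF assms] 2] by auto
  then have "lcode (w \<circ> adj i) y \<le> lcode w y"
    unfolding lcode_def using finite_code(1)[OF assms, of y "\<lambda>_. True"] by (intro card_mono) auto
  then show ?thesis by simp
qed

text \<open>Only the value in position \<open>i + 1\<close> can gain at a letter \<open>i\<close>. A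
  value at or left of all remaining positions of an increasing word is only carried to the
  right.\<close>

lemma lcode_increasing_above:
  assumes "w permutes {1..N}" "L \<in> lists {1..<N}" "sorted_wrt (<) L" "\<forall>i\<in>set L. inv w y \<le> i"
  shows "lcode (w \<circ> word_perm L) y \<le> lcode w y"
  using assms
proof (induction L arbitrary: w)
  case (Cons i L)
  have i: "i \<in> {1..<N}" and iy: "inv w y \<le> i" using Cons.prems by auto
  have w': "w \<circ> adj i permutes {1..N}"
    using Cons.prems(1) adj_permutes[OF i] by (rule permutes_compose[rotated])
  have pos: "inv (w \<circ> adj i) y = adj i (inv w y)"
    using permutes_bij[OF Cons.prems(1)] by (simp add: o_inv_distrib)
  have "inv (w \<circ> adj i) y \<le> Suc i"
    using iy adj_other[of "inv w y" i] unfolding pos by (cases "inv w y = i") auto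
  then have bound: "\<forall>j\<in>set L. inv (w \<circ> adj i) y \<le> j"
    using Cons.prems(3) by fastforce
  have L: "L \<in> lists {1..<N}" "sorted_wrt (<) L"
    using Cons.prems(2,3) by auto
  have "lcode ((w \<circ> adj i) \<circ> word_perm L) y \<le> lcode (w \<circ> adj i) y"
    by (rule Cons.IH[OF w' L bound])
  also have "w (Suc i) \<noteq> y"
    using iy permutes_inverses(2)[OF Cons.prems(1), of "Suc i"] by auto
  then have "lcode (w \<circ> adj i) y \<le> lcode w y"
    using lcode_adj_le[OF Cons.prems(1), of i y] by simp
  finally show ?case by (simp only: word_perm_Cons comp_assoc)
qed simp

text \<open>An increasing word moves a value to the left at most once.\<close>

lemma lcode_increasing:
  assumes "w permutes {1..N}" "L \<in> lists {1..<N}" "sorted_wrt (<) L"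
  shows "lcode (w \<circ> word_perm L) y \<le> Suc (lcode w y)"
  using assms
proof (induction L arbitrary: w)
  case (Cons i L)
  have i: "i \<in> {1..<N}" using Cons.prems by auto
  have w': "w \<circ> adj i permutes {1..N}"
    using Cons.prems(1) adj_permutes[OF i] by (rule permutes_compose[rotated])
  have le: "lcode (w \<circ> adj i) y \<le> lcode w y + (if w (Suc i) = y then 1 else 0)"
    by (rule lcode_adj_le[OF Cons.prems(1)])
  have "lcode ((w \<circ> adj i) \<circ> word_perm L) y \<le> Suc (lcode w y)"
  proof (cases "w (Suc i) = y")
    case True
    have "inv (w \<circ> adj i) y = adj i (inv w y)"
      using permutes_bij[OF Cons.prems(1)] by (simp add: o_inv_distrib)
    also have "inv w y = Suc i"
      using permutes_inverses(2)[OF Cons.prems(1), of "Suc i"] True by simp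
    finally have pos: "inv (w \<circ> adj i) y = i"
      by (simp only: adj_apply)
    have "\<forall>j\<in>set L. inv (w \<circ> adj i) y \<le> j"
      unfolding pos using Cons.prems(3) by auto
    then have "lcode ((w \<circ> adj i) \<circ> word_perm L) y \<le> lcode (w \<circ> adj i) y"
      using Cons.prems(2,3) by (intro lcode_increasing_above[OF w']) auto
    with le show ?thesis using True by simp
  next
    case False
    then show ?thesis using Cons.IH[OF w'] Cons.prems(2,3) le by fastforce
  qed
  then show ?case by (simp only: word_perm_Cons comp_assoc)
qed simp

lemma reading_append: "reading (As @ Bs) = reading Bs @ reading As"
  by (induction As) auto

lemma lcode_reading:
  assumes "\<sigma> \<in> lists {1..<N}" "\<forall>R\<in>set Rs. R \<subseteq> {1..<N}"
  shows "lcode (word_perm (\<sigma> @ reading Rs)) y \<le> lcode (word_perm \<sigma>) y + length Rs"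
  using assms(2)
proof (induction Rs)
  case (Cons R Rs)
  have lists: "sorted_list_of_set R \<in> lists {1..<N}" "reading Rs \<in> lists {1..<N}"
    using Cons.prems set_sorted_list_of_set_subset[of R] set_reading[of Rs N] by auto
  then have "word_perm (\<sigma> @ reading Rs) permutes {1..N}"
    using assms(1) by (intro word_perm_permutes) simp
  then have "lcode (word_perm (\<sigma> @ reading Rs) \<circ> word_perm (sorted_list_of_set R)) y
      \<le> Suc (lcode (word_perm (\<sigma> @ reading Rs)) y)"
    using lists(1) by (intro lcode_increasing) auto
  also have "word_perm (\<sigma> @ reading Rs) \<circ> word_perm (sorted_list_of_set R) = word_perm (\<sigma> @ reading (R # Rs))"
    by (simp add: word_perm_append comp_assoc)
  finally show ?case
    using Cons by fastforce
qed simp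

lemma sum_lcode:
  assumes "w permutes {1..N}"
  shows "(\<Sum>y=1..N. card {x. (x, y) \<in> inversions w \<and> P x}) = card {(x, y) \<in> inversions w. P x}"
proof -
  have "{(x, y) \<in> inversions w. P x} = prod.swap ` (SIGMA y:{1..N}. {x. (x, y) \<in> inversions w \<and> P x})"
    using inversions_subset[OF assms] by (force simp: image_iff)
  then have "card {(x, y) \<in> inversions w. P x} = card (SIGMA y:{1..N}. {x. (x, y) \<in> inversions w \<and> P x})"
    by (simp add: card_image)
  then show ?thesis
    using finite_code(1)[OF assms] by simp
qed

lemma sum_rcode:
  assumes "w permutes {1..N}"
  shows "(\<Sum>x\<in>{i<..N}. rcode w x) = card {(x, y) \<in> inversions w. i < x}"
proof -
  have "{(x, y) \<in> inversions w. i < x} = (SIGMA x:{i<..N}. {y. (x, y) \<in> inversions w})"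
    using inversions_subset[OF assms] by fastforce
  then show ?thesis
    using finite_code(2)[OF assms] by (simp add: rcode_def)
qed

text \<open>The top \<open>i\<close> rows come last in the reading word, are increasing, and so add
  at most \<open>i\<close> to each code. Whatever exceeds \<open>i\<close> must be present after the
  lower rows alone, which produce at most one inversion per cell.\<close>

lemma sum_lcode_le_size:
  assumes "tab N Rs"
  shows "(\<Sum>y=1..N. lcode (word_perm (reading Rs)) y - i) \<le> sum_list (map card (drop i Rs))"
proof -
  define As Bs where "As = take i Rs" and "Bs = drop i Rs"
  have reading: "reading Rs = reading Bs @ reading As"
    by (simp add: As_def Bs_def flip: reading_append)
  have sub: "\<forall>R\<in>set Rs. R \<subseteq> {1..<N}" using assms by (simp add: tab_def)
  have Bl: "reading Bs \<in> lists {1..<N}"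
    using tab_reading[OF assms] reading by simp
  have "lcode (word_perm (reading Rs)) y \<le> lcode (word_perm (reading Bs)) y + length As" for y
    unfolding reading using sub by (intro lcode_reading[OF Bl]) (auto simp: As_def dest: in_set_takeD)
  then have "lcode (word_perm (reading Rs)) y - i \<le> lcode (word_perm (reading Bs)) y" for y
    by (simp add: As_def le_diff_conv) (meson add_le_cancel_left le_trans min.cobounded2)
  then have "(\<Sum>y=1..N. lcode (word_perm (reading Rs)) y - i) \<le> (\<Sum>y=1..N. lcode (word_perm (reading Bs)) y)"
    by (intro sum_mono)
  also have "\<dots> = card (inversions (word_perm (reading Bs)))"
    using sum_lcode[OF word_perm_permutes[OF Bl], of "\<lambda>_. True"] by (simp add: lcode_def)
  also have "\<dots> \<le> length (reading Bs)"
    by (rule card_inversions_word_le[OF Bl])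
  finally show ?thesis by (simp add: length_reading Bs_def)
qed

text \<open>Fullness turns one inversion of \<open>y\<close> with a value above \<open>i\<close>
  into inversions with all of \<open>{1..i}\<close>.\<close>

lemma full_lcode_ge:
  assumes "w permutes {1..N}" "full m w" "m \<le> Suc i" "i < x0" "(x0, y) \<in> inversions w"
  shows "i + card {x. (x, y) \<in> inversions w \<and> i < x} \<le> lcode w y"
proof -
  have "{1..i} \<union> {x. (x, y) \<in> inversions w \<and> i < x} \<subseteq> {x. (x, y) \<in> inversions w}"
  proof -
    have "(x, y) \<in> inversions w" if "1 \<le> x" "x \<le> i" for x
      using assms(2-5) that unfolding full_def by (metis Suc_leI le_less_trans le_trans)
    then show ?thesis by auto
  qed
  then have "card ({1..i} \<union> {x. (x, y) \<in> inversions w \<and> i < x}) \<le> lcode w y"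
    unfolding lcode_def using finite_code(1)[OF assms(1), of y "\<lambda>_. True"] by (intro card_mono) auto
  moreover have "card ({1..i} \<union> {x. (x, y) \<in> inversions w \<and> i < x}) =
      i + card {x. (x, y) \<in> inversions w \<and> i < x}"
    using finite_code(1)[OF assms(1)] by (subst card_Un_disjoint) auto
  ultimately show ?thesis by simp
qed

lemma full_card_le_lcode:
  assumes "w permutes {1..N}" "full m w" "m \<le> Suc i"
  shows "card {x. (x, y) \<in> inversions w \<and> i < x} \<le> lcode w y - i"
proof (cases "{x. (x, y) \<in> inversions w \<and> i < x} = {}")
  case False
  then obtain x0 where "i < x0" "(x0, y) \<in> inversions w" by blast
  from full_lcode_ge[OF assms this] show ?thesis by simp
qed (simp only: card.empty)

text \<open>The inversions whose smaller value exceeds \<open>i\<close> are counted once by their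
  smaller and once by their larger value.\<close>

lemma sum_rcode_le_lcode:
  assumes "w permutes {1..N}" "full m w" "m \<le> Suc i"
  shows "(\<Sum>x\<in>{i<..N}. rcode w x) \<le> (\<Sum>y=1..N. lcode w y - i)"
  unfolding sum_rcode[OF assms(1)] sum_lcode[OF assms(1), symmetric]
  by (intro sum_mono full_card_le_lcode[OF assms])

text \<open>Rows are counted from 0, so row \<open>i\<close> belongs to the value
  \<open>Suc i\<close>; nothing is claimed about the rows of values below \<open>m\<close>.\<close>

definition matches :: "nat \<Rightarrow> nat \<Rightarrow> (nat \<Rightarrow> nat) \<Rightarrow> nat set list \<Rightarrow> bool" where
  "matches N m w Rs \<longleftrightarrow> (\<forall>i<N. m \<le> Suc i \<longrightarrow> card (Rs ! i) = rcode w (Suc i))"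

lemma matches_sum:
  assumes "matches N m w Rs" "length Rs = N" "m \<le> Suc i"
  shows "sum_list (map card (drop i Rs)) = (\<Sum>x\<in>{i<..N}. rcode w x)"
proof -
  have "sum_list (map card (drop i Rs)) = (\<Sum>j<N - i. card (Rs ! (i + j)))"
    using assms(2) by (simp add: sum_list_sum_nth atLeast0LessThan)
  also have "\<dots> = (\<Sum>j<N - i. rcode w (Suc (i + j)))"
    using assms by (intro sum.cong) (auto simp: matches_def)
  also have "\<dots> = (\<Sum>x\<in>{i<..N}. rcode w x)"
    by (rule sum.reindex_bij_witness[of _ "\<lambda>x. x - Suc i" "\<lambda>j. Suc (i + j)"]) auto
  finally show ?thesis .
qed

text \<open>Applied to partitions it is the thinness of a single shape; applied to compositions it
  characterizes \<open>comp_mn\<close> once the column heights are known.\<close>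

definition steep :: "nat \<Rightarrow> nat list \<Rightarrow> bool" where
  "steep m \<rho> \<longleftrightarrow> (\<forall>i<length \<rho>. 0 < \<rho> ! i \<and> m \<le> Suc i \<longrightarrow> (\<forall>i'<i. \<rho> ! i < \<rho> ! i'))"

text \<open>\<open>sum_lcode_le_size\<close> is applied at \<open>i - 1\<close>, one row above the
  rows compared. Each value of \<open>A\<close> gains a unit from lowering the threshold, so row
  \<open>i - 1\<close> has at least \<open>card A\<close> cells, one more than row
  \<open>i\<close>.\<close>

lemma matches_steep:
  assumes w: "w = word_perm (reading Rs)" and tab: "tab N Rs" and len: "length Rs = N"
    and "full m w" "avoids m w" "matches N m w Rs"
  shows "steep m (map card Rs)"
  unfolding steep_def
proof (intro allI impI)
  fix i i' assume i: "i < length (map card Rs)" "0 < map card Rs ! i \<and> m \<le> Suc i" "i' < i"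
  have perm: "w permutes {1..N}"
    unfolding w by (rule word_perm_permutes[OF tab_reading[OF tab]])
  have mi: "m \<le> Suc i" and iN: "i < N" using i len by auto
  have r: "card (Rs ! i) = rcode w (Suc i)"
    using assms(6) mi iN by (simp add: matches_def)
  \<comment> \<open>All these values are inverted with every value of \<open>{1..i}\<close>: the
    larger ones by fullness, and \<open>Suc i\<close> itself by avoidance.\<close>
  define A where "A = insert (Suc i) {y. (Suc i, y) \<in> inversions w}"
  have rpos: "0 < rcode w (Suc i)" using r i by simp
  then obtain y0 where y0: "(Suc i, y0) \<in> inversions w"
    unfolding rcode_def by (metis (mono_tags, lifting) card.empty empty_Collect_eq less_irrefl)
  have AN: "A \<subseteq> {1..N}"
    using inversions_subset[OF perm] iN by (auto simp: A_def)
  have "Suc i \<notin> {y. (Suc i, y) \<in> inversions w}" by (simp add: inversions_def)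
  then have cardA: "card A = Suc (card (Rs ! i))"
    using finite_code(2)[OF perm] by (simp add: A_def r rcode_def)
  have ge: "card {x. (x, y) \<in> inversions w \<and> i < x} + (if y \<in> A then 1 else 0) \<le> lcode w y - (i - 1)"
    if "y \<in> {1..N}" for y
  proof (cases "y \<in> A")
    case False
    then show ?thesis using full_card_le_lcode[OF perm assms(4) mi, of y] by simp
  next
    case True
    have "i + card {x. (x, y) \<in> inversions w \<and> i < x} \<le> lcode w y"
    proof (cases "y = Suc i")
      case True
      have "(x, Suc i) \<in> inversions w" if x: "x \<in> {1..i}" for x
      proof -
        have "(x, y0) \<in> inversions w"
          using assms(4) y0 x mi unfolding full_def by (meson atLeastAtMost_iff le_imp_less_Suc)
        moreover have "Suc i < y0" using y0 by (simp add: inversions_def)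
        ultimately show ?thesis
          using assms(5) x mi unfolding avoids_def by (meson atLeastAtMost_iff le_imp_less_Suc)
      qed
      then have "{1..i} \<subseteq> {x. (x, y) \<in> inversions w}" using True by auto
      then have "card {1..i} \<le> lcode w y"
        unfolding lcode_def using finite_code(1)[OF perm, of y "\<lambda>_. True"] by (intro card_mono) auto
      moreover have "{x. (x, y) \<in> inversions w \<and> i < x} = {}"
        using True by (auto simp: inversions_def)
      ultimately show ?thesis by (simp only: card.empty) simp
    next
      case False
      then show ?thesis
        using True full_lcode_ge[OF perm assms(4) mi, of "Suc i" y] by (simp add: A_def)
    qed
    then show ?thesis using i(3) True by simp
  qed
  have "(\<Sum>x\<in>{i<..N}. rcode w x) + card A =
      (\<Sum>y=1..N. card {x. (x, y) \<in> inversions w \<and> i < x} + (if y \<in> A then 1 else 0))"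
    using AN unfolding sum_rcode[OF perm] sum.distrib sum_lcode[OF perm]
    by (simp add: sum.inter_restrict[symmetric] Int_absorb1)
  also have "\<dots> \<le> (\<Sum>y=1..N. lcode w y - (i - 1))"
    using ge by (rule sum_mono)
  also have "\<dots> \<le> sum_list (map card (drop (i - 1) Rs))"
    unfolding w by (rule sum_lcode_le_size[OF tab])
  also have "drop (i - 1) Rs = Rs ! (i - 1) # drop i Rs"
    using i(1,3) Cons_nth_drop_Suc[of "i - 1" Rs] by simp
  then have "sum_list (map card (drop (i - 1) Rs)) = card (Rs ! (i - 1)) + (\<Sum>x\<in>{i<..N}. rcode w x)"
    using matches_sum[OF assms(6) len mi] by simp
  finally have "card (Rs ! i) < card (Rs ! (i - 1))"
    using cardA by simp
  also have "card (Rs ! (i - 1)) \<le> card (Rs ! i')"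
    using tab_card_antimono[OF tab, of i' "i - 1"] i by simp
  finally show "map card Rs ! i < map card Rs ! i'"
    using i by simp
qed

text \<open>A smaller value before \<open>z\<close> would stand after \<open>y\<close> by fullness
  and then after \<open>z\<close> by avoidance. So only larger values precede
  \<open>z\<close>.\<close>

lemma position_eq_rcode:
  assumes "w permutes {1..N}" "full m w" "avoids m w" "m \<le> z" "(z, y) \<in> inversions w"
  shows "inv w z = Suc (rcode w z)"
proof -
  have inv_w: "inv w (w a) = a" for a by (rule permutes_inverses(2)[OF assms(1)])
  have w_inv: "w (inv w a) = a" for a by (rule permutes_inverses(1)[OF assms(1)])
  have zy: "z < y" "z \<in> {1..N}"
    using inversions_subset[OF assms(1)] assms(5) by auto
  have pos: "inv w a \<in> {1..N} \<longleftrightarrow> a \<in> {1..N}" for a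
    by (rule permutes_in_image[OF permutes_inv[OF assms(1)]])
  have "{v. (z, v) \<in> inversions w} = w ` {1..<inv w z}"
  proof
    show "{v. (z, v) \<in> inversions w} \<subseteq> w ` {1..<inv w z}"
    proof
      fix v assume v: "v \<in> {v. (z, v) \<in> inversions w}"
      then have "v \<in> {1..N}" using inversions_subset[OF assms(1)] by auto
      with v show "v \<in> w ` {1..<inv w z}"
        using pos[of v] w_inv[of v] by (intro image_eqI[of _ _ "inv w v"]) (auto simp: inversions_def)
    qed
    show "w ` {1..<inv w z} \<subseteq> {v. (z, v) \<in> inversions w}"
    proof
      fix v assume "v \<in> w ` {1..<inv w z}"
      then obtain p where p: "1 \<le> p" "p < inv w z" "v = w p" by auto
      then have pv: "inv w v = p" by (simp add: inv_w)
      have "p \<in> {1..N}" using p pos[of z] zy(2) by auto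
      then have v1: "1 \<le> v" using pos[of v] pv by simp
      have "\<not> v < z"
      proof
        assume "v < z"
        then have "(v, y) \<in> inversions w"
          using assms(2,4,5) v1 unfolding full_def by blast
        then have "(v, z) \<in> inversions w"
          using assms(3,4) \<open>v < z\<close> zy(1) unfolding avoids_def by blast
        then show False using p pv by (simp add: inversions_def)
      qed
      moreover have "v \<noteq> z" using p pv by auto
      ultimately show "v \<in> {v. (z, v) \<in> inversions w}"
        using p pv by (simp add: inversions_def)
    qed
  qed
  then have "rcode w z = inv w z - 1"
    using permutes_inj[OF assms(1)] by (simp add: rcode_def card_image inj_on_subset)
  then show ?thesis using pos[of z] zy(2) by simp
qed

section \<open>Going back by one letter\<close>

lemma ins_sum_drop:
  assumes "ins x Rs i0 Rs'" "\<forall>R\<in>set Rs. finite R"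
  shows "sum_list (map card (drop i Rs')) = sum_list (map card (drop i Rs)) + (if i \<le> i0 then 1 else 0)"
proof -
  have i0: "i0 < length (map card Rs)" using ins_length[OF assms(1)] by simp
  have "map card (drop i Rs') = drop i ((map card Rs)[i0 := Suc (map card Rs ! i0)])"
    by (simp only: drop_map[symmetric] ins_shape[OF assms])
  also have "sum_list \<dots> = sum_list (drop i (map card Rs)) + (if i \<le> i0 then 1 else 0)"
  proof (cases "i \<le> i0")
    case True
    then show ?thesis
      using i0 by (simp add: drop_update_swap sum_list_update)
  next
    case False
    then show ?thesis by simp
  qed
  finally show ?thesis by (simp add: drop_map)
qed

lemma rcode_ascent:
  assumes "w permutes {1..N}" "w i < w (Suc i)"
  shows "rcode (w \<circ> adj i) a = rcode w a + (if a = w i then 1 else 0)"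
proof -
  note I = inversions_ascent[OF permutes_bij[OF assms(1)] assms(2)]
  have "{y. (a, y) \<in> inversions (w \<circ> adj i)} =
      (if a = w i then insert (w (Suc i)) {y. (a, y) \<in> inversions w} else {y. (a, y) \<in> inversions w})"
    unfolding I(1) by auto
  then show ?thesis
    using I(2) finite_code(2)[OF assms(1)] by (simp add: rcode_def)
qed

lemma lcode_ascent_other:
  assumes "w permutes {1..N}" "w i < w (Suc i)" "b \<noteq> w (Suc i)"
  shows "lcode (w \<circ> adj i) b = lcode w b"
  unfolding lcode_def inversions_ascent(1)[OF permutes_bij[OF assms(1)] assms(2)] using assms(3) by simp

lemma lcode_less:
  assumes "w permutes {1..N}"
  shows "lcode w y \<le> y - 1"
proof -
  have "{x. (x, y) \<in> inversions w} \<subseteq> {1..<y}"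
    using inversions_subset[OF assms] by auto
  then have "card {x. (x, y) \<in> inversions w} \<le> card {1..<y}"
    by (intro card_mono) auto
  then show ?thesis by (simp add: lcode_def)
qed

text \<open>Only the pair \<open>(v k, v (Suc k))\<close> is lost. If fullness still asked for it
  because of some \<open>z\<close>, avoidance would place \<open>z\<close> before position
  \<open>k\<close>, although \<open>z\<close> comes after position \<open>k + 1\<close>.\<close>

lemma full_ascent_reverse:
  assumes "v permutes {1..N}" "v k < v (Suc k)" "full m (v \<circ> adj k)" "avoids m (v \<circ> adj k)"
  shows "full m v"
  unfolding full_def
proof (intro allI impI, elim conjE)
  fix a z b assume *: "1 \<le> a" "a < z" "m \<le> z" "(z, b) \<in> inversions v"
  define x y where "x = v k" and "y = v (Suc k)"
  note I = inversions_ascent(1)[OF permutes_bij[OF assms(1)] assms(2), folded x_def y_def]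
  have inv_v: "inv v (v c) = c" for c by (rule permutes_inverses(2)[OF assms(1)])
  have "(z, b) \<in> inversions (v \<circ> adj k)"
    unfolding I using *(4) by simp
  then have "(a, b) \<in> inversions (v \<circ> adj k)"
    using assms(3) * unfolding full_def by blast
  then consider "(a, b) \<in> inversions v" | "a = x" "b = y"
    unfolding I by auto
  then show "(a, b) \<in> inversions v"
  proof cases
    case 2
    have zy: "z < y" "inv v y < inv v z"
      using *(4) 2 by (auto simp: inversions_def)
    have "(x, y) \<in> inversions (v \<circ> adj k)"
      unfolding I by simp
    then have "(x, z) \<in> inversions (v \<circ> adj k)"
      using assms(4) * 2 zy unfolding avoids_def by blast
    then have "(x, z) \<in> inversions v"
      unfolding I using zy by simp
    then have "inv v z < k"
      by (simp add: inversions_def x_def inv_v)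
    with zy show ?thesis
      by (simp add: y_def inv_v)
  qed
qed

text \<open>Undoing the letter \<open>k\<close> costs the inversion \<open>(x, y)\<close>, hence one
  unit of \<open>rcode\<close> at \<open>x\<close>, and one cell in row \<open>i0\<close>. For
  \<open>x \<ge> m\<close> this cell is shown to lie in the row of \<open>x\<close>. If avoidance is
  lost, two rows become equally long, contrary to steepness.\<close>

lemma backward_step:
  assumes "1 \<le> m" and v: "v = word_perm (reading Ps)" and tabs: "tab N Ps" "tab N Ps'"
    and len: "length Ps = N" and ins: "ins k Ps i0 Ps'" and k: "k \<in> {1..<N}"
    and asc: "v k < v (Suc k)"
    and w: "full m (v \<circ> adj k)" "avoids m (v \<circ> adj k)" "matches N m (v \<circ> adj k) Ps'"
  shows "full m v"
    and "avoids m v \<Longrightarrow> matches N m v Ps"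
    and "\<not> avoids m v \<Longrightarrow> \<not> steep m (map card Ps)"
proof -
  define w where "w = v \<circ> adj k"
  note w' = w[folded w_def]
  define x y where "x = v k" and "y = v (Suc k)"
  have permv: "v permutes {1..N}"
    unfolding v by (rule word_perm_permutes[OF tab_reading[OF tabs(1)]])
  have permw: "w permutes {1..N}"
    unfolding w_def using permv adj_permutes[OF k] by (rule permutes_compose[rotated])
  have fin: "\<forall>R\<in>set Ps. finite R" using tab_finite[OF tabs(1)] by blast
  have wr: "w = word_perm (reading Ps')"
    using ins_reading[OF ins fin] by (simp only: w_def v word_perm_snoc)
  have len': "length Ps' = N" "i0 < N"
    using ins_length[OF ins] len by auto
  have I: "inversions w = insert (x, y) (inversions v)"
    using inversions_ascent(1)[OF permutes_bij[OF permv] asc] by (simp add: w_def x_def y_def)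
  have xyI: "(x, y) \<in> inversions w" by (simp add: I)
  have xN: "1 \<le> x" "x < y" "y \<le> N"
    using inversions_subset[OF permw] xyI by auto
  have inv_v: "inv v (v a) = a" for a by (rule permutes_inverses(2)[OF permv])
  have wk: "w k = y" "w (Suc k) = x" by (simp_all add: w_def x_def y_def)
  have inv_w: "inv w x = Suc k" "inv w y = k"
    using permutes_inverses(2)[OF permw] wk by metis+
  have r: "rcode w a = rcode v a + (if a = x then 1 else 0)" for a
    using rcode_ascent[OF permv asc] by (simp add: w_def x_def)
  have sum_r: "(\<Sum>a\<in>{i<..N}. rcode w a) = (\<Sum>a\<in>{i<..N}. rcode v a) + (if i < x then 1 else 0)" for i
    using xN by (simp add: r sum.distrib)
  have size: "sum_list (map card (drop i Ps')) = sum_list (map card (drop i Ps)) + (if i \<le> i0 then 1 else 0)" for i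
    by (rule ins_sum_drop[OF ins fin])
  have cards: "card (Ps' ! j) = card (Ps ! j) + (if j = i0 then 1 else 0)" if "j < N" for j
    using ins_nth_card[OF ins fin, of j] that len by simp
  have ck: "card (Ps' ! i0) \<le> k"
    by (rule ins_col_le[OF ins tabs(1) k])
  show fullv: "full m v"
    using full_ascent_reverse[OF permv asc] w by blast
  show "matches N m v Ps" if "avoids m v"
  proof -
    \<comment> \<open>Otherwise the code sum over values above \<open>i\<close> stays the same while
      a cell at or below row \<open>i\<close> disappears, leaving fewer cells than the lower bound
      for \<open>v\<close> allows.\<close>
    have low: "i < x" if "m \<le> Suc i" "i \<le> i0" for i
    proof (rule ccontr)
      assume "\<not> i < x"
      then have "sum_list (map card (drop i Ps')) = (\<Sum>a\<in>{i<..N}. rcode v a)"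
        using matches_sum[OF w'(3) len'(1) that(1)] sum_r[of i] by simp
      also have "\<dots> \<le> (\<Sum>b=1..N. lcode v b - i)"
        by (rule sum_rcode_le_lcode[OF permv fullv that(1)])
      also have "\<dots> \<le> sum_list (map card (drop i Ps))"
        unfolding v by (rule sum_lcode_le_size[OF tabs(1)])
      finally show False using size[of i] that(2) by simp
    qed
    have row: "Suc i0 = x" if "m \<le> x"
    proof -
      have "i0 < x" using low[of x] that by fastforce
      have kx: "k = card (Ps' ! (x - 1))"
        using position_eq_rcode[OF permw w'(1,2) that xyI] inv_w w'(3) xN that
        by (simp add: matches_def)
      \<comment> \<open>Row \<open>x - 1\<close> has length \<open>k\<close>, and the new cell lies
        in a column at most \<open>k\<close>. A row higher up that has just grown would be longer
        than that.\<close>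
      have "\<not> Suc i0 < x"
      proof
        assume less: "Suc i0 < x"
        then have "card (Ps' ! (x - 1)) \<le> card (Ps' ! Suc i0)"
          using tab_card_antimono[OF tabs(2), of "Suc i0" "x - 1"] len' xN by simp
        also have "\<dots> = card (Ps ! Suc i0)"
          using cards[of "Suc i0"] less xN by simp
        also have "\<dots> \<le> card (Ps ! i0)"
          using tab_card_antimono[OF tabs(1), of i0 "Suc i0"] len less xN by simp
        also have "\<dots> < card (Ps' ! i0)"
          using cards[of i0] len' by simp
        finally show False using kx ck by simp
      qed
      with \<open>i0 < x\<close> show ?thesis by simp
    qed
    have "card (Ps ! i) = rcode v (Suc i)" if i: "i < N" "m \<le> Suc i" for i
    proof -
      have "i = i0 \<longleftrightarrow> Suc i = x"
      proof (cases "m \<le> x")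
        case True
        then show ?thesis using row by auto
      next
        case False
        \<comment> \<open>By \<open>low\<close>, a new cell in a row belonging to a value at least
          \<open>m\<close> would force \<open>m \<le> x\<close>.\<close>
        then have "i \<noteq> i0"
          using low[of "m - 1"] low[of i] i by fastforce
        then show ?thesis using i False by auto
      qed
      then show ?thesis
        using cards[OF i(1)] r[of "Suc i"] w'(3) i unfolding matches_def by (auto split: if_splits)
    qed
    then show ?thesis by (simp add: matches_def)
  qed
  show "\<not> steep m (map card Ps)" if bad: "\<not> avoids m v"
  proof
    assume steep: "steep m (map card Ps)"
    \<comment> \<open>The permutation \<open>w\<close> does not show this violation, so the pair
      \<open>(a, z)\<close> is the one just added.\<close>
    obtain a z b where *: "a < z" "z < b" "m \<le> z" "(a, b) \<in> inversions v" "(a, z) \<notin> inversions v"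
      using bad unfolding avoids_def by blast
    then have "(a, z) \<in> inversions w"
      using w'(2) unfolding avoids_def I by blast
    then have az: "a = x" "z = y" using *(5) by (auto simp: I)
    have my: "m \<le> y" using * az by simp
    have "inv v b < k"
      using *(4) az by (simp add: inversions_def x_def inv_v)
    moreover have "(x, b) \<in> inversions w" using * az by (simp add: I)
    moreover have "inv w b \<noteq> k"
      using permutes_inverses(1)[OF permw, of b] wk * az by metis
    ultimately have "inv w b < inv w y"
      using inv_w by (simp add: inversions_def)
    then have yb: "(y, b) \<in> inversions w"
      using * az by (simp add: inversions_def)
    define j where "j = y - 1"
    have j: "Suc j = y" "j < N" "m \<le> Suc j" using xN my by (auto simp: j_def)
    have cj: "card (Ps' ! j) = rcode w y"
      using w'(3) j by (simp add: matches_def)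
    have "0 < rcode w y"
      unfolding rcode_def using yb finite_code(2)[OF permw] by (auto simp: card_gt_0_iff)
    have kj: "k = Suc (card (Ps' ! j))"
      using position_eq_rcode[OF permw w'(1,2) my yb] inv_w cj by simp
    \<comment> \<open>Only the code of \<open>y\<close> differs between \<open>v\<close> and
      \<open>w\<close>. It is at most \<open>y - 1 = j\<close>, so truncated subtraction hides the
      change and \<open>v\<close> obeys the same lower bound as \<open>w\<close>, which leaves no
      cell to remove from row \<open>j\<close> on.\<close>
    have "i0 < j"
    proof (rule ccontr)
      assume "\<not> i0 < j"
      have "sum_list (map card (drop j Ps')) = (\<Sum>a\<in>{j<..N}. rcode w a)"
        by (rule matches_sum[OF w'(3) len'(1) j(3)])
      also have "\<dots> \<le> (\<Sum>b=1..N. lcode w b - j)"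
        by (rule sum_rcode_le_lcode[OF permw w'(1) j(3)])
      also have "\<dots> = (\<Sum>b=1..N. lcode v b - j)"
      proof (rule sum.cong)
        fix b
        show "lcode w b - j = lcode v b - j"
        proof (cases "b = y")
          case True
          then show ?thesis
            using lcode_less[OF permw, of y] lcode_less[OF permv, of y] j by (simp add: j_def)
        next
          case False
          then show ?thesis
            using lcode_ascent_other[OF permv asc, of b] by (simp add: w_def y_def)
        qed
      qed simp
      also have "\<dots> \<le> sum_list (map card (drop j Ps))"
        unfolding v by (rule sum_lcode_le_size[OF tabs(1)])
      finally show False using size[of j] \<open>\<not> i0 < j\<close> by simp
    qed
    \<comment> \<open>Row \<open>i0\<close> is longer than row \<open>j\<close> by steepness, but at
      most \<open>k\<close>, which is one more than row \<open>j\<close>. Without its last cell it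
      has the length of row \<open>j\<close>.\<close>
    have "map card Ps' ! j < map card Ps' ! i0"
      using matches_steep[OF wr tabs(2) len'(1) w', unfolded steep_def, rule_format, of j i0]
        \<open>i0 < j\<close> j len' cj \<open>0 < rcode w y\<close> by simp
    then have "card (Ps' ! i0) = Suc (card (Ps' ! j))"
      using ck kj j len' by simp
    then have "card (Ps ! i0) = card (Ps ! j)" "0 < card (Ps ! j)"
      using cards[of i0] cards[of j] \<open>i0 < j\<close> j len' cj \<open>0 < rcode w y\<close> by auto
    then show False
      using steep \<open>i0 < j\<close> j len len' unfolding steep_def by (metis length_map less_irrefl nth_map)
  qed
qed

section \<open>Steep shapes and column heights\<close>

lemma hts_Suc: "hts \<rho> k = hts \<rho> (Suc k) + card {j. j < length \<rho> \<and> \<rho> ! j = k}"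
proof -
  have "{j. j < length \<rho> \<and> k \<le> \<rho> ! j} =
      {j. j < length \<rho> \<and> Suc k \<le> \<rho> ! j} \<union> {j. j < length \<rho> \<and> \<rho> ! j = k}"
    by auto
  then show ?thesis
    unfolding hts_eq_card by (simp add: card_Un_disjoint disjoint_iff)
qed

text \<open>When at least \<open>m\<close> rows reach column \<open>k\<close>, the lowest of them is
  the \<open>m\<close>-th or a later row. It is shorter than all rows above it, so no other row can
  end in column \<open>k\<close>.\<close>

lemma steep_imp_hts_le:
  assumes "steep m \<rho>" "1 \<le> k" "m \<le> hts \<rho> k"
  shows "hts \<rho> k \<le> Suc (hts \<rho> (Suc k))"
proof (cases "hts \<rho> k = 0")
  case False
  define S where "S = {j. j < length \<rho> \<and> k \<le> \<rho> ! j}"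
  have fin: "finite S" and card: "card S = hts \<rho> k"
    by (simp_all add: S_def hts_eq_card)
  then have ne: "S \<noteq> {}" using False by auto
  define i where "i = Max S"
  have i: "i < length \<rho>" "k \<le> \<rho> ! i"
    using Max_in[OF fin ne] by (auto simp: S_def i_def)
  have le: "j \<le> i" if "j \<in> S" for j using Max_ge[OF fin that] by (simp add: i_def)
  then have "S \<subseteq> {..i}" by auto
  then have "card S \<le> card {..i}" by (intro card_mono) auto
  then have "m \<le> Suc i" using assms(3) card by simp
  then have less: "\<rho> ! i < \<rho> ! j" if "j < i" for j
    using assms(1,2) i that unfolding steep_def by auto
  have "{j. j < length \<rho> \<and> \<rho> ! j = k} \<subseteq> {i}"
  proof
    fix j assume j: "j \<in> {j. j < length \<rho> \<and> \<rho> ! j = k}"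
    then have "j \<le> i" using le by (simp add: S_def)
    with less[of j] j i show "j \<in> {i}" by (cases "j = i") auto
  qed
  then have "card {j. j < length \<rho> \<and> \<rho> ! j = k} \<le> card {i}" by (intro card_mono) auto
  then show ?thesis using hts_Suc[of \<rho> k] by simp
qed simp

lemma hts_le_imp_steep:
  assumes "\<And>i j. i \<le> j \<Longrightarrow> j < length \<rho> \<Longrightarrow> \<rho> ! j \<le> \<rho> ! i"
    and "\<And>k. 1 \<le> k \<Longrightarrow> m \<le> hts \<rho> k \<Longrightarrow> hts \<rho> k \<le> Suc (hts \<rho> (Suc k))"
  shows "steep m \<rho>"
  unfolding steep_def
proof (intro allI impI, elim conjE)
  fix i i' assume i: "i < length \<rho>" "i' < i" "0 < \<rho> ! i" "m \<le> Suc i"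
  define k where "k = \<rho> ! i"
  have "i < hts \<rho> k"
    using less_hts_iff[OF assms(1) i(1), of k] by (simp add: k_def)
  then have "hts \<rho> k \<le> Suc (hts \<rho> (Suc k))"
    using assms(2)[of k] i by (simp add: k_def)
  then have le1: "card {j. j < length \<rho> \<and> \<rho> ! j = k} \<le> 1"
    using hts_Suc[of \<rho> k] by simp
  show "\<rho> ! i < \<rho> ! i'"
  proof (rule ccontr)
    assume "\<not> \<rho> ! i < \<rho> ! i'"
    then have "\<rho> ! i' = k" using assms(1)[of i' i] i by (simp add: k_def)
    then have "{i, i'} \<subseteq> {j. j < length \<rho> \<and> \<rho> ! j = k}" using i by (auto simp: k_def)
    then have "card {i, i'} \<le> card {j. j < length \<rho> \<and> \<rho> ! j = k}" by (intro card_mono) auto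
    then show False using i(2) le1 by simp
  qed
qed

lemma EG_steep_iff:
  assumes "EG N \<sigma> c Rs"
  shows "steep m (map card Rs) \<longleftrightarrow>
    (\<forall>k\<ge>1. m \<le> count_list c k \<longrightarrow> count_list c k \<le> Suc (count_list c (Suc k)))"
proof -
  let ?\<rho> = "map card Rs"
  have mono: "?\<rho> ! j \<le> ?\<rho> ! i" if "i \<le> j" "j < length ?\<rho>" for i j
    using tab_card_antimono[OF EG_tab[OF assms], of i j] that by simp
  have "steep m ?\<rho> \<longleftrightarrow> (\<forall>k\<ge>1. m \<le> hts ?\<rho> k \<longrightarrow> hts ?\<rho> k \<le> Suc (hts ?\<rho> (Suc k)))"
    using steep_imp_hts_le[of m ?\<rho>] hts_le_imp_steep[of ?\<rho> m, OF mono] by blast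
  moreover have "hts ?\<rho> k = count_list c k \<and> hts ?\<rho> (Suc k) = count_list c (Suc k)" if "1 \<le> k" for k
    using EG_hts[OF assms that] EG_hts[OF assms, of "Suc k"] by simp
  ultimately show ?thesis by auto
qed

text \<open>Under the invariants the shape is steep, so the last prefix meets its part of
  \<open>thin\<close>. One letter earlier either the invariants persist and the induction continues,
  or avoidance and thinness fail at that same prefix.\<close>

lemma EG_avoids_iff_thin:
  assumes "EG N \<sigma> c Rs" "1 \<le> m" "card (inversions (word_perm \<sigma>)) = length \<sigma>"
    and "full m (word_perm \<sigma>)" "avoids m (word_perm \<sigma>)" "matches N m (word_perm \<sigma>) Rs"
  shows "(\<forall>t. avoids m (word_perm (take t \<sigma>))) \<longleftrightarrow> thin m c"
  using assms
proof (induction rule: EG.induct)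
  case EG_Nil
  then show ?case by (simp add: thin_def)
next
  case (EG_snoc \<sigma> c Rs x i Rs')
  define v where "v = word_perm \<sigma>"
  have snoc: "word_perm (\<sigma> @ [x]) = v \<circ> adj x"
    by (simp add: v_def word_perm_snoc)
  have EG': "EG N (\<sigma> @ [x]) (c @ [card (Rs' ! i)]) Rs'"
    using EG_snoc.hyps by (rule EG.EG_snoc)
  have lists: "\<sigma> @ [x] \<in> lists {1..<N}" by (rule EG_lists[OF EG'])
  note red = lists EG_snoc.prems(2)
  have asc: "v x < v (Suc x)"
    using take_word_ascent[OF red, of "length \<sigma>"] by (simp add: v_def)
  have inv: "card (inversions v) = length \<sigma>"
    using card_inversions_take[OF red, of "length \<sigma>"] by (simp add: v_def)
  have vr: "v = word_perm (reading Rs)"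
    using EG_reading[OF EG_snoc.hyps(1)] by (simp add: v_def)
  note w = EG_snoc.prems(3-5)[unfolded snoc]
  have len: "length Rs = N" using EG_length[OF EG_snoc.hyps(1)] by simp
  note steps = backward_step[OF EG_snoc.prems(1) vr EG_tab[OF EG_snoc.hyps(1)] EG_tab[OF EG'] len
      EG_snoc.hyps(3,2) asc w]
  have "steep m (map card Rs')"
    using matches_steep[OF _ EG_tab[OF EG'] _ EG_snoc.prems(3-5)] EG_reading[OF EG'] EG_length[OF EG']
    by metis
  then have thin: "thin m (c @ [card (Rs' ! i)]) \<longleftrightarrow> thin m c"
    unfolding thin_snoc using EG_steep_iff[OF EG'] by blast
  have all: "(\<forall>t. avoids m (word_perm (take t (\<sigma> @ [x])))) \<longleftrightarrow> (\<forall>t. avoids m (word_perm (take t \<sigma>)))"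
    using all_take_snoc[of "\<lambda>\<sigma>. avoids m (word_perm \<sigma>)"] EG_snoc.prems(4) by blast
  show ?case
  proof (cases "avoids m v")
    case True
    then show ?thesis
      unfolding thin all using EG_snoc.IH[OF EG_snoc.prems(1)] steps(1,2) inv by (simp add: v_def)
  next
    case False
    then have "\<not> (\<forall>t. avoids m (word_perm (take t \<sigma>)))"
      unfolding v_def by (metis take_all order.refl)
    moreover have "\<not> thin m c"
    proof
      assume "thin m c"
      then have "\<forall>k\<ge>1. m \<le> count_list c k \<longrightarrow> count_list c k \<le> Suc (count_list c (Suc k))"
        unfolding thin_def by (metis take_all order.refl)
      then show False
        using EG_steep_iff[OF EG_snoc.hyps(1), of m] steps(3)[OF False] by simp
    qed
    ultimately show ?thesis
      unfolding thin all by simp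
  qed
qed

lemma matches_stair: "matches N m (long_perm N) (stair N)"
proof -
  have "{y. (Suc i, y) \<in> inversions (long_perm N)} = {Suc i<..N}" for i
    by (auto simp: inversions_long_perm)
  then show ?thesis
    by (simp add: matches_def stair_def rcode_def)
qed

lemma EG_LMR_iff_thin:
  assumes "1 \<le> m" "EG (m + n) \<sigma> c (stair (m + n))" "reduced_word (m + n) (long_perm (m + n)) \<sigma>"
  shows "\<sigma> \<in> LMR m n \<longleftrightarrow> thin m c"
proof -
  let ?N = "m + n"
  have \<sigma>: "\<sigma> \<in> lists {1..<?N}" "word_perm \<sigma> = long_perm ?N"
      "card (inversions (word_perm \<sigma>)) = length \<sigma>"
    using assms(3) by (simp_all add: reduced_word_long_perm_iff card_inversions_long_perm)
  have "graph_perm ?N (lollipop m n) (word_perm (take t \<sigma>)) \<longleftrightarrow> avoids m (word_perm (take t \<sigma>))" for t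
  proof -
    have "take t \<sigma> \<in> lists {1..<?N}"
      using \<sigma>(1) by (auto dest: in_set_takeD)
    then show ?thesis
      using graph_perm_imp_avoids avoids_imp_graph_perm[OF assms(1) word_perm_permutes] by blast
  qed
  then have "\<sigma> \<in> LMR m n \<longleftrightarrow> (\<forall>t. avoids m (word_perm (take t \<sigma>)))"
    using assms(3) by (simp add: LMR_iff)
  also have "\<dots> \<longleftrightarrow> thin m c"
  proof (rule EG_avoids_iff_thin[OF assms(2,1) \<sigma>(3)])
    show "full m (word_perm \<sigma>)"
      unfolding \<sigma>(2) full_def inversions_long_perm by auto
    show "avoids m (word_perm \<sigma>)"
      unfolding \<sigma>(2) avoids_def inversions_long_perm by auto
    show "matches ?N m (word_perm \<sigma>) (stair ?N)"
      unfolding \<sigma>(2) by (rule matches_stair)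
  qed
  finally show ?thesis .
qed

text \<open>The common index set of the two expansions; the letter counts are the column heights of
  the staircase.\<close>

definition words :: "nat \<Rightarrow> nat \<Rightarrow> nat list set" where
  "words m N = {c. lattice_word c \<and> thin m c \<and> (\<forall>k\<ge>1. count_list c k = N - k)}"

section \<open>Column words of Young column tableaux\<close>

text \<open>A tableau is built by adding its entries in order. The triple rule of
  \<open>SYCT\<close> leaves only the lowest row of length \<open>k\<close> for an entry in column
  \<open>k + 1\<close>, hence \<open>k \<notin> set b\<close>, and so the column determines the
  cell.\<close>

inductive grow :: "nat list \<Rightarrow> nat list \<Rightarrow> (nat \<times> nat \<Rightarrow> enat) \<Rightarrow> bool" where
  grow_Nil: "grow [] [] (\<lambda>_. \<infinity>)"
| grow_new: "grow c \<alpha> \<tau> \<Longrightarrow>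
    grow (c @ [1]) (\<alpha> @ [1]) (\<tau>((Suc (length \<alpha>), 1) := enat (Suc (length c))))"
| grow_extend: "grow c (a @ k # b) \<tau> \<Longrightarrow> 1 \<le> k \<Longrightarrow> k \<notin> set b \<Longrightarrow>
    grow (c @ [Suc k]) (a @ Suc k # b) (\<tau>((Suc (length a), Suc k) := enat (Suc (length c))))"

section \<open>Adding and removing the largest entry of a tableau\<close>

lemma diagram_iff: "(i, k) \<in> diagram \<alpha> \<longleftrightarrow> 1 \<le> i \<and> i \<le> length \<alpha> \<and> 1 \<le> k \<and> k \<le> \<alpha> ! (i - 1)"
  by (simp add: diagram_def)

lemma diagram_new:
  "diagram (\<alpha> @ [1]) = insert (Suc (length \<alpha>), 1) (diagram \<alpha>)"
  "(Suc (length \<alpha>), k) \<notin> diagram \<alpha>"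
  by (auto simp: diagram_def nth_append less_Suc_eq_le[symmetric] split: if_splits)

lemma diagram_extend:
  "diagram (a @ Suc k # b) = insert (Suc (length a), Suc k) (diagram (a @ k # b))"
  "(Suc (length a), l) \<in> diagram (a @ k # b) \<longleftrightarrow> 1 \<le> l \<and> l \<le> k"
proof -
  have "(i, l) \<in> diagram (a @ Suc k # b) \<longleftrightarrow>
      (i, l) = (Suc (length a), Suc k) \<or> (i, l) \<in> diagram (a @ k # b)" for i l
    by (cases "i = Suc (length a)") (auto simp: diagram_iff nth_append nth_Cons')
  then show "diagram (a @ Suc k # b) = insert (Suc (length a), Suc k) (diagram (a @ k # b))"
    by auto
  show "(Suc (length a), l) \<in> diagram (a @ k # b) \<longleftrightarrow> 1 \<le> l \<and> l \<le> k"
    by (simp add: diagram_iff)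
qed

lemma SYCT_value:
  assumes "\<tau> \<in> SYCT \<alpha>"
  shows "p \<in> diagram \<alpha> \<Longrightarrow> \<tau> p \<in> enat ` {1..sum_list \<alpha>}"
    and "p \<notin> diagram \<alpha> \<Longrightarrow> \<tau> p = \<infinity>"
  using assms unfolding SYCT_def bij_betw_def by blast+

lemma SYCT_less: "\<tau> \<in> SYCT \<alpha> \<Longrightarrow> p \<in> diagram \<alpha> \<Longrightarrow> \<tau> p < enat (Suc (sum_list \<alpha>))"
  using SYCT_value(1)[of \<tau> \<alpha> p] by auto

text \<open>For a new largest entry the conditions become statements about the shape: the cell ends
  its row, no first-column cell lies directly below a new first-column cell, and every lower row
  that reaches the column before it reaches its column too, since the triple rule would otherwise
  meet \<open>\<infinity>\<close>.\<close>

lemma SYCT_insert: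
  assumes \<tau>: "\<tau> \<in> SYCT \<alpha>"
    and D: "diagram \<alpha>' = insert (j, l) (diagram \<alpha>)" "(j, l) \<notin> diagram \<alpha>" "sum_list \<alpha>' = Suc (sum_list \<alpha>)"
    and right: "(j, Suc l) \<notin> diagram \<alpha>"
    and below: "(Suc j, 1) \<in> diagram \<alpha> \<Longrightarrow> l \<noteq> 1"
    and last: "\<And>i k. j < i \<Longrightarrow> 1 \<le> k \<Longrightarrow> l = Suc k \<Longrightarrow> (i, k) \<in> diagram \<alpha> \<Longrightarrow> (i, l) \<in> diagram \<alpha>"
  shows "\<tau>((j, l) := enat (Suc (sum_list \<alpha>))) \<in> SYCT \<alpha>'"
proof -
  let ?d = "sum_list \<alpha>" and ?\<tau> = "\<tau>((j, l) := enat (Suc (sum_list \<alpha>)))"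
  have bij: "bij_betw \<tau> (diagram \<alpha>) (enat ` {1..?d})"
    and rows: "\<And>i k. (i, k) \<in> diagram \<alpha> \<Longrightarrow> (i, k + 1) \<in> diagram \<alpha> \<Longrightarrow> \<tau> (i, k) < \<tau> (i, k + 1)"
    and col: "\<And>i. (i, 1) \<in> diagram \<alpha> \<Longrightarrow> (i + 1, 1) \<in> diagram \<alpha> \<Longrightarrow> \<tau> (i, 1) < \<tau> (i + 1, 1)"
    and triple: "\<And>i j k. 1 \<le> j \<Longrightarrow> j < i \<Longrightarrow> 1 \<le> k \<Longrightarrow> (j, k + 1) \<in> diagram \<alpha> \<Longrightarrow>
      \<tau> (i, k) \<le> \<tau> (j, k + 1) \<Longrightarrow> \<tau> (i, k + 1) < \<tau> (j, k + 1)"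
    using \<tau> unfolding SYCT_def by blast+
  have less: "\<tau> p < enat (Suc ?d)" if "p \<in> diagram \<alpha>" for p
    using SYCT_less[OF \<tau> that] .
  have out: "\<tau> p = \<infinity>" if "p \<notin> diagram \<alpha>" for p
    using SYCT_value(2)[OF \<tau> that] .
  have "bij_betw ?\<tau> (diagram \<alpha>) (enat ` {1..?d})"
    using bij D(2) by (subst bij_betw_cong[where g = \<tau>]) auto
  then have "bij_betw ?\<tau> (diagram \<alpha> \<union> {(j, l)}) (enat ` {1..?d} \<union> {?\<tau> (j, l)})"
    using D(2) by (intro notIn_Un_bij_betw) auto
  moreover have "{1..sum_list \<alpha>'} = insert (Suc ?d) {1..?d}"
    by (auto simp: D(3))
  then have "enat ` {1..?d} \<union> {?\<tau> (j, l)} = enat ` {1..sum_list \<alpha>'}"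
    by simp
  ultimately have "bij_betw ?\<tau> (diagram \<alpha>') (enat ` {1..sum_list \<alpha>'})"
    by (simp add: D(1))
  moreover have "?\<tau> p = \<infinity>" if "p \<notin> diagram \<alpha>'" for p
    using that out[of p] by (auto simp: D(1))
  moreover have "?\<tau> (i, k) < ?\<tau> (i, k + 1)" if "(i, k) \<in> diagram \<alpha>'" "(i, k + 1) \<in> diagram \<alpha>'" for i k
    using that rows[of i k] less[of "(i, k)"] right D(2) by (auto simp: D(1))
  moreover have "?\<tau> (i, 1) < ?\<tau> (i + 1, 1)" if "(i, 1) \<in> diagram \<alpha>'" "(i + 1, 1) \<in> diagram \<alpha>'" for i
    using that col[of i] less[of "(i, 1)"] below D(2) by (auto simp: D(1))
  moreover have "?\<tau> (i, k + 1) < ?\<tau> (j', k + 1)"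
    if *: "1 \<le> j'" "j' < i" "1 \<le> k" "(j', k + 1) \<in> diagram \<alpha>'" "?\<tau> (i, k) \<le> ?\<tau> (j', k + 1)" for i j' k
  proof (cases "(j', k + 1) = (j, l)")
    case True
    then have "?\<tau> (i, k) = \<tau> (i, k)" "?\<tau> (i, k + 1) = \<tau> (i, k + 1)" using *(2) by auto
    moreover have "(i, k) \<in> diagram \<alpha>"
      using out[of "(i, k)"] *(5) True \<open>?\<tau> (i, k) = \<tau> (i, k)\<close> by (cases "(i, k) \<in> diagram \<alpha>") auto
    ultimately show ?thesis
      using last[of i k] True *(2,3) less[of "(i, k + 1)"] by auto
  next
    case False
    then have D': "(j', k + 1) \<in> diagram \<alpha>" and eq: "?\<tau> (j', k + 1) = \<tau> (j', k + 1)"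
      using *(4) by (auto simp: D(1))
    have "?\<tau> (i, k) < enat (Suc ?d)"
      using *(5) less[OF D'] unfolding eq by (rule le_less_trans)
    then have "(i, k) \<noteq> (j, l)" by auto
    then have "?\<tau> (i, k) = \<tau> (i, k)" by (rule fun_upd_other)
    then have "\<tau> (i, k + 1) < \<tau> (j', k + 1)"
      using triple[OF *(1-3) D'] *(5) eq by simp
    moreover from this have "(i, k + 1) \<noteq> (j, l)"
      using out[OF D(2)] by auto
    then have "?\<tau> (i, k + 1) = \<tau> (i, k + 1)" by (rule fun_upd_other)
    ultimately show ?thesis unfolding eq by (simp only:)
  qed
  ultimately show ?thesis
    unfolding SYCT_def by blast
qed

lemma SYCT_remove:
  assumes \<tau>: "\<tau> \<in> SYCT \<alpha>'"
    and D: "diagram \<alpha>' = insert p (diagram \<alpha>)" "p \<notin> diagram \<alpha>" "sum_list \<alpha>' = Suc (sum_list \<alpha>)"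
    and p: "\<tau> p = enat (Suc (sum_list \<alpha>))"
  shows "\<tau>(p := \<infinity>) \<in> SYCT \<alpha>"
proof -
  let ?d = "sum_list \<alpha>" and ?\<tau> = "\<tau>(p := \<infinity>)"
  have bij: "bij_betw \<tau> (diagram \<alpha>') (enat ` {1..Suc ?d})"
    and rows: "\<And>i k. (i, k) \<in> diagram \<alpha>' \<Longrightarrow> (i, k + 1) \<in> diagram \<alpha>' \<Longrightarrow> \<tau> (i, k) < \<tau> (i, k + 1)"
    and col: "\<And>i. (i, 1) \<in> diagram \<alpha>' \<Longrightarrow> (i + 1, 1) \<in> diagram \<alpha>' \<Longrightarrow> \<tau> (i, 1) < \<tau> (i + 1, 1)"
    and triple: "\<And>i j k. 1 \<le> j \<Longrightarrow> j < i \<Longrightarrow> 1 \<le> k \<Longrightarrow> (j, k + 1) \<in> diagram \<alpha>' \<Longrightarrow>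
      \<tau> (i, k) \<le> \<tau> (j, k + 1) \<Longrightarrow> \<tau> (i, k + 1) < \<tau> (j, k + 1)"
    using \<tau> unfolding SYCT_def D(3)[symmetric] by blast+
  have out: "\<tau> q = \<infinity>" if "q \<notin> diagram \<alpha>'" for q
    using SYCT_value(2)[OF \<tau> that] .
  have img: "\<tau> ` diagram \<alpha>' = enat ` {1..Suc ?d}" and inj: "inj_on \<tau> (diagram \<alpha>')"
    using bij by (auto simp: bij_betw_def)
  have "\<tau> ` diagram \<alpha> = \<tau> ` (diagram \<alpha>' - {p})"
    using D by simp
  also have "\<dots> = \<tau> ` diagram \<alpha>' - \<tau> ` {p}"
    by (rule inj_on_image_set_diff[OF inj]) (auto simp: D(1))
  also have "\<dots> = enat ` {1..Suc ?d} - enat ` {Suc ?d}"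
    by (simp add: img p)
  also have "\<dots> = enat ` ({1..Suc ?d} - {Suc ?d})"
    by (rule image_set_diff[symmetric]) (simp add: inj_def)
  also have "{1..Suc ?d} - {Suc ?d} = {1..?d}"
    by auto
  finally have "bij_betw \<tau> (diagram \<alpha>) (enat ` {1..?d})"
    using inj_on_subset[OF inj, of "diagram \<alpha>"] unfolding bij_betw_def D(1) by blast
  then have bij': "bij_betw ?\<tau> (diagram \<alpha>) (enat ` {1..?d})"
    using D(2) by (subst bij_betw_cong[where g = \<tau>]) auto
  have eq: "?\<tau> q = \<tau> q" if "q \<in> diagram \<alpha>" for q
    using that D(2) by auto
  have le: "?\<tau> q \<le> enat ?d" if "q \<in> diagram \<alpha>" for q
    using bij_betwE[OF bij', rule_format, OF that] by (elim imageE) simp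
  have sub: "q \<in> diagram \<alpha>'" if "q \<in> diagram \<alpha>" for q
    using that by (simp add: D(1))
  have "?\<tau> q = \<infinity>" if "q \<notin> diagram \<alpha>" for q
    using that out[of q] by (auto simp: D(1))
  moreover have "?\<tau> (i, k) < ?\<tau> (i, k + 1)" if "(i, k) \<in> diagram \<alpha>" "(i, k + 1) \<in> diagram \<alpha>" for i k
    using rows[OF that[THEN sub]] unfolding that[THEN eq] .
  moreover have "?\<tau> (i, 1) < ?\<tau> (i + 1, 1)" if "(i, 1) \<in> diagram \<alpha>" "(i + 1, 1) \<in> diagram \<alpha>" for i
    using col[OF that[THEN sub]] unfolding that[THEN eq] .
  moreover have "?\<tau> (i, k + 1) < ?\<tau> (j, k + 1)"
    if *: "1 \<le> j" "j < i" "1 \<le> k" "(j, k + 1) \<in> diagram \<alpha>" "?\<tau> (i, k) \<le> ?\<tau> (j, k + 1)" for i j k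
  proof -
    have "?\<tau> (i, k) \<le> enat ?d"
      using *(5) le[OF *(4)] by (rule order_trans)
    then have "(i, k) \<noteq> p" by auto
    then have "\<tau> (i, k) \<le> \<tau> (j, k + 1)"
      using *(5) unfolding eq[OF *(4)] by simp
    then have less: "\<tau> (i, k + 1) < \<tau> (j, k + 1)"
      using triple[OF *(1-3) sub[OF *(4)]] by blast
    also have "\<tau> (j, k + 1) \<le> enat ?d"
      using le[OF *(4)] unfolding eq[OF *(4)] .
    finally have "(i, k + 1) \<noteq> p"
      using p by auto
    then show ?thesis
      using less unfolding eq[OF *(4)] by simp
  qed
  ultimately show ?thesis
    using bij' unfolding SYCT_def by blast
qed

lemma grow_length: "grow c \<alpha> \<tau> \<Longrightarrow> sum_list \<alpha> = length c \<and> (\<forall>r\<in>set \<alpha>. 1 \<le> r)"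
  by (induction rule: grow.induct) auto

lemma grow_SYCT: "grow c \<alpha> \<tau> \<Longrightarrow> \<tau> \<in> SYCT \<alpha>"
proof (induction rule: grow.induct)
  case grow_Nil
  have "diagram [] = {}" by (auto simp: diagram_def)
  then show ?case by (simp add: SYCT_def bij_betw_def)
next
  case (grow_new c \<alpha> \<tau>)
  have "\<tau>((Suc (length \<alpha>), 1) := enat (Suc (sum_list \<alpha>))) \<in> SYCT (\<alpha> @ [1])"
    by (rule SYCT_insert[OF grow_new.IH diagram_new(1) diagram_new(2)])
      (auto simp: diagram_iff)
  moreover have "sum_list \<alpha> = length c" using grow_length[OF grow_new.hyps] by simp
  ultimately show ?case by (simp only:)
next
  case (grow_extend c a k b \<tau>)
  have "\<tau>((Suc (length a), Suc k) := enat (Suc (sum_list (a @ k # b)))) \<in> SYCT (a @ Suc k # b)"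
  proof (rule SYCT_insert[OF grow_extend.IH diagram_extend(1)])
    fix i k' assume i: "Suc (length a) < i" "1 \<le> k'" "Suc k = Suc k'" "(i, k') \<in> diagram (a @ k # b)"
    then have "(a @ k # b) ! (i - 1) \<in> set b"
      by (auto simp: diagram_iff nth_append nth_Cons')
    then have "(a @ k # b) ! (i - 1) \<noteq> k" using grow_extend.hyps(3) by metis
    then show "(i, Suc k) \<in> diagram (a @ k # b)"
      using i by (simp add: diagram_iff)
  qed (use grow_extend.hyps(2) in \<open>auto simp: diagram_extend(2)\<close>)
  moreover have "sum_list (a @ k # b) = length c" using grow_length[OF grow_extend.hyps(1)] by simp
  ultimately show ?case by (simp only:)
qed

text \<open>The largest entry ends its row. In the first column it must be in the last row; in
  column \<open>k + 1\<close> a lower row of length \<open>k\<close> would violate the triple rule,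
  as its next value is \<open>\<infinity>\<close>. Both are exactly the growth steps,
  undone.\<close>

lemma ex_grow_of_SYCT:
  assumes "\<forall>r\<in>set \<alpha>. 1 \<le> r" "\<tau> \<in> SYCT \<alpha>"
  shows "\<exists>c. grow c \<alpha> \<tau>"
  using assms
proof (induction "sum_list \<alpha>" arbitrary: \<alpha> \<tau>)
  case 0
  then have "\<alpha> = []" by (cases \<alpha>) auto
  moreover from this have "\<tau> = (\<lambda>_. \<infinity>)"
    using SYCT_value(2)[OF "0.prems"(2)] by (auto simp: diagram_def)
  ultimately show ?case using grow_Nil by blast
next
  case (Suc d)
  note \<tau> = \<open>\<tau> \<in> SYCT \<alpha>\<close>
  have "enat (Suc d) \<in> \<tau> ` diagram \<alpha>"
    using \<tau> Suc.hyps(2) by (auto simp: SYCT_def bij_betw_def)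
  then obtain j l where p: "(j, l) \<in> diagram \<alpha>" "\<tau> (j, l) = enat (Suc d)" by auto
  have max: "\<not> \<tau> (j, l) < \<tau> q" if "q \<in> diagram \<alpha>" for q
    using SYCT_less[OF \<tau> that] p(2) Suc.hyps(2) by (cases "\<tau> q") auto
  define a b where "a = take (j - 1) \<alpha>" and "b = drop j \<alpha>"
  have j: "1 \<le> j" "j \<le> length \<alpha>" "1 \<le> l" "l \<le> \<alpha> ! (j - 1)"
    using p(1) by (auto simp: diagram_iff)
  have la: "Suc (length a) = j" using j by (simp add: a_def)
  have "l = \<alpha> ! (j - 1)"
  proof (rule ccontr)
    assume "l \<noteq> \<alpha> ! (j - 1)"
    then have "(j, l + 1) \<in> diagram \<alpha>" using j by (simp add: diagram_iff)
    then show False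
      using max \<tau> p(1) unfolding SYCT_def by blast
  qed
  then have \<alpha>: "\<alpha> = a @ l # b"
    using id_take_nth_drop[of "j - 1" \<alpha>] j by (simp add: a_def b_def)
  show ?case
  proof (cases "l = 1")
    case True
    have "b = []"
    proof (rule ccontr)
      assume "b \<noteq> []"
      then obtain r b' where b: "b = r # b'" by (cases b) auto
      then have "(j + 1, 1) \<in> diagram \<alpha>"
        using Suc.prems(1) la \<alpha> by (auto simp: diagram_iff nth_append)
      moreover have "(j, 1) \<in> diagram \<alpha>" using p(1) True by simp
      ultimately show False
        using max \<tau> True unfolding SYCT_def by blast
    qed
    then have \<alpha>1: "\<alpha> = a @ [1]" using \<alpha> True by simp
    have d: "sum_list a = d" using Suc.hyps(2) \<alpha>1 by simp
    have "\<tau>((j, l) := \<infinity>) \<in> SYCT a"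
      using d p(2) diagram_new[of a] \<alpha>1 la True
      by (intro SYCT_remove[OF \<tau>]) auto
    then obtain c where c: "grow c a (\<tau>((j, l) := \<infinity>))"
      using Suc.hyps(1)[OF d[symmetric]] Suc.prems(1) \<alpha>1 by auto
    have "grow (c @ [1]) (a @ [1]) ((\<tau>((j, l) := \<infinity>))((Suc (length a), 1) := enat (Suc (length c))))"
      by (rule grow_new[OF c])
    also have "(\<tau>((j, l) := \<infinity>))((Suc (length a), 1) := enat (Suc (length c))) = \<tau>"
      using grow_length[OF c] d p(2) la True by auto
    finally show ?thesis using \<alpha>1 by blast
  next
    case False
    then obtain k where k: "l = Suc k" "1 \<le> k" using j by (cases l) auto
    have d: "sum_list (a @ k # b) = d" using Suc.hyps(2) \<alpha> k by simp
    have nin: "k \<notin> set b"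
    proof
      assume "k \<in> set b"
      then obtain t where t: "t < length b" "b ! t = k" by (auto simp: in_set_conv_nth)
      define i where "i = Suc j + t"
      have ai: "\<alpha> ! (i - 1) = k"
        using t la by (simp add: \<alpha> i_def nth_append flip: la)
      have len: "i \<le> length \<alpha>" using t la by (simp add: \<alpha> i_def)
      have ik: "(i, k) \<in> diagram \<alpha>" "(i, k + 1) \<notin> diagram \<alpha>"
        using ai len k by (auto simp: diagram_iff i_def)
      then have "\<tau> (i, k) \<le> \<tau> (j, k + 1)"
        using max[of "(i, k)"] k by simp
      then have "\<tau> (i, k + 1) < \<tau> (j, k + 1)"
        using \<tau> p(1) k j(1) unfolding SYCT_def by (auto simp: i_def)
      then show False using SYCT_value(2)[OF \<tau> ik(2)] by simp
    qed
    have "\<tau>((j, l) := \<infinity>) \<in> SYCT (a @ k # b)"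
      using d p(2) diagram_extend(1)[of a k b] diagram_extend(2)[of a "Suc k" k b] \<alpha> la k
      by (intro SYCT_remove[OF \<tau>]) auto
    then obtain c where c: "grow c (a @ k # b) (\<tau>((j, l) := \<infinity>))"
      using Suc.hyps(1)[OF d[symmetric]] Suc.prems(1) \<alpha> k by auto
    have "grow (c @ [Suc k]) (a @ Suc k # b)
        ((\<tau>((j, l) := \<infinity>))((Suc (length a), Suc k) := enat (Suc (length c))))"
      by (rule grow_extend[OF c k(2) nin])
    also have "(\<tau>((j, l) := \<infinity>))((Suc (length a), Suc k) := enat (Suc (length c))) = \<tau>"
      using grow_length[OF c] d p(2) la k by auto
    finally show ?thesis using \<alpha> k by blast
  qed
qed

lemma grow_hts: "grow c \<alpha> \<tau> \<Longrightarrow> 1 \<le> k \<Longrightarrow> hts \<alpha> k = count_list c k"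
  by (induction rule: grow.induct) (auto simp: hts_def)

lemma grow_lattice_word: "grow c \<alpha> \<tau> \<Longrightarrow> lattice_word c"
proof (induction rule: grow.induct)
  case (grow_new c \<alpha> \<tau>)
  have "grow (c @ [1]) (\<alpha> @ [1]) (\<tau>((Suc (length \<alpha>), 1) := enat (Suc (length c))))"
    by (rule grow.grow_new[OF grow_new.hyps])
  from grow_hts[OF this] grow_new.IH show ?case
    unfolding lattice_word_snoc by (metis hts_antimono le_SucI le_refl)
next
  case (grow_extend c a k b \<tau>)
  have "grow (c @ [Suc k]) (a @ Suc k # b) (\<tau>((Suc (length a), Suc k) := enat (Suc (length c))))"
    by (rule grow.grow_extend[OF grow_extend.hyps])
  from grow_hts[OF this] grow_extend.IH show ?case
    unfolding lattice_word_snoc by (metis hts_antimono le_SucI le_refl One_nat_def Suc_le_mono le0)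
qed (simp add: lattice_word_def)

text \<open>The lattice condition says that column \<open>k\<close> is strictly higher than column
  \<open>k + 1\<close> before the step, so some row of length exactly \<open>k\<close> is
  available.\<close>

lemma grow_ex: "lattice_word c \<Longrightarrow> \<exists>\<alpha> \<tau>. grow c \<alpha> \<tau>"
proof (induction c rule: rev_induct)
  case Nil
  show ?case using grow_Nil by blast
next
  case (snoc l c)
  have lat: "lattice_word c" "1 \<le> l"
    and le: "\<And>k. 1 \<le> k \<Longrightarrow> count_list (c @ [l]) (Suc k) \<le> count_list (c @ [l]) k"
    using snoc.prems unfolding lattice_word_snoc by blast+
  obtain \<alpha> \<tau> where g: "grow c \<alpha> \<tau>" using snoc.IH[OF lat(1)] by blast
  show ?case
  proof (cases "l = 1")
    case True
    then show ?thesis using grow_new[OF g] by blast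
  next
    case False
    then obtain k where k: "l = Suc k" "1 \<le> k"
      using lat(2) by (cases l) auto
    have "count_list c (Suc k) < count_list c k"
      using le[OF k(2)] unfolding k(1) by simp
    then have "hts \<alpha> (Suc k) < hts \<alpha> k"
      using grow_hts[OF g] k by simp
    then have "{j. j < length \<alpha> \<and> \<alpha> ! j = k} \<noteq> {}"
      using hts_Suc[of \<alpha> k] by fastforce
    then have "k \<in> set \<alpha>" by auto
    then obtain a b where ab: "\<alpha> = a @ k # b" "k \<notin> set b"
      using split_list_last[of k \<alpha>] by blast
    show ?thesis
      using grow_extend[OF g[unfolded ab(1)] k(2) ab(2)] unfolding k(1) by blast
  qed
qed

lemma split_last_unique:
  assumes "a @ k # b = a' @ k # b'" "k \<notin> set b" "k \<notin> set b'"
  shows "a = a' \<and> b = b'"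
proof -
  have tw: "takeWhile (\<lambda>x. x \<noteq> k) (rev (a @ k # b)) = rev b" if "k \<notin> set b" for a b
  proof -
    have "takeWhile (\<lambda>x. x \<noteq> k) (rev b @ k # rev a) = rev b @ takeWhile (\<lambda>x. x \<noteq> k) (k # rev a)"
      using that by (intro takeWhile_append2) auto
    then show ?thesis by simp
  qed
  have "rev b = rev b'"
    using tw[OF assms(2), of a] tw[OF assms(3), of a'] assms(1) by simp
  then show ?thesis using assms(1) by simp
qed

lemma grow_snocE:
  assumes "grow (c @ [l]) \<alpha>' \<tau>'"
  obtains \<alpha> \<tau> where "l = 1" "grow c \<alpha> \<tau>" "\<alpha>' = \<alpha> @ [1]"
      "\<tau>' = \<tau>((Suc (length \<alpha>), 1) := enat (Suc (length c)))"
    | a k b \<tau> where "l = Suc k" "grow c (a @ k # b) \<tau>" "1 \<le> k" "k \<notin> set b" "\<alpha>' = a @ Suc k # b"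
      "\<tau>' = \<tau>((Suc (length a), Suc k) := enat (Suc (length c)))"
  using assms by (cases rule: grow.cases) auto

lemma grow_functional: "grow c \<alpha> \<tau> \<Longrightarrow> grow c \<alpha>' \<tau>' \<Longrightarrow> \<alpha> = \<alpha>' \<and> \<tau> = \<tau>'"
proof (induction arbitrary: \<alpha>' \<tau>' rule: grow.induct)
  case grow_Nil
  then show ?case by (cases rule: grow.cases) auto
next
  case (grow_new c \<alpha> \<tau>)
  from grow_new.prems show ?case
  proof (cases rule: grow_snocE)
    case (1 \<alpha>0 \<tau>0)
    then show ?thesis using grow_new.IH[OF 1(2)] by simp
  qed (use grow_length[OF grow_new.hyps] in simp)
next
  case (grow_extend c a k b \<tau>)
  from grow_extend.prems show ?case
  proof (cases rule: grow_snocE)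
    case (2 a0 k0 b0 \<tau>0)
    then have "a @ k # b = a0 @ k # b0" "\<tau> = \<tau>0"
      using grow_extend.IH[OF 2(2)] by simp_all
    moreover from this have "a = a0 \<and> b = b0"
      using split_last_unique[of a k b a0 b0] grow_extend.hyps 2 by simp
    ultimately show ?thesis using 2 by simp
  qed (use grow_extend.hyps in simp)
qed

text \<open>Entries count from 1 and word positions from 0: the letter at index \<open>t\<close> is
  the column of the entry \<open>Suc t\<close>.\<close>

lemma grow_column: "grow c \<alpha> \<tau> \<Longrightarrow> \<tau> (r, l) = enat (Suc t) \<Longrightarrow> t < length c \<and> c ! t = l"
proof (induction arbitrary: r l t rule: grow.induct)
  case (grow_new c \<alpha> \<tau>)
  show ?case
  proof (cases "(r, l) = (Suc (length \<alpha>), 1)")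
    case False
    then have "\<tau> (r, l) = enat (Suc t)" using grow_new.prems by (simp only: fun_upd_apply if_False)
    from grow_new.IH[OF this] show ?thesis by (simp add: nth_append)
  qed (use grow_new.prems in auto)
next
  case (grow_extend c a k b \<tau>)
  show ?case
  proof (cases "(r, l) = (Suc (length a), Suc k)")
    case False
    then have "\<tau> (r, l) = enat (Suc t)" using grow_extend.prems by (simp only: fun_upd_apply if_False)
    from grow_extend.IH[OF this] show ?thesis by (simp add: nth_append)
  qed (use grow_extend.prems in auto)
qed simp

lemma grow_cells:
  assumes "grow c \<alpha> \<tau>"
  shows "t < length c \<Longrightarrow> \<exists>r. (r, c ! t) \<in> diagram \<alpha> \<and> \<tau> (r, c ! t) = enat (Suc t)"
    and "(r, l) \<in> diagram \<alpha> \<Longrightarrow> \<exists>t<length c. \<tau> (r, l) = enat (Suc t) \<and> c ! t = l"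
proof -
  have img: "\<tau> ` diagram \<alpha> = enat ` {1..length c}"
    using grow_SYCT[OF assms] grow_length[OF assms] by (simp add: SYCT_def bij_betw_def)
  show "\<exists>r. (r, c ! t) \<in> diagram \<alpha> \<and> \<tau> (r, c ! t) = enat (Suc t)" if "t < length c"
  proof -
    have "enat (Suc t) \<in> \<tau> ` diagram \<alpha>" unfolding img using that by simp
    then obtain r l where rl: "(r, l) \<in> diagram \<alpha>" "\<tau> (r, l) = enat (Suc t)" by (auto simp: image_iff)
    then have "c ! t = l" using grow_column[OF assms] by blast
    with rl show ?thesis by blast
  qed
  show "\<exists>t<length c. \<tau> (r, l) = enat (Suc t) \<and> c ! t = l" if "(r, l) \<in> diagram \<alpha>"
  proof -
    have "\<tau> (r, l) \<in> enat ` {1..length c}" using that unfolding img[symmetric] by (rule imageI)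
    then obtain i where "\<tau> (r, l) = enat i" "1 \<le> i" by auto
    then have "\<tau> (r, l) = enat (Suc (i - 1))" by simp
    with grow_column[OF assms this] show ?thesis by blast
  qed
qed

lemma grow_injective:
  assumes "grow c \<alpha> \<tau>" "grow c' \<alpha> \<tau>"
  shows "c = c'"
proof (rule nth_equalityI)
  show "length c = length c'"
    using grow_length[OF assms(1)] grow_length[OF assms(2)] by simp
  fix t assume "t < length c"
  then obtain r where r: "(r, c ! t) \<in> diagram \<alpha>" "\<tau> (r, c ! t) = enat (Suc t)"
    using grow_cells(1)[OF assms(1), of t] by blast
  from grow_column[OF assms(2) r(2)] show "c ! t = c' ! t" by simp
qed

lemma grow_descents:
  assumes "grow c \<alpha> \<tau>"
  shows "tableau_descents \<alpha> \<tau> = col_descents c"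
proof
  show "tableau_descents \<alpha> \<tau> \<subseteq> col_descents c"
  proof
    fix i assume "i \<in> tableau_descents \<alpha> \<tau>"
    then obtain r l r' l' where *: "(r, l) \<in> diagram \<alpha>" "(r', l') \<in> diagram \<alpha>"
        "\<tau> (r, l) = enat i" "\<tau> (r', l') = enat (i + 1)" "l' \<le> l"
      by (auto simp: tableau_descents_def)
    obtain t where "t < length c" "\<tau> (r, l) = enat (Suc t)" "c ! t = l"
      using grow_cells(2)[OF assms *(1)] by blast
    moreover obtain t' where "t' < length c" "\<tau> (r', l') = enat (Suc t')" "c ! t' = l'"
      using grow_cells(2)[OF assms *(2)] by blast
    ultimately have "i = Suc t" "t' = Suc t" "t' < length c" "c ! t' \<le> c ! t"
      using * by auto
    then show "i \<in> col_descents c"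
      by (simp add: col_descents_def)
  qed
  show "col_descents c \<subseteq> tableau_descents \<alpha> \<tau>"
  proof
    fix i assume i: "i \<in> col_descents c"
    have lt: "i - 1 < length c" "i < length c" using i by (auto simp: col_descents_def)
    obtain r where r: "(r, c ! (i - 1)) \<in> diagram \<alpha>" "\<tau> (r, c ! (i - 1)) = enat (Suc (i - 1))"
      using grow_cells(1)[OF assms lt(1)] by blast
    obtain r' where r': "(r', c ! i) \<in> diagram \<alpha>" "\<tau> (r', c ! i) = enat (Suc i)"
      using grow_cells(1)[OF assms lt(2)] by blast
    have "Suc (i - 1) = i" "c ! i \<le> c ! (i - 1)" using i by (auto simp: col_descents_def)
    with r r' show "i \<in> tableau_descents \<alpha> \<tau>"
      unfolding tableau_descents_def by (metis (mono_tags, lifting) Suc_eq_plus1 mem_Collect_eq)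
  qed
qed

text \<open>A row compared with the extended row \<open>j\<close> from below was at most as long as
  row \<open>j\<close> before the extension, and equality is excluded because row \<open>j\<close>
  is the lowest of its length.\<close>

lemma steep_update_reverse:
  assumes "steep m (\<rho>[j := Suc (\<rho> ! j)])" "j < length \<rho>"
    and "\<And>i. j < i \<Longrightarrow> i < length \<rho> \<Longrightarrow> \<rho> ! i \<noteq> \<rho> ! j"
  shows "steep m \<rho>"
  unfolding steep_def
proof (intro allI impI, elim conjE)
  fix i i' assume i: "i < length \<rho>" "0 < \<rho> ! i" "m \<le> Suc i" "i' < i"
  have "\<rho>[j := Suc (\<rho> ! j)] ! i < \<rho>[j := Suc (\<rho> ! j)] ! i'"
    using assms(1)[unfolded steep_def, rule_format, of i i'] i assms(2) by (simp add: nth_list_update)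
  then show "\<rho> ! i < \<rho> ! i'"
    using assms(2) assms(3)[of i] i by (auto simp: nth_list_update split: if_splits)
qed

lemma hts_le_imp_unique:
  assumes "hts \<rho> k \<le> Suc (hts \<rho> (Suc k))" "i < length \<rho>" "i' < length \<rho>" "\<rho> ! i = k" "\<rho> ! i' = k"
  shows "i = i'"
proof (rule ccontr)
  assume "i \<noteq> i'"
  have "{i, i'} \<subseteq> {j. j < length \<rho> \<and> \<rho> ! j = k}" using assms by simp
  then have "card {i, i'} \<le> card {j. j < length \<rho> \<and> \<rho> ! j = k}" by (intro card_mono) auto
  then show False using hts_Suc[of \<rho> k] assms(1) \<open>i \<noteq> i'\<close> by simp
qed

lemma le_hts:
  assumes "\<And>j. j \<le> i \<Longrightarrow> k \<le> \<rho> ! j" "i < length \<rho>"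
  shows "Suc i \<le> hts \<rho> k"
proof -
  have "{..i} \<subseteq> {j. j < length \<rho> \<and> k \<le> \<rho> ! j}" using assms by auto
  then have "card {..i} \<le> hts \<rho> k" unfolding hts_eq_card by (intro card_mono) auto
  then show ?thesis by simp
qed

text \<open>If row \<open>j\<close> is subject to steepness, all rows above it already reach its new
  length \<open>k\<close>. So column \<open>k\<close> has height at least
  \<open>j + 1 \<ge> m\<close>, and the height condition leaves just one row of length exactly
  \<open>k\<close>.\<close>

lemma steep_update:
  assumes "steep m \<rho>" "j < length \<rho>" "1 \<le> \<rho> ! j" and \<rho>': "\<rho>' = \<rho>[j := Suc (\<rho> ! j)]"
    and thin: "\<And>k. 1 \<le> k \<Longrightarrow> m \<le> hts \<rho>' k \<Longrightarrow> hts \<rho>' k \<le> Suc (hts \<rho>' (Suc k))"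
  shows "steep m \<rho>'"
  unfolding steep_def
proof (intro allI impI, elim conjE)
  fix i i' assume i: "i < length \<rho>'" "0 < \<rho>' ! i" "m \<le> Suc i" "i' < i"
  have len: "length \<rho>' = length \<rho>" by (simp add: \<rho>')
  show "\<rho>' ! i < \<rho>' ! i'"
  proof (cases "i = j")
    case False
    then have "\<rho> ! i < \<rho> ! i'"
      using assms(1)[unfolded steep_def, rule_format, of i i'] i len by (simp add: \<rho>')
    also have "\<rho> ! i' \<le> \<rho>' ! i'" using assms(2) by (simp add: \<rho>' nth_list_update)
    finally show ?thesis using False by (simp add: \<rho>')
  next
    case True
    define k where "k = Suc (\<rho> ! j)"
    have j: "\<rho>' ! j = k" using assms(2) by (simp add: \<rho>' k_def)
    have ge: "k \<le> \<rho>' ! i''" if "i'' < j" for i''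
      using assms(1)[unfolded steep_def, rule_format, of j i''] that i True assms(2,3)
      by (simp add: \<rho>' k_def)
    have "Suc j \<le> hts \<rho>' k"
      using ge j len assms(2) by (intro le_hts) (auto simp: le_less)
    then have "hts \<rho>' k \<le> Suc (hts \<rho>' (Suc k))"
      using thin[of k] i(3) True by (simp add: k_def)
    then have "\<rho>' ! i' \<noteq> k"
      using hts_le_imp_unique[of \<rho>' k i' j] i True j by auto
    then show ?thesis using ge[of i'] i True j by simp
  qed
qed

lemma steep_snoc:
  assumes "steep m \<rho>" "\<forall>r\<in>set \<rho>. 1 \<le> r" and \<rho>': "\<rho>' = \<rho> @ [1]"
    and thin: "\<And>k. 1 \<le> k \<Longrightarrow> m \<le> hts \<rho>' k \<Longrightarrow> hts \<rho>' k \<le> Suc (hts \<rho>' (Suc k))"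
  shows "steep m \<rho>'"
  unfolding steep_def
proof (intro allI impI, elim conjE)
  fix i i' assume i: "i < length \<rho>'" "0 < \<rho>' ! i" "m \<le> Suc i" "i' < i"
  show "\<rho>' ! i < \<rho>' ! i'"
  proof (cases "i < length \<rho>")
    case True
    then show ?thesis
      using assms(1)[unfolded steep_def, rule_format, of i i'] i by (simp add: \<rho>' nth_append)
  next
    case False
    then have il: "i = length \<rho>" using i by (simp add: \<rho>')
    then have one: "\<rho>' ! i = 1" by (simp add: \<rho>')
    have ge: "1 \<le> \<rho>' ! l" if "l \<le> i" for l
      using assms(2) that il by (cases "l = i") (auto simp: \<rho>' nth_append)
    have "Suc i \<le> hts \<rho>' 1"
      using ge i(1) by (rule le_hts)
    then have "hts \<rho>' 1 \<le> Suc (hts \<rho>' (Suc 1))"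
      using thin[of 1] i(3) by simp
    then have "\<rho>' ! i' \<noteq> 1"
      using hts_le_imp_unique[of \<rho>' 1 i' i] i one by auto
    then show ?thesis using ge[of i'] i one by simp
  qed
qed

lemma steep_append: "steep m (\<rho> @ \<rho>') \<Longrightarrow> steep m \<rho>"
  unfolding steep_def
proof (intro allI impI, elim conjE)
  fix i i' assume *: "\<forall>i<length (\<rho> @ \<rho>'). 0 < (\<rho> @ \<rho>') ! i \<and> m \<le> Suc i \<longrightarrow> (\<forall>i'<i. (\<rho> @ \<rho>') ! i < (\<rho> @ \<rho>') ! i')"
    "i < length \<rho>" "0 < \<rho> ! i" "m \<le> Suc i" "i' < i"
  from *(1)[rule_format, of i i'] *(2-) show "\<rho> ! i < \<rho> ! i'"
    by (simp add: nth_append)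
qed

text \<open>\<open>thin\<close> concerns all prefixes, \<open>steep\<close> only the final
  composition. Undoing a growth step keeps a composition steep, so the end result carries the
  condition for each prefix; conversely the height condition of each new prefix keeps the growing
  composition steep.\<close>

lemma grow_thin_iff: "grow c \<alpha> \<tau> \<Longrightarrow> thin m c \<longleftrightarrow> steep m \<alpha>"
proof (induction rule: grow.induct)
  case grow_Nil
  show ?case by (simp add: thin_def steep_def)
next
  case (grow_new c \<alpha> \<tau>)
  let ?c = "c @ [1]" and ?\<alpha> = "\<alpha> @ [1]"
  have g: "grow ?c ?\<alpha> (\<tau>((Suc (length \<alpha>), 1) := enat (Suc (length c))))"
    by (rule grow.grow_new[OF grow_new.hyps])
  have eq: "hts ?\<alpha> k = count_list ?c k" if "1 \<le> k" for k
    by (rule grow_hts[OF g that])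
  have thin: "thin m ?c \<longleftrightarrow> steep m \<alpha> \<and> (\<forall>k\<ge>1. m \<le> hts ?\<alpha> k \<longrightarrow> hts ?\<alpha> k \<le> Suc (hts ?\<alpha> (Suc k)))"
    unfolding thin_snoc grow_new.IH using eq by (simp del: count_list_append)
  have "\<forall>r\<in>set \<alpha>. 1 \<le> r" using grow_length[OF grow_new.hyps] by blast
  then show ?case
    unfolding thin using steep_snoc[of m \<alpha> ?\<alpha>] steep_append[of m \<alpha> "[1]"] steep_imp_hts_le[of m ?\<alpha>] by blast
next
  case (grow_extend c a k b \<tau>)
  let ?c = "c @ [Suc k]" and ?\<alpha> = "a @ k # b" and ?\<alpha>' = "a @ Suc k # b"
  have g: "grow ?c ?\<alpha>' (\<tau>((Suc (length a), Suc k) := enat (Suc (length c))))"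
    by (rule grow.grow_extend[OF grow_extend.hyps])
  have eq: "hts ?\<alpha>' l = count_list ?c l" if "1 \<le> l" for l
    by (rule grow_hts[OF g that])
  have thin: "thin m ?c \<longleftrightarrow> steep m ?\<alpha> \<and> (\<forall>l\<ge>1. m \<le> hts ?\<alpha>' l \<longrightarrow> hts ?\<alpha>' l \<le> Suc (hts ?\<alpha>' (Suc l)))"
    unfolding thin_snoc grow_extend.IH using eq by (simp del: count_list_append)
  have upd: "?\<alpha>' = ?\<alpha>[length a := Suc (?\<alpha> ! length a)]" by simp
  have "?\<alpha> ! i \<noteq> ?\<alpha> ! length a" if "length a < i" "i < length ?\<alpha>" for i
  proof -
    have "?\<alpha> ! i \<in> set b" using that by (auto simp: nth_append nth_Cons')
    then show ?thesis using grow_extend.hyps(3) by auto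
  qed
  then have rev: "steep m ?\<alpha>' \<Longrightarrow> steep m ?\<alpha>"
    using steep_update_reverse[of m ?\<alpha> "length a"] unfolding upd[symmetric] by simp
  have "steep m ?\<alpha> \<Longrightarrow> (\<And>l. 1 \<le> l \<Longrightarrow> m \<le> hts ?\<alpha>' l \<Longrightarrow> hts ?\<alpha>' l \<le> Suc (hts ?\<alpha>' (Suc l))) \<Longrightarrow> steep m ?\<alpha>'"
    using grow_extend.hyps(2) by (intro steep_update[OF _ _ _ upd]) auto
  then show ?case
    unfolding thin using rev steep_imp_hts_le[of m ?\<alpha>'] by blast
qed

section \<open>The compositions in \<open>comp_mn\<close>\<close>

lemma comp_mn_imp:
  assumes "1 \<le> m" "\<alpha> \<in> comp_mn m n"
  shows "(\<forall>r\<in>set \<alpha>. 1 \<le> r) \<and> (\<forall>k\<ge>1. hts \<alpha> k = m + n - k) \<and> steep m \<alpha>"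
proof -
  obtain as where \<alpha>: "\<alpha> = as @ rev [1..<n + 1]" and as: "as \<in> permutations_of_set {n + 1..n + m - 1}"
    using assms(2) by (auto simp: comp_mn_def)
  have sas: "set as = {n + 1..n + m - 1}" "distinct as"
    using as by (auto dest: permutations_of_setD)
  have las: "length as = m - 1"
    using distinct_card[OF sas(2)] sas(1) assms(1) by simp
  have d: "distinct \<alpha>"
    unfolding \<alpha> distinct_append using sas by (auto simp del: upt_Suc)
  have s: "set \<alpha> = {1..<m + n}"
    unfolding \<alpha> set_append sas(1) using assms(1) by (auto simp del: upt_Suc)
  have h: "hts \<alpha> k = m + n - k" if "1 \<le> k" for k
  proof -
    have "hts \<alpha> k = card (Collect ((\<le>) k) \<inter> set \<alpha>)"
      unfolding hts_def by (rule distinct_length_filter[OF d])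
    also have "Collect ((\<le>) k) \<inter> set \<alpha> = {k..<m + n}"
      unfolding s using that by auto
    finally show ?thesis by simp
  qed
  have nth: "\<alpha> ! i = m + n - Suc i" if "m \<le> Suc i" "i < length \<alpha>" for i
    using that assms(1) unfolding \<alpha> by (auto simp: nth_append las rev_nth simp del: upt_Suc)
  have "steep m \<alpha>"
    unfolding steep_def
  proof (intro allI impI, elim conjE)
    fix i i' assume i: "i < length \<alpha>" "m \<le> Suc i" "i' < i"
    have len: "length \<alpha> = m - 1 + n" by (simp add: \<alpha> las del: upt_Suc)
    show "\<alpha> ! i < \<alpha> ! i'"
    proof (cases "m \<le> Suc i'")
      case True
      then show ?thesis using nth[of i] nth[of i'] i len by simp
    next
      case False
      then have "\<alpha> ! i' = as ! i'" "i' < length as"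
        using las by (auto simp: \<alpha> nth_append)
      then have "n + 1 \<le> \<alpha> ! i'"
        using sas(1) nth_mem[of i' as] by auto
      then show ?thesis using nth[of i] i by simp
    qed
  qed
  moreover have "\<forall>r\<in>set \<alpha>. 1 \<le> r" by (simp add: s)
  ultimately show ?thesis using h by blast
qed

text \<open>Staircase heights force each of \<open>{1..<m + n}\<close> to occur exactly once as a
  part. Steepness makes the last \<open>n\<close> parts decreasing and smaller than all earlier
  ones; being downward closed, they are \<open>{1..n}\<close> in decreasing order.\<close>

lemma comp_mn_intro:
  assumes "1 \<le> m" "\<forall>r\<in>set \<alpha>. 1 \<le> r" "\<forall>k\<ge>1. hts \<alpha> k = m + n - k" "steep m \<alpha>"
  shows "\<alpha> \<in> comp_mn m n"
proof -
  have cardk: "card {j. j < length \<alpha> \<and> \<alpha> ! j = k} = (if k < m + n then 1 else 0)" if "1 \<le> k" for k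
    using hts_Suc[of \<alpha> k] assms(3) that by auto
  have s: "set \<alpha> = {1..<m + n}"
  proof (rule set_eqI)
    fix k
    show "k \<in> set \<alpha> \<longleftrightarrow> k \<in> {1..<m + n}"
    proof (cases "1 \<le> k")
      case True
      have "k \<in> set \<alpha> \<longleftrightarrow> {j. j < length \<alpha> \<and> \<alpha> ! j = k} \<noteq> {}"
        by (auto simp: in_set_conv_nth)
      also have "\<dots> \<longleftrightarrow> card {j. j < length \<alpha> \<and> \<alpha> ! j = k} \<noteq> 0"
        by simp
      finally show ?thesis using cardk[OF True] True by simp
    qed (use assms(2) in auto)
  qed
  have d: "distinct \<alpha>"
    unfolding distinct_conv_nth
  proof (intro allI impI)
    fix i j assume ij: "i < length \<alpha>" "j < length \<alpha>" "i \<noteq> j"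
    show "\<alpha> ! i \<noteq> \<alpha> ! j"
    proof
      assume eq: "\<alpha> ! i = \<alpha> ! j"
      have "1 \<le> \<alpha> ! i" using assms(2) ij by simp
      then have "hts \<alpha> (\<alpha> ! i) \<le> Suc (hts \<alpha> (Suc (\<alpha> ! i)))"
        using assms(3) by simp
      from hts_le_imp_unique[OF this ij(1,2) refl eq[symmetric]] ij(3) show False by blast
    qed
  qed
  have len: "length \<alpha> = m + n - 1"
    using distinct_card[OF d] s by simp
  define as bs where "as = take (m - 1) \<alpha>" and "bs = drop (m - 1) \<alpha>"
  have \<alpha>: "\<alpha> = as @ bs" by (simp add: as_def bs_def)
  have las: "length as = m - 1" "length bs = n"
    using len assms(1) by (auto simp: as_def bs_def)
  have steep: "\<alpha> ! i < \<alpha> ! i'" if "i < length \<alpha>" "m \<le> Suc i" "i' < i" for i i'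
  proof -
    have "1 \<le> \<alpha> ! i" using assms(2) nth_mem[OF that(1)] by blast
    then show ?thesis
      using assms(4)[unfolded steep_def, rule_format, of i i'] that by simp
  qed
  have asbs: "y < x" if xy: "x \<in> set as" "y \<in> set bs" for x y
  proof -
    obtain i where i: "i < length as" "x = as ! i" using xy(1) by (auto simp: in_set_conv_nth)
    obtain j where j: "j < length bs" "y = bs ! j" using xy(2) by (auto simp: in_set_conv_nth)
    have "\<alpha> ! (length as + j) < \<alpha> ! i"
      using i j las by (intro steep) (auto simp: \<alpha>)
    then show ?thesis using i j by (simp add: \<alpha> nth_append)
  qed
  have sub: "set bs \<subseteq> {1..n}"
  proof
    fix y assume y: "y \<in> set bs"
    have "{1..y} \<subseteq> set bs"
    proof
      fix x assume x: "x \<in> {1..y}"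
      have "y \<in> set \<alpha>" using y by (simp add: \<alpha>)
      then have "x \<in> set \<alpha>" using x unfolding s by auto
      then show "x \<in> set bs" using asbs[of x y] x y by (auto simp: \<alpha>)
    qed
    then have "card {1..y} \<le> card (set bs)" by (intro card_mono) auto
    also have "\<dots> = n" using d distinct_card[of bs] las by (simp add: \<alpha>)
    finally have "y \<le> n" by simp
    moreover have "y \<in> set \<alpha>" using y by (simp add: \<alpha>)
    ultimately show "y \<in> {1..n}" unfolding s by simp
  qed
  have sbs: "set bs = {1..n}"
    using d distinct_card[of bs] las by (intro card_subset_eq sub) (auto simp: \<alpha>)
  have "bs ! j < bs ! i" if "i < j" "j < length bs" for i j
  proof -
    have "\<alpha> ! (length as + j) < \<alpha> ! (length as + i)"
      using that las by (intro steep) (auto simp: \<alpha>)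
    then show ?thesis by (simp add: \<alpha> nth_append)
  qed
  then have "sorted_wrt (>) bs" by (simp add: sorted_wrt_iff_nth_less)
  then have "sorted_wrt (<) (rev bs)" by (simp add: sorted_wrt_rev)
  then have "sorted (rev bs)" "distinct (rev bs)"
    using strict_sorted_iff by blast+
  moreover have "set (rev bs) = set [1..<n + 1]"
    unfolding set_rev sbs set_upt by auto
  ultimately have "rev bs = [1..<n + 1]"
    by (rule sorted_distinct_set_unique[OF _ _ sorted_upt distinct_upt])
  then have "bs = rev [1..<n + 1]" by (simp only: rev_swap rev_rev_ident)
  moreover have "as \<in> permutations_of_set {n + 1..n + m - 1}"
  proof (rule permutations_of_setI)
    show "distinct as" using d by (simp add: \<alpha>)
    have "set as \<inter> set bs = {}" using d by (simp add: \<alpha>)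
    moreover have "set as \<union> set bs = set \<alpha>" by (simp add: \<alpha>)
    ultimately have "set as = set \<alpha> - set bs" by blast
    also have "\<dots> = {n + 1..n + m - 1}" unfolding s sbs using assms(1) by auto
    finally show "set as = {n + 1..n + m - 1}" .
  qed
  ultimately show "\<alpha> \<in> comp_mn m n"
    unfolding comp_mn_def using \<alpha> by blast
qed

section \<open>Quasisymmetric functions\<close>

text \<open>Reindexing along a one-to-one relation. Insertion and growth are inductive predicates,
  and the choice of a function is made here once for both.\<close>

lemma sum_eq_by_relation:
  assumes "\<And>a. a \<in> A \<Longrightarrow> \<exists>b\<in>B. R a b" "\<And>b. b \<in> B \<Longrightarrow> \<exists>a\<in>A. R a b"
    and "\<And>a b b'. R a b \<Longrightarrow> R a b' \<Longrightarrow> b = b'" "\<And>a a' b. R a b \<Longrightarrow> R a' b \<Longrightarrow> a = a'"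
    and "\<And>a b. a \<in> A \<Longrightarrow> b \<in> B \<Longrightarrow> R a b \<Longrightarrow> f a = g b"
  shows "sum f A = sum g B"
proof -
  define h where "h a = (SOME b. b \<in> B \<and> R a b)" for a
  have h: "h a \<in> B \<and> R a (h a)" if "a \<in> A" for a
    unfolding h_def by (rule someI_ex) (use assms(1)[OF that] in blast)
  have "bij_betw h A B"
    unfolding bij_betw_def
  proof
    show "inj_on h A"
    proof (rule inj_onI)
      fix a a' assume a: "a \<in> A" "a' \<in> A" and eq: "h a = h a'"
      have "R a (h a)" "R a' (h a)" using h[OF a(1)] h[OF a(2)] by (simp_all add: eq)
      then show "a = a'" by (rule assms(4))
    qed
    show "h ` A = B"
    proof
      show "B \<subseteq> h ` A"
      proof
        fix b assume "b \<in> B"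
        then obtain a where "a \<in> A" "R a b" using assms(2) by blast
        then have "h a = b" using h assms(3) by blast
        with \<open>a \<in> A\<close> show "b \<in> h ` A" by blast
      qed
    qed (use h in blast)
  qed
  then have "sum (g \<circ> h) A = sum g B"
    by (simp add: sum.reindex_bij_betw comp_def)
  moreover have "sum f A = sum (g \<circ> h) A"
    using h assms(5) by (intro sum.cong) auto
  ultimately show ?thesis by simp
qed

lemma LMF_eq_words:
  assumes "1 \<le> m"
  shows "LMF m n = (\<Sum>c\<in>words m (m + n). fundamental_qsym (col_descents c) (length c))"
  unfolding LMF_def
proof (rule sum_eq_by_relation[where R = "\<lambda>\<sigma> c. EG (m + n) \<sigma> c (stair (m + n))"])
  fix \<sigma> assume \<sigma>: "\<sigma> \<in> LMR m n"
  then have red: "reduced_word (m + n) (long_perm (m + n)) \<sigma>" by (simp add: LMR_def)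
  then obtain c where c: "EG (m + n) \<sigma> c (stair (m + n))" using EG_long_perm by blast
  then have "c \<in> words m (m + n)"
    using EG_LMR_iff_thin[OF assms c red] \<sigma> EG_lattice_word[OF c] EG_stair_count[OF c]
    by (simp add: words_def)
  with c show "\<exists>c\<in>words m (m + n). EG (m + n) \<sigma> c (stair (m + n))" by blast
next
  fix c assume c: "c \<in> words m (m + n)"
  then obtain \<sigma> where \<sigma>: "EG (m + n) \<sigma> c (stair (m + n))" "reduced_word (m + n) (long_perm (m + n)) \<sigma>"
    using EG_stair_long_perm[of c "m + n"] by (auto simp: words_def)
  then have "\<sigma> \<in> LMR m n"
    using EG_LMR_iff_thin[OF assms \<sigma>] c by (simp add: words_def)
  with \<sigma> show "\<exists>\<sigma>\<in>LMR m n. EG (m + n) \<sigma> c (stair (m + n))" by blast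
next
  fix \<sigma> c assume "\<sigma> \<in> LMR m n" and EG: "EG (m + n) \<sigma> c (stair (m + n))"
  then have "reduced (m + n) \<sigma>"
    by (simp add: LMR_def reduced_def reduced_word_def)
  then show "fundamental_qsym (word_descents \<sigma>) (length \<sigma>) = fundamental_qsym (col_descents c) (length c)"
    using EG_descents[OF EG] EG_length[OF EG] by simp
next
  show "c = c'" if "EG (m + n) \<sigma> c (stair (m + n))" "EG (m + n) \<sigma> c' (stair (m + n))" for \<sigma> c c'
    using EG_functional[OF that] by simp
  show "\<sigma> = \<sigma>'" if "EG (m + n) \<sigma> c (stair (m + n))" "EG (m + n) \<sigma>' c (stair (m + n))" for \<sigma> \<sigma>' c
    using that by (rule EG_injective)
qed

section \<open>Young quasisymmetric Schur functions as sums over tableaux\<close>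

lemma finite_diagram: "finite (diagram \<alpha>)"
proof -
  have "diagram \<alpha> = (SIGMA i:{1..length \<alpha>}. {1..\<alpha> ! (i - 1)})"
    by (auto simp: diagram_def)
  then show ?thesis by simp
qed

lemma finite_SYCT: "finite (SYCT \<alpha>)"
proof (rule finite_subset)
  show "SYCT \<alpha> \<subseteq> {\<tau>. \<forall>p. (p \<in> diagram \<alpha> \<longrightarrow> \<tau> p \<in> enat ` {1..sum_list \<alpha>}) \<and> (p \<notin> diagram \<alpha> \<longrightarrow> \<tau> p = \<infinity>)}"
    using SYCT_value by blast
  show "finite \<dots>"
    by (intro finite_set_of_finite_funs finite_diagram) simp
qed

lemma finite_comp_mn: "finite (comp_mn m n)"
proof -
  have "comp_mn m n = (\<lambda>as. as @ rev [1..<n + 1]) ` permutations_of_set {n + 1..n + m - 1}"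
    by (auto simp: comp_mn_def)
  then show ?thesis by simp
qed

lemma scale_card: "finite S \<Longrightarrow> scale (card S) f = (\<Sum>x\<in>S. f)"
proof (induction S rule: finite_induct)
  case empty
  show ?case by (simp add: scale_def fun_eq_iff)
next
  case (insert x S)
  have "scale (card (insert x S)) f = f + scale (card S) f"
    using insert.hyps by (intro ext) (simp add: scale_def algebra_simps)
  then show ?case by (simp only: insert.IH sum.insert[OF insert.hyps])
qed

lemma comp_set_image: "comp_set \<beta> = (\<lambda>j. sum_list (take j \<beta>)) ` {1..<length \<beta>}"
proof -
  have "{1..<length \<beta>} = {j. 1 \<le> j \<and> j < length \<beta>}" by auto
  then show ?thesis by (simp only: comp_set_def setcompr_eq_image)
qed

lemma comp_set_Cons:
  "comp_set (b # \<beta>) = (if \<beta> = [] then {} else insert b ((+) b ` comp_set \<beta>))"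
proof (cases "\<beta> = []")
  case False
  have "{1..<length (b # \<beta>)} = Suc ` {0..<length \<beta>}"
    by (simp add: image_Suc_atLeastLessThan)
  then have "comp_set (b # \<beta>) = (\<lambda>j. sum_list (take j (b # \<beta>))) ` Suc ` {0..<length \<beta>}"
    unfolding comp_set_image by (rule arg_cong)
  also have "\<dots> = (\<lambda>j. b + sum_list (take j \<beta>)) ` {0..<length \<beta>}"
    unfolding image_image by simp
  also have "{0..<length \<beta>} = insert 0 {1..<length \<beta>}"
    using False by auto
  also have "(\<lambda>j. b + sum_list (take j \<beta>)) ` insert 0 {1..<length \<beta>} = insert b ((+) b ` comp_set \<beta>)"
    unfolding comp_set_image image_insert image_image by simp
  finally show ?thesis
    by (simp only: False if_False)
qed (simp add: comp_set_def)

lemma comp_set_ge: "\<forall>b\<in>set \<beta>. 1 \<le> b \<Longrightarrow> x \<in> comp_set \<beta> \<Longrightarrow> 1 \<le> x"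
proof (induction \<beta> arbitrary: x)
  case Nil
  then show ?case by (simp add: comp_set_def)
next
  case (Cons b \<beta>)
  then show ?case by (auto simp: comp_set_Cons split: if_splits)
qed

text \<open>Parts are positive, so the first part is the least element of the set and can be split
  off; the last part is settled by the equal sums.\<close>

lemma comp_set_inj:
  assumes "\<forall>b\<in>set \<beta>. 1 \<le> b" "\<forall>b\<in>set \<gamma>. 1 \<le> b" "sum_list \<beta> = sum_list \<gamma>" "comp_set \<beta> = comp_set \<gamma>"
  shows "\<beta> = \<gamma>"
  using assms
proof (induction \<beta> arbitrary: \<gamma>)
  case Nil
  then show ?case by (cases \<gamma>) auto
next
  case (Cons b \<beta>)
  then obtain g \<gamma>' where \<gamma>: "\<gamma> = g # \<gamma>'" by (cases \<gamma>) auto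
  show ?case
  proof (cases "\<beta> = []")
    case True
    then have "\<gamma>' = []"
      using Cons.prems(4) by (auto simp: comp_set_Cons \<gamma> split: if_splits)
    then show ?thesis using True Cons.prems(3) \<gamma> by simp
  next
    case False
    then have ne: "\<gamma>' \<noteq> []"
      using Cons.prems(4) by (auto simp: comp_set_Cons \<gamma> split: if_splits)
    have eq: "insert b ((+) b ` comp_set \<beta>) = insert g ((+) g ` comp_set \<gamma>')"
      using Cons.prems(4) False ne by (simp add: comp_set_Cons \<gamma>)
    have "b \<in> insert g ((+) g ` comp_set \<gamma>')" "g \<in> insert b ((+) b ` comp_set \<beta>)"
      using eq by blast+
    then have bg: "b = g" by auto
    have pos: "1 \<le> x" if "x \<in> comp_set \<beta> \<union> comp_set \<gamma>'" for x
      using that comp_set_ge[of \<beta> x] comp_set_ge[of \<gamma>' x] Cons.prems(1,2) \<gamma> by auto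
    then have "b \<notin> (+) b ` comp_set \<beta>" "b \<notin> (+) b ` comp_set \<gamma>'"
      by fastforce+
    moreover have "insert b ((+) b ` comp_set \<beta>) = insert b ((+) b ` comp_set \<gamma>')"
      using eq bg by simp
    ultimately have "(+) b ` comp_set \<beta> = (+) b ` comp_set \<gamma>'"
      by (simp only: insert_ident not_False_eq_True)
    then have "comp_set \<beta> = comp_set \<gamma>'"
      by (simp add: inj_image_eq_iff)
    then show ?thesis
      using Cons.IH[of \<gamma>'] Cons.prems \<gamma> bg by simp
  qed
qed

lemma ex_composition:
  "S \<subseteq> {1..<d} \<Longrightarrow> \<exists>\<beta>\<in>compositions d. comp_set \<beta> = S"
proof (induction d arbitrary: S rule: less_induct)
  case (less d)
  show ?case
  proof (cases "S = {}")
    case True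
    show ?thesis
    proof (cases "d = 0")
      case True
      then show ?thesis
        using \<open>S = {}\<close> by (intro bexI[of _ "[]"]) (auto simp: compositions_def comp_set_def)
    next
      case False
      then show ?thesis
        using \<open>S = {}\<close> by (intro bexI[of _ "[d]"]) (auto simp: compositions_def comp_set_Cons)
    qed
  next
    case False
    have fin: "finite S" using less.prems finite_subset by blast
    define b where "b = Min S"
    have b: "b \<in> S" and le: "\<And>x. x \<in> S \<Longrightarrow> b \<le> x"
      using Min_in[OF fin False] Min_le[OF fin] by (auto simp: b_def)
    have bd: "1 \<le> b" "b < d" using less.prems b by auto
    define S' where "S' = (\<lambda>x. x - b) ` (S - {b})"
    have "S' \<subseteq> {1..<d - b}"
    proof
      fix y assume "y \<in> S'"
      then obtain x where x: "x \<in> S" "x \<noteq> b" "y = x - b" by (auto simp: S'_def)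
      then show "y \<in> {1..<d - b}" using le[of x] less.prems bd by auto
    qed
    then obtain \<beta> where \<beta>: "\<beta> \<in> compositions (d - b)" "comp_set \<beta> = S'"
      using less.IH[of "d - b"] bd by auto
    have ne: "\<beta> \<noteq> []" using \<beta>(1) bd by (auto simp: compositions_def)
    have "(+) b ` S' = S - {b}"
    proof -
      have "(+) b ` S' = (\<lambda>x. b + (x - b)) ` (S - {b})"
        by (simp add: S'_def image_image)
      also have "\<dots> = (\<lambda>x. x) ` (S - {b})"
        using le by (intro image_cong) auto
      finally show ?thesis by simp
    qed
    then have "comp_set (b # \<beta>) = S"
      using ne \<beta>(2) b by (auto simp: comp_set_Cons)
    moreover have "b # \<beta> \<in> compositions d"
      using \<beta>(1) bd by (auto simp: compositions_def)
    ultimately show ?thesis by blast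
  qed
qed

lemma finite_compositions: "finite (compositions d)"
proof (rule finite_subset)
  show "compositions d \<subseteq> {xs. set xs \<subseteq> {..d} \<and> length xs \<le> d}"
  proof
    fix \<alpha> assume "\<alpha> \<in> compositions d"
    then have \<alpha>: "\<forall>a\<in>set \<alpha>. 1 \<le> a" "sum_list \<alpha> = d" by (auto simp: compositions_def)
    have "length \<alpha> \<le> sum_list \<alpha>"
      using \<alpha>(1) by (induction \<alpha>) auto
    moreover have "a \<le> sum_list \<alpha>" if "a \<in> set \<alpha>" for a
      using that by (rule member_le_sum_list) simp
    ultimately show "\<alpha> \<in> {xs. set xs \<subseteq> {..d} \<and> length xs \<le> d}" using \<alpha>(2) by auto
  qed
qed (simp add: finite_lists_length_le)

text \<open>After exchanging the sums, each tableau is counted for exactly one composition, the one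
  whose partial sums form its descent set.\<close>

lemma YQS_eq:
  assumes "\<forall>r\<in>set \<alpha>. 1 \<le> r"
  shows "YQS \<alpha> = (\<Sum>\<tau>\<in>SYCT \<alpha>. fundamental_qsym (tableau_descents \<alpha> \<tau>) (sum_list \<alpha>))"
proof -
  let ?d = "sum_list \<alpha>"
  let ?Q = "\<lambda>\<tau>. fundamental_qsym (tableau_descents \<alpha> \<tau>) ?d"
  have "YQS \<alpha> = (\<Sum>\<beta>\<in>compositions ?d. \<Sum>\<tau>\<in>{\<tau> \<in> SYCT \<alpha>. tableau_descents \<alpha> \<tau> = comp_set \<beta>}. ?Q \<tau>)"
    unfolding YQS_def
  proof (rule sum.cong[OF refl])
    fix \<beta> assume "\<beta> \<in> compositions ?d"
    then have "sum_list \<beta> = ?d" by (simp add: compositions_def)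
    then show "scale (card {\<tau> \<in> SYCT \<alpha>. tableau_descents \<alpha> \<tau> = comp_set \<beta>})
        (fundamental_qsym (comp_set \<beta>) (sum_list \<beta>)) =
        (\<Sum>\<tau>\<in>{\<tau> \<in> SYCT \<alpha>. tableau_descents \<alpha> \<tau> = comp_set \<beta>}. ?Q \<tau>)"
      using finite_SYCT[of \<alpha>] by (subst scale_card) (auto intro: sum.cong)
  qed
  also have "\<dots> = (\<Sum>\<beta>\<in>compositions ?d. \<Sum>\<tau>\<in>SYCT \<alpha>. if tableau_descents \<alpha> \<tau> = comp_set \<beta> then ?Q \<tau> else 0)"
    by (intro sum.cong refl sum.inter_filter finite_SYCT)
  also have "\<dots> = (\<Sum>\<tau>\<in>SYCT \<alpha>. \<Sum>\<beta>\<in>compositions ?d. if tableau_descents \<alpha> \<tau> = comp_set \<beta> then ?Q \<tau> else 0)"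
    by (rule sum.swap)
  also have "\<dots> = (\<Sum>\<tau>\<in>SYCT \<alpha>. ?Q \<tau>)"
  proof (rule sum.cong[OF refl])
    fix \<tau> assume "\<tau> \<in> SYCT \<alpha>"
    then obtain c where c: "grow c \<alpha> \<tau>" using ex_grow_of_SYCT assms by blast
    have "tableau_descents \<alpha> \<tau> \<subseteq> {1..<?d}"
      using grow_length[OF c] by (auto simp: grow_descents[OF c] col_descents_def)
    then obtain \<beta>0 where \<beta>0: "\<beta>0 \<in> compositions ?d" "comp_set \<beta>0 = tableau_descents \<alpha> \<tau>"
      using ex_composition by blast
    have "tableau_descents \<alpha> \<tau> = comp_set \<beta> \<longleftrightarrow> \<beta> = \<beta>0" if "\<beta> \<in> compositions ?d" for \<beta>
      using comp_set_inj[of \<beta> \<beta>0] that \<beta>0 by (auto simp: compositions_def)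
    then have "(\<Sum>\<beta>\<in>compositions ?d. if tableau_descents \<alpha> \<tau> = comp_set \<beta> then ?Q \<tau> else 0) =
        (\<Sum>\<beta>\<in>compositions ?d. if \<beta> = \<beta>0 then ?Q \<tau> else 0)"
      by (intro sum.cong) auto
    also have "\<dots> = ?Q \<tau>"
      using finite_compositions \<beta>0(1) by simp
    finally show "(\<Sum>\<beta>\<in>compositions ?d. if tableau_descents \<alpha> \<tau> = comp_set \<beta> then ?Q \<tau> else 0) = ?Q \<tau>" .
  qed
  finally show ?thesis .
qed

text \<open>A column word determines shape and filling together, so the double sum over shapes and
  tableaux becomes a single sum over words.\<close>

lemma sum_YQS_eq_words:
  assumes "1 \<le> m"
  shows "(\<Sum>\<alpha>\<in>comp_mn m n. YQS \<alpha>) = (\<Sum>c\<in>words m (m + n). fundamental_qsym (col_descents c) (length c))"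
proof -
  have "(\<Sum>\<alpha>\<in>comp_mn m n. YQS \<alpha>) =
      (\<Sum>\<alpha>\<in>comp_mn m n. \<Sum>\<tau>\<in>SYCT \<alpha>. fundamental_qsym (tableau_descents \<alpha> \<tau>) (sum_list \<alpha>))"
    using comp_mn_imp[OF assms] by (intro sum.cong refl YQS_eq) blast
  also have "\<dots> = (\<Sum>(\<alpha>, \<tau>)\<in>(SIGMA \<alpha>:comp_mn m n. SYCT \<alpha>).
      fundamental_qsym (tableau_descents \<alpha> \<tau>) (sum_list \<alpha>))"
    by (intro sum.Sigma finite_comp_mn ballI finite_SYCT)
  also have "\<dots> = (\<Sum>c\<in>words m (m + n). fundamental_qsym (col_descents c) (length c))"
  proof (rule sum_eq_by_relation[where R = "\<lambda>(\<alpha>, \<tau>) c. grow c \<alpha> \<tau>"], goal_cases)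
    case (1 p)
    then obtain \<alpha> \<tau> where p: "p = (\<alpha>, \<tau>)" "\<alpha> \<in> comp_mn m n" "\<tau> \<in> SYCT \<alpha>" by auto
    note \<alpha> = comp_mn_imp[OF assms p(2)]
    then obtain c where c: "grow c \<alpha> \<tau>" using ex_grow_of_SYCT p(3) by blast
    then have "c \<in> words m (m + n)"
      using \<alpha> grow_thin_iff[OF c] grow_lattice_word[OF c] grow_hts[OF c] by (simp add: words_def)
    with c p show ?case by auto
  next
    case (2 c)
    then obtain \<alpha> \<tau> where g: "grow c \<alpha> \<tau>" using grow_ex[of c] unfolding words_def by blast
    have "\<alpha> \<in> comp_mn m n"
      using 2 grow_length[OF g] grow_hts[OF g] grow_thin_iff[OF g]
      by (intro comp_mn_intro[OF assms]) (auto simp: words_def)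
    with g grow_SYCT[OF g] show ?case by (intro bexI[of _ "(\<alpha>, \<tau>)"]) auto
  next
    case (3 p c c')
    then show ?case by (auto dest: grow_injective)
  next
    case (4 p p' c)
    then show ?case by (auto dest: grow_functional)
  next
    case (5 p c)
    then obtain \<alpha> \<tau> where p: "p = (\<alpha>, \<tau>)" "grow c \<alpha> \<tau>" by (cases p) auto
    then show ?case using grow_descents[OF p(2)] grow_length[OF p(2)] by simp
  qed
  finally show ?thesis .
qed

theorem theorem6p5:
  fixes m n :: nat
  assumes "m \<ge> 1"
  shows "YQS_positive (LMF m n) \<and> LMF m n = (\<Sum>\<alpha> \<in> comp_mn m n. YQS \<alpha>)"
proof
  show eq: "LMF m n = (\<Sum>\<alpha> \<in> comp_mn m n. YQS \<alpha>)"
    using LMF_eq_words[OF assms] sum_YQS_eq_words[OF assms] by simp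
  have scale: "scale 1 f = f" for f by (simp add: scale_def)
  show "YQS_positive (LMF m n)"
    unfolding YQS_positive_def
  proof (intro exI conjI)
    show "finite (comp_mn m n)" by (rule finite_comp_mn)
    show "comp_mn m n \<subseteq> (\<Union>d. compositions d)"
      using comp_mn_imp[OF assms] by (auto simp: compositions_def)
    show "\<forall>\<alpha>\<in>comp_mn m n. 0 < (1 :: nat)" by simp
    show "LMF m n = (\<Sum>\<alpha>\<in>comp_mn m n. scale 1 (YQS \<alpha>))"
      by (simp only: eq scale)
  qed
qed

end
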